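(* Let $G$ be a cograph minimal $(\infty,3)$-polar obstruction. Then: (1) $G$ is connected if and only if $\overline{G} \cong P_3 + H$, where $H$ is isomorphic to $K_1 \oplus C_4$, $\overline{2P_3}$, $K_2 \oplus 2K_2$, or $K_1 \oplus (K_2 + P_3)$; (2) $G$ is disconnected and has neither isolated vertices nor components isomorphic to $P_3$ if and only if $G$ is isomorphic to $2C_4$, $2(K_1 \oplus 2K_2)$, or $C_4 + (K_1 \oplus 2K_2)$; (3) $G$ is disconnected and has at least one component isomorphic to $P_3$ if and only if $G \cong P_3 + H$, where $H$ is isomorphic to $P_3 + 2K_2$, $K_2 + (K_1 \oplus 2K_2)$, $K_2 + C_4$, $K_{3,3}$, $2K_1 \oplus (K_2 + 2K_1)$, $K_1 \oplus (K_1 + 2K_2)$, $K_1 \oplus C_4$, $\overline{2P_3}$, $K_2 \oplus 2K_2$, or $K_1 \oplus (K_2 + P_3)$; (4) $G$ has exactly $5$ connected components if and only if $G$ is isomorphic to $4K_1 + (K_1 \oplus C_4)$ or to $pK_1 + (4-p)K_2 + K_{p,p}$ for some $p \in \{1,2,3,4\}$; (5) $G$ has exactly $4$ connected components and at least one isolated vertex if and only if either $G \cong 3K_1 + H$ where $H$ is isomorphic to $\overline{2P_3}$, $K_1 \oplus (P_3 + K_2)$, $K_2 \oplus 2K_2$, $K_1 \oplus (C_4 + K_1)$, $K_1 \oplus \overline{P_3 + K_2}$, or $\overline{K_2} \oplus (P_3 + K_1)$, or $G$ is isomorphic to $pK_1 + (3-p)K_2 + (2K_1 \oplus (K_2 +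 pK_1))$ for some $p \in \{1,2,3\}$; (6) $G$ has exactly $3$ connected components and at least one isolated vertex if and only if either $G \cong 2K_1 + H$ where $H$ is isomorphic to $K_1 \oplus (C_4 + 2K_1)$, $K_1 \oplus 2P_3$, $K_1 \oplus (K_1 + \overline{P_3 + K_2})$, $K_1 \oplus (K_2 + \overline{P_3 + K_1})$, $K_2 \oplus (K_1 + 2K_2)$, $K_1 \oplus (K_1 + K_2 + P_3)$, or $K_1 \oplus (K_1 + (K_1 \oplus 2K_2))$, or $G$ is isomorphic to $pK_1 + (2-p)K_2 + (K_1 \oplus (2K_2 + pK_1))$ for some $p \in \{1,2\}$; (7) $G$ has exactly $2$ connected components and one isolated vertex if and only if $G \cong K_1 + (K_1 \oplus H)$, where $H$ is isomorphic to $P_3 + C_4$, $P_3 + (K_1 \oplus 2K_2)$, $2P_3 + K_2$, $K_1 + 3K_2$, $2K_1 + K_2 + C_4$, $3K_1 + K_{3,3}$, $K_1 + K_2 + (2K_1 \oplus (K_2 + K_1))$, $2K_1 + (2K_1 \oplus (K_2 + 2K_1))$, or $K_1 + (K_1 \oplus (K_1 + 2K_2))$. In conclusion, a graph $G$ is a cograph minimal $(\infty,3)$-polar obstruction if and only if it is isomorphic to one of the $49$ cographs listed above.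
   Context: All graphs are finite and simple. A cograph is a graph with no induced subgraph isomorphic to $P_4$. $G+H$ denotes disjoint union, $G \oplus H$ the join (disjoint union plus all edges between $G$ and $H$), $nG$ the disjoint union of $n$ copies of $G$ ($0G$ is the empty graph), $\overline{G}$ the complement of $G$; $K_n$, $P_n$, $C_n$ are the complete graph, path and cycle on $n$ vertices and $K_{p,q}$ the complete bipartite graph. A cluster is a disjoint union of complete graphs. For $s,k \in \mathbb{Z}_{\ge 0}\cup\{\infty\}$, an $(s,k)$-polar partition of $G$ is a partition $(A,B)$ of $V(G)$ (parts may be empty) such that $G[A]$ is a complete multipartite graph with at most $s$ parts and $G[B]$ is a cluster with at most $k$ components; $\infty$ means unbounded. $G$ is $(s,k)$-polar if it has such a partition. A cograph minimal $(s,k)$-polar obstruction is a cograph that is not $(s,k)$-polar but all of whose proper induced subgraphs are $(s,k)$-polar. *)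

theory Defs
  imports "Graph_Theory.Graph_Theory" "HOL-Library.Disjoint_Sets" "HOL-Library.Extended_Nat"
begin

text \<open>
  Finite simple graphs are the \<^locale>\<open>graph\<close>s of Graph_Theory, i.e. finite loop-free symmetric
  digraphs without parallel arcs; an undirected edge is a pair of opposite arcs. On symmetric
  digraphs the strongly connected components are the connected components.
\<close>

abbreviation components :: "('a, 'b) pre_digraph \<Rightarrow> ('a, 'b) pre_digraph set" where
  "components G \<equiv> pre_digraph.sccs G"

abbreviation graph_iso :: "('a, 'b) pre_digraph \<Rightarrow> ('c, 'd) pre_digraph \<Rightarrow> bool"
    (infix \<open>\<simeq>\<close> 50) where
  "G \<simeq> H \<equiv> digraph_iso G H"

definition isolated_vertices :: "('a, 'b) pre_digraph \<Rightarrow> 'a set" where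
  "isolated_vertices G = {v \<in> verts G. \<forall>u. \<not> v \<rightarrow>\<^bsub>G\<^esub> u}"

definition complement :: "('a, 'b) pre_digraph \<Rightarrow> 'a pair_pre_digraph" where
  "complement G = \<lparr> pverts = verts G,
     parcs = {(u, v). u \<in> verts G \<and> v \<in> verts G \<and> u \<noteq> v \<and> \<not> u \<rightarrow>\<^bsub>G\<^esub> v} \<rparr>"


section \<open>Concrete graphs\<close>

definition empty_graph :: "nat pair_pre_digraph" where
  "empty_graph = \<lparr> pverts = {}, parcs = {} \<rparr>"

definition complete_graph :: "nat \<Rightarrow> nat pair_pre_digraph" where
  "complete_graph n = \<lparr> pverts = {..<n}, parcs = {(u, v). u < n \<and> v < n \<and> u \<noteq> v} \<rparr>"

definition path_graph :: "nat \<Rightarrow> nat pair_pre_digraph" where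
  "path_graph n = \<lparr> pverts = {..<n},
     parcs = {(u, v). u < n \<and> v < n \<and> (v = Suc u \<or> u = Suc v)} \<rparr>"

text \<open>Meaningful for \<open>n \<ge> 3\<close> only.\<close>

definition cycle_graph :: "nat \<Rightarrow> nat pair_pre_digraph" where
  "cycle_graph n = \<lparr> pverts = {..<n},
     parcs = {(u, v). u < n \<and> v < n \<and> (v = Suc u mod n \<or> u = Suc v mod n)} \<rparr>"

definition complete_bipartite_graph :: "nat \<Rightarrow> nat \<Rightarrow> nat pair_pre_digraph" where
  "complete_bipartite_graph p q = \<lparr> pverts = {..<p + q},
     parcs = {(u, v). u < p + q \<and> v < p + q \<and> (u < p) \<noteq> (v < p)} \<rparr>"

text \<open>
  To stay within vertex type \<^typ>\<open>nat\<close>, the first operand of a disjoint union is moved to the even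
  and the second one to the odd numbers.
\<close>

definition disjoint_union ::
    "nat pair_pre_digraph \<Rightarrow> nat pair_pre_digraph \<Rightarrow> nat pair_pre_digraph" (infixl \<open>\<uplus>\<close> 65) where
  "G \<uplus> H = \<lparr> pverts = (\<lambda>u. 2 * u) ` pverts G \<union> (\<lambda>u. 2 * u + 1) ` pverts H,
     parcs = (\<lambda>(u, v). (2 * u, 2 * v)) ` parcs G \<union>
             (\<lambda>(u, v). (2 * u + 1, 2 * v + 1)) ` parcs H \<rparr>"

definition join ::
    "nat pair_pre_digraph \<Rightarrow> nat pair_pre_digraph \<Rightarrow> nat pair_pre_digraph" (infixl \<open>\<oplus>\<close> 70) where
  "G \<oplus> H = \<lparr> pverts = pverts (G \<uplus> H),
     parcs = parcs (G \<uplus> H) \<union>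
       (\<Union>u\<in>pverts G. \<Union>v\<in>pverts H. {(2 * u, 2 * v + 1), (2 * v + 1, 2 * u)}) \<rparr>"

primrec copies :: "nat \<Rightarrow> nat pair_pre_digraph \<Rightarrow> nat pair_pre_digraph" (infixr \<open>\<cdot>\<close> 80) where
  "0 \<cdot> G = empty_graph"
| "Suc n \<cdot> G = G \<uplus> n \<cdot> G"

abbreviation "K\<^sub>1 \<equiv> complete_graph 1"
abbreviation "K\<^sub>2 \<equiv> complete_graph 2"
abbreviation "P\<^sub>3 \<equiv> path_graph 3"
abbreviation "P\<^sub>4 \<equiv> path_graph 4"
abbreviation "C\<^sub>4 \<equiv> cycle_graph 4"


section \<open>Cographs and polarity\<close>

definition cograph :: "('a, 'b) pre_digraph \<Rightarrow> bool" where
  "cograph G \<longleftrightarrow> graph G \<and> \<not> (\<exists>H. induced_subgraph H G \<and> H \<simeq> P\<^sub>4)"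

text \<open>
  Parts are nonempty, so the graph without vertices is complete multipartite with \<open>0\<close> parts and a
  cluster with \<open>0\<close> components.
\<close>

definition complete_multipartite_le :: "enat \<Rightarrow> ('a, 'b) pre_digraph \<Rightarrow> bool" where
  "complete_multipartite_le s G \<longleftrightarrow>
     (\<exists>\<P>. partition_on (verts G) \<P> \<and> finite \<P> \<and> enat (card \<P>) \<le> s \<and>
       (\<forall>u\<in>verts G. \<forall>v\<in>verts G. u \<rightarrow>\<^bsub>G\<^esub> v \<longleftrightarrow> \<not> (\<exists>P\<in>\<P>. u \<in> P \<and> v \<in> P)))"

definition cluster_le :: "enat \<Rightarrow> ('a, 'b) pre_digraph \<Rightarrow> bool" where
  "cluster_le k G \<longleftrightarrow>
     (\<forall>C\<in>components G. complete_digraph (card (verts C)) C) \<and>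
     finite (components G) \<and> enat (card (components G)) \<le> k"

definition polar_partition ::
    "enat \<Rightarrow> enat \<Rightarrow> ('a, 'b) pre_digraph \<Rightarrow> 'a set \<Rightarrow> 'a set \<Rightarrow> bool" where
  "polar_partition s k G A B \<longleftrightarrow>
     A \<union> B = verts G \<and> A \<inter> B = {} \<and>
     complete_multipartite_le s (G \<restriction> A) \<and> cluster_le k (G \<restriction> B)"

definition polar :: "enat \<Rightarrow> enat \<Rightarrow> ('a, 'b) pre_digraph \<Rightarrow> bool" where
  "polar s k G \<longleftrightarrow> (\<exists>A B. polar_partition s k G A B)"

definition cograph_minimal_polar_obstruction ::
    "enat \<Rightarrow> enat \<Rightarrow> ('a, 'b) pre_digraph \<Rightarrow> bool" where
  "cograph_minimal_polar_obstruction s k G \<longleftrightarrow>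
     cograph G \<and> \<not> polar s k G \<and>
     (\<forall>H. induced_subgraph H G \<and> H \<noteq> G \<longrightarrow> polar s k H)"


section \<open>The listed graphs\<close>

definition co_connected_summands :: "nat pair_pre_digraph list" where
  "co_connected_summands =
    [K\<^sub>1 \<oplus> C\<^sub>4, complement (2 \<cdot> P\<^sub>3), K\<^sub>2 \<oplus> 2 \<cdot> K\<^sub>2, K\<^sub>1 \<oplus> (K\<^sub>2 \<uplus> P\<^sub>3)]"

definition no_isolated_no_P3_obstructions :: "nat pair_pre_digraph list" where
  "no_isolated_no_P3_obstructions =
    [2 \<cdot> C\<^sub>4, 2 \<cdot> (K\<^sub>1 \<oplus> 2 \<cdot> K\<^sub>2), C\<^sub>4 \<uplus> (K\<^sub>1 \<oplus> 2 \<cdot> K\<^sub>2)]"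

definition P3_summands :: "nat pair_pre_digraph list" where
  "P3_summands =
    [P\<^sub>3 \<uplus> 2 \<cdot> K\<^sub>2, K\<^sub>2 \<uplus> (K\<^sub>1 \<oplus> 2 \<cdot> K\<^sub>2), K\<^sub>2 \<uplus> C\<^sub>4,
     complete_bipartite_graph 3 3, 2 \<cdot> K\<^sub>1 \<oplus> (K\<^sub>2 \<uplus> 2 \<cdot> K\<^sub>1), K\<^sub>1 \<oplus> (K\<^sub>1 \<uplus> 2 \<cdot> K\<^sub>2),
     K\<^sub>1 \<oplus> C\<^sub>4, complement (2 \<cdot> P\<^sub>3), K\<^sub>2 \<oplus> 2 \<cdot> K\<^sub>2, K\<^sub>1 \<oplus> (K\<^sub>2 \<uplus> P\<^sub>3)]"

definition five_components_obstruction :: "nat pair_pre_digraph" where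
  "five_components_obstruction = 4 \<cdot> K\<^sub>1 \<uplus> (K\<^sub>1 \<oplus> C\<^sub>4)"

definition five_components_family :: "nat \<Rightarrow> nat pair_pre_digraph" where
  "five_components_family p = p \<cdot> K\<^sub>1 \<uplus> (4 - p) \<cdot> K\<^sub>2 \<uplus> complete_bipartite_graph p p"

definition four_components_summands :: "nat pair_pre_digraph list" where
  "four_components_summands =
    [complement (2 \<cdot> P\<^sub>3), K\<^sub>1 \<oplus> (P\<^sub>3 \<uplus> K\<^sub>2), K\<^sub>2 \<oplus> 2 \<cdot> K\<^sub>2, K\<^sub>1 \<oplus> (C\<^sub>4 \<uplus> K\<^sub>1),
     K\<^sub>1 \<oplus> complement (P\<^sub>3 \<uplus> K\<^sub>2), complement K\<^sub>2 \<oplus> (P\<^sub>3 \<uplus> K\<^sub>1)]"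

definition four_components_family :: "nat \<Rightarrow> nat pair_pre_digraph" where
  "four_components_family p =
    p \<cdot> K\<^sub>1 \<uplus> (3 - p) \<cdot> K\<^sub>2 \<uplus> (2 \<cdot> K\<^sub>1 \<oplus> (K\<^sub>2 \<uplus> p \<cdot> K\<^sub>1))"

definition three_components_summands :: "nat pair_pre_digraph list" where
  "three_components_summands =
    [K\<^sub>1 \<oplus> (C\<^sub>4 \<uplus> 2 \<cdot> K\<^sub>1), K\<^sub>1 \<oplus> 2 \<cdot> P\<^sub>3, K\<^sub>1 \<oplus> (K\<^sub>1 \<uplus> complement (P\<^sub>3 \<uplus> K\<^sub>2)),
     K\<^sub>1 \<oplus> (K\<^sub>2 \<uplus> complement (P\<^sub>3 \<uplus> K\<^sub>1)), K\<^sub>2 \<oplus> (K\<^sub>1 \<uplus> 2 \<cdot> K\<^sub>2),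
     K\<^sub>1 \<oplus> (K\<^sub>1 \<uplus> K\<^sub>2 \<uplus> P\<^sub>3), K\<^sub>1 \<oplus> (K\<^sub>1 \<uplus> (K\<^sub>1 \<oplus> 2 \<cdot> K\<^sub>2))]"

definition three_components_family :: "nat \<Rightarrow> nat pair_pre_digraph" where
  "three_components_family p =
    p \<cdot> K\<^sub>1 \<uplus> (2 - p) \<cdot> K\<^sub>2 \<uplus> (K\<^sub>1 \<oplus> (2 \<cdot> K\<^sub>2 \<uplus> p \<cdot> K\<^sub>1))"

definition two_components_summands :: "nat pair_pre_digraph list" where
  "two_components_summands =
    [P\<^sub>3 \<uplus> C\<^sub>4, P\<^sub>3 \<uplus> (K\<^sub>1 \<oplus> 2 \<cdot> K\<^sub>2), 2 \<cdot> P\<^sub>3 \<uplus> K\<^sub>2, K\<^sub>1 \<uplus> 3 \<cdot> K\<^sub>2,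
     2 \<cdot> K\<^sub>1 \<uplus> K\<^sub>2 \<uplus> C\<^sub>4, 3 \<cdot> K\<^sub>1 \<uplus> complete_bipartite_graph 3 3,
     K\<^sub>1 \<uplus> K\<^sub>2 \<uplus> (2 \<cdot> K\<^sub>1 \<oplus> (K\<^sub>2 \<uplus> K\<^sub>1)), 2 \<cdot> K\<^sub>1 \<uplus> (2 \<cdot> K\<^sub>1 \<oplus> (K\<^sub>2 \<uplus> 2 \<cdot> K\<^sub>1)),
     K\<^sub>1 \<uplus> (K\<^sub>1 \<oplus> (K\<^sub>1 \<uplus> 2 \<cdot> K\<^sub>2))]"

definition listed_cographs :: "nat pair_pre_digraph list" where
  "listed_cographs =
     map (\<lambda>H. complement (P\<^sub>3 \<uplus> H)) co_connected_summands @
     no_isolated_no_P3_obstructions @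
     map (\<lambda>H. P\<^sub>3 \<uplus> H) P3_summands @
     five_components_obstruction # map five_components_family [1, 2, 3, 4] @
     map (\<lambda>H. 3 \<cdot> K\<^sub>1 \<uplus> H) four_components_summands @ map four_components_family [1, 2, 3] @
     map (\<lambda>H. 2 \<cdot> K\<^sub>1 \<uplus> H) three_components_summands @ map three_components_family [1, 2] @
     map (\<lambda>H. K\<^sub>1 \<uplus> (K\<^sub>1 \<oplus> H)) two_components_summands"

end

theory Submission
  imports Defs "HOL-Library.Multiset"
begin

text \<open>
  A cograph is built from single vertices by disjoint unions and joins. Whether it is
  \<open>(\<infinity>, 3)\<close>-polar is determined by its profile, three numbers below \<open>5\<close> that behave
  compositionally under both operations and grow with the graph; only \<open>24\<close> profiles occur.
  If a graph is minimal among the graphs with profile at least \<open>s\<close>, then the two operands of its last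
  operation are minimal for the members of a pair of profiles that is itself minimal among those
  whose combination is at least \<open>s\<close>. Hence the minimal graphs for all profiles can be
  found by a finite simultaneous recursion, and the obstructions are the minimal graphs of the top
  profile. Degree sequences tell the \<open>49\<close> of them apart.
\<close>


section \<open>Cotrees\<close>

text \<open>Polarity alone is not compositional. In a disjoint union, a complete multipartite part
  that meets both sides is an independent set, and a part that avoids a side leaves that whole side
  to the cluster. This forces the other two numbers of a profile. The cap \<open>4\<close> is one
  more than the largest admissible number of cliques, and \<open>(4, 4, 4)\<close> is the only
  occurring profile whose third entry exceeds \<open>3\<close>.

  The operands of an obstruction need not be obstructions; they are minimal only for the profiles
  that a rule demands of them. Therefore all targets \<open>s\<close> are treated together, and a
  target is a lower bound for a profile, not its exact value.

  The tables are certified in one direction: every minimal graph has a cotree in the table of its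
  target. That the final graphs are minimal obstructions is a separate evaluation of their vertex
  deletions, sufficient because polarity is hereditary. One graph has many binary cotrees, so a
  normal form is needed to recognise table entries.\<close>

datatype cotree = Leaf | Node bool cotree cotree

text \<open>\<open>E\<close> is constrained only on \<open>V\<close>, so subgraphs can share the
  relation of the whole graph. Requiring both \<open>E a b\<close> and \<open>E b a\<close> makes
  every realized relation symmetric on \<open>V\<close>. The label \<open>True\<close> is a join,
  \<open>False\<close> a disjoint union.\<close>

fun realizes :: "cotree \<Rightarrow> 'a set \<Rightarrow> ('a \<Rightarrow> 'a \<Rightarrow> bool) \<Rightarrow> bool" where
  "realizes Leaf V E \<longleftrightarrow> (\<exists>v. V = {v} \<and> \<not> E v v)"
| "realizes (Node j s t) V E \<longleftrightarrow> (\<exists>A B. V = A \<union> B \<and> A \<inter> B = {} \<and> realizes s A E \<and> realizes t B E \<and>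
     (\<forall>a\<in>A. \<forall>b\<in>B. E a b = j \<and> E b a = j))"

lemma realizes_NodeI:
  "\<lbrakk>realizes s A E; realizes t B E; A \<inter> B = {}; \<forall>a\<in>A. \<forall>b\<in>B. E a b = j \<and> E b a = j\<rbrakk>
    \<Longrightarrow> realizes (Node j s t) (A \<union> B) E"
  by auto

lemma realizes_finite: "realizes t V E \<Longrightarrow> finite V"
  by (induction t arbitrary: V) auto

lemma realizes_nonempty: "realizes t V E \<Longrightarrow> V \<noteq> {}"
  by (induction t arbitrary: V) auto

lemma realizes_commute: "realizes (Node j s t) V E \<longleftrightarrow> realizes (Node j t s) V E"
proof -
  have "realizes (Node j t s) V E" if st: "realizes (Node j s t) V E" for s t
  proof -
    from st obtain A B where *: "V = A \<union> B" "A \<inter> B = {}" "realizes s A E" "realizes t B E"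
      "\<forall>a\<in>A. \<forall>b\<in>B. E a b = j \<and> E b a = j" by auto
    then have "realizes (Node j t s) (B \<union> A) E" by (intro realizes_NodeI) auto
    then show ?thesis using * by (simp only: Un_commute)
  qed
  then show ?thesis by blast
qed

lemma realizes_assoc:
  "realizes (Node j (Node j s t) u) V E \<longleftrightarrow> realizes (Node j s (Node j t u)) V E"
proof
  assume "realizes (Node j (Node j s t) u) V E"
  then obtain A B C where *: "V = (A \<union> B) \<union> C" "(A \<union> B) \<inter> C = {}" "A \<inter> B = {}"
    "realizes s A E" "realizes t B E" "realizes u C E"
    "\<forall>a\<in>A \<union> B. \<forall>b\<in>C. E a b = j \<and> E b a = j" "\<forall>a\<in>A. \<forall>b\<in>B. E a b = j \<and> E b a = j"
    by auto
  have "realizes (Node j s (Node j t u)) (A \<union> (B \<union> C)) E"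
    by (intro realizes_NodeI) (use * in auto)
  then show "realizes (Node j s (Node j t u)) V E"
    using * by (simp only: Un_assoc)
next
  assume "realizes (Node j s (Node j t u)) V E"
  then obtain A B C where *: "V = A \<union> (B \<union> C)" "A \<inter> (B \<union> C) = {}" "B \<inter> C = {}"
    "realizes s A E" "realizes t B E" "realizes u C E"
    "\<forall>a\<in>A. \<forall>b\<in>B \<union> C. E a b = j \<and> E b a = j" "\<forall>a\<in>B. \<forall>b\<in>C. E a b = j \<and> E b a = j"
    by auto
  have "realizes (Node j (Node j s t) u) ((A \<union> B) \<union> C) E"
    by (intro realizes_NodeI) (use * in auto)
  then show "realizes (Node j (Node j s t) u) V E"
    using * by (simp only: Un_assoc)
qed

lemma realizes_Node_cong:
  assumes "\<And>W. realizes s W E \<longleftrightarrow> realizes s' W E" "\<And>W. realizes t W E \<longleftrightarrow> realizes t' W E"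
  shows "realizes (Node j s t) V E \<longleftrightarrow> realizes (Node j s' t') V E"
  using assms by simp

lemma realizes_cong:
  "(\<And>u v. u \<in> V \<Longrightarrow> v \<in> V \<Longrightarrow> E u v = E' u v) \<Longrightarrow> realizes t V E \<Longrightarrow> realizes t V E'"
proof (induction t arbitrary: V)
  case (Node j s t)
  from Node.prems(2) obtain A B where *: "V = A \<union> B" "A \<inter> B = {}"
    "realizes s A E" "realizes t B E" "\<forall>a\<in>A. \<forall>b\<in>B. E a b = j \<and> E b a = j" by auto
  have "realizes s A E'" by (rule Node.IH(1)[OF _ *(3)]) (use * Node.prems(1) in auto)
  moreover have "realizes t B E'" by (rule Node.IH(2)[OF _ *(4)]) (use * Node.prems(1) in auto)
  ultimately show ?case unfolding *(1)
    by (intro realizes_NodeI) (use * Node.prems(1) in auto)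
qed auto

section \<open>Complements and isomorphisms of realizations\<close>

fun co_tree :: "cotree \<Rightarrow> cotree" where
  "co_tree Leaf = Leaf"
| "co_tree (Node j s t) = Node (\<not> j) (co_tree s) (co_tree t)"

lemma co_tree_co_tree [simp]: "co_tree (co_tree t) = t"
  by (induction t) auto

lemma realizes_co_tree:
  "realizes t V E \<Longrightarrow> realizes (co_tree t) V (\<lambda>u v. u \<noteq> v \<and> \<not> E u v)"
proof (induction t arbitrary: V)
  case (Node j s t)
  then obtain A B where *: "V = A \<union> B" "A \<inter> B = {}"
    "realizes s A E" "realizes t B E" "\<forall>a\<in>A. \<forall>b\<in>B. E a b = j \<and> E b a = j" by auto
  then show ?case unfolding *(1) co_tree.simps
    by (intro realizes_NodeI Node.IH) auto
qed auto

lemma realizes_transfer: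
  assumes "realizes t V E" "inj_on f V" "\<And>u v. u \<in> V \<Longrightarrow> v \<in> V \<Longrightarrow> E u v = E' (f u) (f v)"
  shows "realizes t (f ` V) E'"
  using assms
proof (induction t arbitrary: V)
  case (Node j s t)
  from Node.prems(1) obtain A B where *: "V = A \<union> B" "A \<inter> B = {}"
    "realizes s A E" "realizes t B E" "\<forall>a\<in>A. \<forall>b\<in>B. E a b = j \<and> E b a = j" by auto
  have "realizes s (f ` A) E'"
    by (rule Node.IH(1)[OF *(3)]) (use * Node.prems(2,3) in \<open>auto intro: inj_on_subset\<close>)
  moreover have "realizes t (f ` B) E'"
    by (rule Node.IH(2)[OF *(4)]) (use * Node.prems(2,3) in \<open>auto intro: inj_on_subset\<close>)
  moreover have "f ` A \<inter> f ` B = {}"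
    using inj_on_image_Int[OF Node.prems(2), of A B] * by simp
  ultimately show ?case unfolding *(1) image_Un
    by (intro realizes_NodeI) (use * Node.prems(3) in auto)
qed auto

text \<open>A cotree fixes its graph up to isomorphism: the bijections of the two operands are
  glued, and pairs across the operands agree because both graphs follow the label \<open>j\<close>
  there.\<close>

lemma realizes_iso:
  assumes "realizes t V E" "realizes t V' E'"
  obtains f where "bij_betw f V V'" "\<And>u v. u \<in> V \<Longrightarrow> v \<in> V \<Longrightarrow> E u v = E' (f u) (f v)"
proof -
  have "\<exists>f. bij_betw f V V' \<and> (\<forall>u\<in>V. \<forall>v\<in>V. E u v = E' (f u) (f v))"
    using assms
  proof (induction t arbitrary: V V')
    case Leaf
    then obtain v v' where "V = {v}" "\<not> E v v" "V' = {v'}" "\<not> E' v' v'" by auto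
    then show ?case by (intro exI[of _ "\<lambda>_. v'"]) (auto simp: bij_betw_def)
  next
    case (Node j s t)
    obtain A B where *: "V = A \<union> B" "A \<inter> B = {}"
      "realizes s A E" "realizes t B E" "\<forall>a\<in>A. \<forall>b\<in>B. E a b = j \<and> E b a = j"
      using Node.prems(1) by auto
    obtain A' B' where **: "V' = A' \<union> B'" "A' \<inter> B' = {}"
      "realizes s A' E'" "realizes t B' E'" "\<forall>a\<in>A'. \<forall>b\<in>B'. E' a b = j \<and> E' b a = j"
      using Node.prems(2) by auto
    obtain f where f: "bij_betw f A A'" "\<forall>u\<in>A. \<forall>v\<in>A. E u v = E' (f u) (f v)"
      using Node.IH(1) * ** by blast
    obtain g where g: "bij_betw g B B'" "\<forall>u\<in>B. \<forall>v\<in>B. E u v = E' (g u) (g v)"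
      using Node.IH(2) * ** by blast
    define h where "h v = (if v \<in> A then f v else g v)" for v
    have hA: "h v = f v" if "v \<in> A" for v using that by (simp add: h_def)
    have hB: "h v = g v" if "v \<in> B" for v using that *(2) by (auto simp: h_def)
    have "bij_betw h A A'" "bij_betw h B B'"
      using f(1) g(1) by (auto simp: hA hB cong: bij_betw_cong)
    then have "bij_betw h V V'" unfolding *(1) **(1) using **(2) by (rule bij_betw_combine)
    moreover have "E u v = E' (h u) (h v)" if "u \<in> V" "v \<in> V" for u v
    proof -
      have "f a \<in> A'" if "a \<in> A" for a using f(1) that by (rule bij_betwE[rule_format])
      moreover have "g b \<in> B'" if "b \<in> B" for b using g(1) that by (rule bij_betwE[rule_format])
      ultimately show ?thesis using that *(1,2,5) **(5) f(2) g(2) by (auto simp: hA hB)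
    qed
    ultimately show ?case by blast
  qed
  then show thesis using that by blast
qed

text \<open>The empty graph has no cotree. Hence \<open>Leaf\<close> has no deletion, and deleting a
  leaf operand collapses the node to the other operand.\<close>

fun deletions :: "cotree \<Rightarrow> cotree list" where
  "deletions Leaf = []"
| "deletions (Node j s t) =
     (if s = Leaf then [t] else map (\<lambda>s'. Node j s' t) (deletions s)) @
     (if t = Leaf then [s] else map (Node j s) (deletions t))"

lemma realizes_deletion:
  "realizes t V E \<Longrightarrow> d \<in> set (deletions t) \<Longrightarrow> \<exists>v\<in>V. realizes d (V - {v}) E"
proof (induction t arbitrary: V d)
  case (Node j s t)
  from Node.prems(1) obtain A B where *: "V = A \<union> B" "A \<inter> B = {}"
    "realizes s A E" "realizes t B E" "\<forall>a\<in>A. \<forall>b\<in>B. E a b = j \<and> E b a = j" by auto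
  consider "s = Leaf" "d = t" | "t = Leaf" "d = s"
    | s' where "s' \<in> set (deletions s)" "d = Node j s' t"
    | t' where "t' \<in> set (deletions t)" "d = Node j s t'"
    using Node.prems(2) by (auto split: if_splits)
  then show ?case
  proof cases
    case 1
    then obtain v where "A = {v}" using * by auto
    then have "V - {v} = B" "v \<in> V" using * by auto
    then show ?thesis using * 1 by auto
  next
    case 2
    then obtain v where "B = {v}" using * by auto
    then have "V - {v} = A" "v \<in> V" using * by auto
    then show ?thesis using * 2 by auto
  next
    case 3
    then obtain v where v: "v \<in> A" "realizes s' (A - {v}) E" using Node.IH(1) * by blast
    have "V - {v} = (A - {v}) \<union> B" using * v by auto
    moreover have "realizes d ((A - {v}) \<union> B) E"
      unfolding 3 by (intro realizes_NodeI) (use * v in auto)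
    ultimately show ?thesis using v * by (intro bexI[of _ v]) simp_all
  next
    case 4
    then obtain v where v: "v \<in> B" "realizes t' (B - {v}) E" using Node.IH(2) * by blast
    have "V - {v} = A \<union> (B - {v})" using * v by auto
    moreover have "realizes d (A \<union> (B - {v})) E"
      unfolding 4 by (intro realizes_NodeI) (use * v in auto)
    ultimately show ?thesis using v * by (intro bexI[of _ v]) simp_all
  qed
qed auto

text \<open>Together with \<open>realizes_deletion\<close>, this makes \<open>deletions\<close> an
  enumeration of the vertex-deleted subgraphs up to isomorphism, so that minimality becomes
  computable.\<close>

lemma realizes_delete_vertex:
  "realizes t V E \<Longrightarrow> t \<noteq> Leaf \<Longrightarrow> v \<in> V \<Longrightarrow> \<exists>d\<in>set (deletions t). realizes d (V - {v}) E"
proof (induction t arbitrary: V)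
  case (Node j s t)
  from Node.prems(1) obtain A B where *: "V = A \<union> B" "A \<inter> B = {}"
    "realizes s A E" "realizes t B E" "\<forall>a\<in>A. \<forall>b\<in>B. E a b = j \<and> E b a = j" by auto
  show ?case
  proof (cases "v \<in> A")
    case True
    then have V: "V - {v} = (A - {v}) \<union> B" using * by auto
    show ?thesis
    proof (cases "s = Leaf")
      case s: True
      then have "V - {v} = B" using * True V by auto
      then show ?thesis using * s by (intro bexI[of _ t]) auto
    next
      case False
      then obtain d where d: "d \<in> set (deletions s)" "realizes d (A - {v}) E"
        using Node.IH(1) * True by blast
      have "realizes (Node j d t) (V - {v}) E"
        unfolding V by (intro realizes_NodeI) (use * d in auto)
      moreover have "Node j d t \<in> set (deletions (Node j s t))" using d False by simp
      ultimately show ?thesis by blast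
    qed
  next
    case False
    then have vB: "v \<in> B" using * Node.prems by auto
    then have V: "V - {v} = A \<union> (B - {v})" using * by auto
    show ?thesis
    proof (cases "t = Leaf")
      case t: True
      then have "V - {v} = A" using * vB V by auto
      then show ?thesis using * t by (intro bexI[of _ s]) auto
    next
      case False
      then obtain d where d: "d \<in> set (deletions t)" "realizes d (B - {v}) E"
        using Node.IH(2) * vB by blast
      have "realizes (Node j s d) (V - {v}) E"
        unfolding V by (intro realizes_NodeI) (use * d in auto)
      moreover have "Node j s d \<in> set (deletions (Node j s t))" using d False by simp
      ultimately show ?thesis by blast
    qed
  qed
qed simp

section \<open>Degree sequences read off a cotree\<close>

fun leaves :: "cotree \<Rightarrow> nat" where
  "leaves Leaf = 1"
| "leaves (Node j s t) = leaves s + leaves t"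

fun degrees :: "cotree \<Rightarrow> nat list" where
  "degrees Leaf = [0]"
| "degrees (Node j s t) =
     (if j then map ((+) (leaves t)) (degrees s) @ map ((+) (leaves s)) (degrees t)
      else degrees s @ degrees t)"

lemma card_realizes: "realizes t V E \<Longrightarrow> card V = leaves t"
proof (induction t arbitrary: V)
  case (Node j s t)
  then obtain A B where "V = A \<union> B" "A \<inter> B = {}" "realizes s A E" "realizes t B E" by auto
  then show ?case using Node.IH by (simp add: card_Un_disjoint realizes_finite)
qed auto

lemma mset_degrees:
  "realizes t V E \<Longrightarrow> mset (degrees t) = image_mset (\<lambda>v. card {u \<in> V. E v u}) (mset_set V)"
proof (induction t arbitrary: V)
  case Leaf
  then obtain v where "V = {v}" "\<not> E v v" by auto
  moreover from this have "{u \<in> V. E v u} = {}" by auto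
  ultimately show ?case by simp
next
  case (Node j s t)
  from Node.prems(1) obtain A B where *: "V = A \<union> B" "A \<inter> B = {}"
    "realizes s A E" "realizes t B E" "\<forall>a\<in>A. \<forall>b\<in>B. E a b = j \<and> E b a = j" by auto
  have fin: "finite A" "finite B" using *(3,4) realizes_finite by blast+
  have A: "card {u \<in> V. E v u} = (if j then leaves t else 0) + card {u \<in> A. E v u}" if "v \<in> A" for v
  proof -
    have "{u \<in> V. E v u} = {u \<in> A. E v u} \<union> (if j then B else {})" using that * by auto
    then show ?thesis using fin card_realizes[OF *(4)] *(2)
      by (subst \<open>{u \<in> V. E v u} = _\<close>, subst card_Un_disjoint) auto
  qed
  have B: "card {u \<in> V. E v u} = (if j then leaves s else 0) + card {u \<in> B. E v u}" if "v \<in> B" for v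
  proof -
    have "{u \<in> V. E v u} = {u \<in> B. E v u} \<union> (if j then A else {})" using that * by auto
    then show ?thesis using fin card_realizes[OF *(3)] *(2)
      by (subst \<open>{u \<in> V. E v u} = _\<close>, subst card_Un_disjoint) auto
  qed
  have "mset_set V = mset_set A + mset_set B" using * fin by (simp add: mset_set_Union)
  moreover have "image_mset (\<lambda>v. card {u \<in> V. E v u}) (mset_set A) =
      image_mset (\<lambda>v. (if j then leaves t else 0) + card {u \<in> A. E v u}) (mset_set A)"
    by (rule image_mset_cong) (use fin A in auto)
  moreover have "image_mset (\<lambda>v. card {u \<in> V. E v u}) (mset_set B) =
      image_mset (\<lambda>v. (if j then leaves s else 0) + card {u \<in> B. E v u}) (mset_set B)"
    by (rule image_mset_cong) (use fin B in auto)
  ultimately show ?case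
    using Node.IH(1)[OF *(3)] Node.IH(2)[OF *(4)]
    by (auto simp: multiset.map_comp comp_def)
qed

text \<open>The multiset of degrees belongs to the graph and not to the cotree; sorting turns it
  into a comparable invariant, which later separates the listed graphs.\<close>

lemma realizes_sort_degrees:
  "realizes s V E \<Longrightarrow> realizes t V E \<Longrightarrow> sort (degrees s) = sort (degrees t)"
  by (metis mset_degrees properties_for_sort mset_sort sorted_sort)

section \<open>Polarity of unions and joins\<close>

text \<open>The colouring \<open>c\<close> names the cliques of a cluster.\<close>

definition is_cluster :: "nat \<Rightarrow> 'a set \<Rightarrow> ('a \<Rightarrow> 'a \<Rightarrow> bool) \<Rightarrow> bool" where
  "is_cluster k V E \<longleftrightarrow> (\<exists>c :: 'a \<Rightarrow> nat. card (c ` V) \<le> k \<and>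
     (\<forall>u\<in>V. \<forall>v\<in>V. u \<noteq> v \<longrightarrow> (E u v \<longleftrightarrow> c u = c v)))"

definition is_independent :: "'a set \<Rightarrow> ('a \<Rightarrow> 'a \<Rightarrow> bool) \<Rightarrow> bool" where
  "is_independent V E \<longleftrightarrow> (\<forall>u\<in>V. \<forall>v\<in>V. \<not> E u v)"

text \<open>On a simple graph non-adjacency is reflexive and symmetric; if it is also transitive,
  its classes are the parts. Their number is unrestricted, which corresponds to the bound
  \<open>\<infinity>\<close>.\<close>

definition is_multipartite :: "'a set \<Rightarrow> ('a \<Rightarrow> 'a \<Rightarrow> bool) \<Rightarrow> bool" where
  "is_multipartite V E \<longleftrightarrow>
     (\<forall>u\<in>V. \<forall>v\<in>V. \<forall>w\<in>V. \<not> E u v \<longrightarrow> \<not> E v w \<longrightarrow> \<not> E u w)"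

text \<open>Polarity with at most one multipartite part. It is forced by disjoint unions, see
  \<open>is_polar_union\<close>.\<close>

definition is_unipolar :: "nat \<Rightarrow> 'a set \<Rightarrow> ('a \<Rightarrow> 'a \<Rightarrow> bool) \<Rightarrow> bool" where
  "is_unipolar k V E \<longleftrightarrow> (\<exists>A\<subseteq>V. is_independent A E \<and> is_cluster k (V - A) E)"

definition is_polar :: "nat \<Rightarrow> 'a set \<Rightarrow> ('a \<Rightarrow> 'a \<Rightarrow> bool) \<Rightarrow> bool" where
  "is_polar k V E \<longleftrightarrow> (\<exists>A\<subseteq>V. is_multipartite A E \<and> is_cluster k (V - A) E)"

section \<open>Monotonicity and heredity\<close>

lemma is_cluster_mono: "is_cluster i V E \<Longrightarrow> i \<le> k \<Longrightarrow> is_cluster k V E"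
  unfolding is_cluster_def by (meson le_trans)

lemma is_cluster_subset:
  assumes "is_cluster k V E" "W \<subseteq> V" "finite V"
  shows "is_cluster k W E"
proof -
  obtain c :: "'a \<Rightarrow> nat" where c: "card (c ` V) \<le> k"
    "\<forall>u\<in>V. \<forall>v\<in>V. u \<noteq> v \<longrightarrow> (E u v \<longleftrightarrow> c u = c v)"
    using assms(1) unfolding is_cluster_def by blast
  have "card (c ` W) \<le> card (c ` V)" using assms(2,3) by (intro card_mono) auto
  then show ?thesis using c assms(2) unfolding is_cluster_def by (intro exI[of _ c]) auto
qed

lemma is_cluster_empty [simp]: "is_cluster k {} E"
  unfolding is_cluster_def by simp

lemma is_cluster_0: "finite V \<Longrightarrow> is_cluster 0 V E \<longleftrightarrow> V = {}"
  unfolding is_cluster_def by auto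

lemma is_independent_subset: "is_independent V E \<Longrightarrow> W \<subseteq> V \<Longrightarrow> is_independent W E"
  unfolding is_independent_def by blast

lemma is_multipartite_subset: "is_multipartite V E \<Longrightarrow> W \<subseteq> V \<Longrightarrow> is_multipartite W E"
  unfolding is_multipartite_def by blast

lemma is_multipartite_if_independent: "is_independent V E \<Longrightarrow> is_multipartite V E"
  unfolding is_independent_def is_multipartite_def by blast

lemma is_unipolar_mono: "is_unipolar i V E \<Longrightarrow> i \<le> k \<Longrightarrow> is_unipolar k V E"
  unfolding is_unipolar_def using is_cluster_mono by blast

lemma is_polar_mono: "is_polar i V E \<Longrightarrow> i \<le> k \<Longrightarrow> is_polar k V E"
  unfolding is_polar_def using is_cluster_mono by blast

lemma is_polar_subset:
  assumes "is_polar k V E" "W \<subseteq> V" "finite V"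
  shows "is_polar k W E"
proof -
  obtain A where "A \<subseteq> V" "is_multipartite A E" "is_cluster k (V - A) E"
    using assms(1) unfolding is_polar_def by blast
  then have "is_multipartite (A \<inter> W) E" "is_cluster k (W - A \<inter> W) E"
    using assms(2,3) by (auto intro: is_multipartite_subset is_cluster_subset[of k "V - A"])
  then show ?thesis unfolding is_polar_def by blast
qed

lemma is_unipolar_0: "finite V \<Longrightarrow> is_unipolar 0 V E \<longleftrightarrow> is_independent V E"
  unfolding is_unipolar_def by (auto simp: is_cluster_0)

lemma is_polar_0: "finite V \<Longrightarrow> is_polar 0 V E \<longleftrightarrow> is_multipartite V E"
  unfolding is_polar_def by (auto simp: is_cluster_0)

section \<open>Disjoint unions\<close>

lemma is_cluster_union:
  assumes fin: "finite A" "finite B" and disj: "A \<inter> B = {}"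
    and no_edge: "\<forall>a\<in>A. \<forall>b\<in>B. \<not> E a b \<and> \<not> E b a"
  shows "is_cluster k (A \<union> B) E \<longleftrightarrow> (\<exists>i j. i + j \<le> k \<and> is_cluster i A E \<and> is_cluster j B E)"
proof
  assume "is_cluster k (A \<union> B) E"
  then obtain c :: "'a \<Rightarrow> nat" where c: "card (c ` (A \<union> B)) \<le> k"
    "\<forall>u\<in>A \<union> B. \<forall>v\<in>A \<union> B. u \<noteq> v \<longrightarrow> (E u v \<longleftrightarrow> c u = c v)"
    unfolding is_cluster_def by blast
  have "c u \<noteq> c v" if "u \<in> A" "v \<in> B" for u v
  proof -
    have "u \<noteq> v" "\<not> E u v" using that disj no_edge by auto
    then show ?thesis using c(2) that by auto
  qed
  then have "c ` A \<inter> c ` B = {}" by blast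
  then have "card (c ` A) + card (c ` B) \<le> k"
    using c(1) fin by (simp add: image_Un card_Un_disjoint)
  moreover have "is_cluster (card (c ` A)) A E" "is_cluster (card (c ` B)) B E"
    using c(2) unfolding is_cluster_def by blast+
  ultimately show "\<exists>i j. i + j \<le> k \<and> is_cluster i A E \<and> is_cluster j B E" by blast
next
  assume "\<exists>i j. i + j \<le> k \<and> is_cluster i A E \<and> is_cluster j B E"
  then obtain i j and c d :: "'a \<Rightarrow> nat" where k: "i + j \<le> k"
    and c: "card (c ` A) \<le> i" "\<forall>u\<in>A. \<forall>v\<in>A. u \<noteq> v \<longrightarrow> (E u v \<longleftrightarrow> c u = c v)"
    and d: "card (d ` B) \<le> j" "\<forall>u\<in>B. \<forall>v\<in>B. u \<noteq> v \<longrightarrow> (E u v \<longleftrightarrow> d u = d v)"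
    unfolding is_cluster_def by blast
  \<comment> \<open>Even colours for \<open>A\<close> and odd ones for \<open>B\<close> keep the
    cliques of the two sides apart.\<close>
  define h where "h v = (if v \<in> A then 2 * c v else Suc (2 * d v))" for v
  have hB: "h v = Suc (2 * d v)" if "v \<in> B" for v using that disj by (auto simp: h_def)
  have "h ` A = (*) 2 ` c ` A" by (auto simp: image_image h_def)
  moreover have "h ` B = (\<lambda>x. Suc (2 * x)) ` d ` B" by (auto simp: image_image hB)
  ultimately have "h ` (A \<union> B) = (*) 2 ` c ` A \<union> (\<lambda>x. Suc (2 * x)) ` d ` B"
    by (simp add: image_Un)
  then have "card (h ` (A \<union> B)) \<le> card ((*) 2 ` c ` A) + card ((\<lambda>x. Suc (2 * x)) ` d ` B)"
    by (simp add: card_Un_le)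
  also have "\<dots> \<le> i + j"
    using c(1) d(1) fin card_image_le[of "c ` A" "(*) 2"] card_image_le[of "d ` B" "\<lambda>x. Suc (2 * x)"]
    by (intro add_mono) (auto intro: order_trans)
  finally have "card (h ` (A \<union> B)) \<le> k" using k by simp
  moreover have "E u v \<longleftrightarrow> h u = h v" if "u \<in> A \<union> B" "v \<in> A \<union> B" "u \<noteq> v" for u v
  proof -
    have "Suc (2 * x) \<noteq> 2 * y" "2 * y \<noteq> Suc (2 * x)" for x y by presburger+
    then show ?thesis using that c(2) d(2) no_edge disj
      by (cases "u \<in> A"; cases "v \<in> A") (auto simp: h_def)
  qed
  ultimately show "is_cluster k (A \<union> B) E"
    unfolding is_cluster_def by blast
qed

lemma is_cluster_union_diff:
  assumes "finite A" "finite B" "A \<inter> B = {}" "\<forall>a\<in>A. \<forall>b\<in>B. \<not> E a b \<and> \<not> E b a"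
  shows "is_cluster k (A \<union> B - S) E \<longleftrightarrow>
    (\<exists>i j. i + j \<le> k \<and> is_cluster i (A - S) E \<and> is_cluster j (B - S) E)"
  unfolding Un_Diff by (rule is_cluster_union) (use assms in auto)

text \<open>An independent set restricts to each side, and independent sets of the two sides combine
  freely; so the numbers of cliques just add up.\<close>

lemma is_unipolar_union:
  assumes AB: "finite A" "finite B" "A \<inter> B = {}" "\<forall>a\<in>A. \<forall>b\<in>B. \<not> E a b \<and> \<not> E b a"
  shows "is_unipolar k (A \<union> B) E \<longleftrightarrow> (\<exists>i j. i + j \<le> k \<and> is_unipolar i A E \<and> is_unipolar j B E)"
proof
  assume "is_unipolar k (A \<union> B) E"
  then obtain S where "S \<subseteq> A \<union> B" "is_independent S E" "is_cluster k (A \<union> B - S) E"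
    unfolding is_unipolar_def by blast
  then obtain i j where S: "S \<subseteq> A \<union> B" "is_independent S E" "i + j \<le> k"
    "is_cluster i (A - S) E" "is_cluster j (B - S) E"
    unfolding is_cluster_union_diff[OF AB] by blast
  have "is_unipolar i A E" unfolding is_unipolar_def
    by (rule exI[of _ "A \<inter> S"]) (use S in \<open>auto intro: is_independent_subset simp: Diff_Int\<close>)
  moreover have "is_unipolar j B E" unfolding is_unipolar_def
    by (rule exI[of _ "B \<inter> S"]) (use S in \<open>auto intro: is_independent_subset simp: Diff_Int\<close>)
  ultimately show "\<exists>i j. i + j \<le> k \<and> is_unipolar i A E \<and> is_unipolar j B E" using S by blast
next
  assume "\<exists>i j. i + j \<le> k \<and> is_unipolar i A E \<and> is_unipolar j B E"
  then obtain i j S T where k: "i + j \<le> k" and S: "S \<subseteq> A" "is_independent S E" "is_cluster i (A - S) E"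
    and T: "T \<subseteq> B" "is_independent T E" "is_cluster j (B - T) E"
    unfolding is_unipolar_def by blast
  have "A - (S \<union> T) = A - S" "B - (S \<union> T) = B - T" using S T AB by auto
  then have "is_cluster k (A \<union> B - (S \<union> T)) E"
    using is_cluster_union_diff[OF AB, of k "S \<union> T"] S T k by auto
  moreover have "is_independent (S \<union> T) E"
    using S T AB(4) unfolding is_independent_def by blast
  ultimately show "is_unipolar k (A \<union> B) E"
    unfolding is_unipolar_def using S(1) T(1) by (intro exI[of _ "S \<union> T"]) auto
qed

text \<open>The three alternatives reflect where the multipartite part lies: inside
  \<open>A\<close>, inside \<open>B\<close>, or in both.\<close>

lemma is_polar_union:
  assumes AB: "finite A" "finite B" "A \<inter> B = {}" "\<forall>a\<in>A. \<forall>b\<in>B. \<not> E a b \<and> \<not> E b a"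
  shows "is_polar k (A \<union> B) E \<longleftrightarrow> (\<exists>i j. i + j \<le> k \<and>
    (is_polar i A E \<and> is_cluster j B E \<or> is_cluster i A E \<and> is_polar j B E \<or>
     is_unipolar i A E \<and> is_unipolar j B E))"
proof
  assume "is_polar k (A \<union> B) E"
  then obtain S where "S \<subseteq> A \<union> B" "is_multipartite S E" "is_cluster k (A \<union> B - S) E"
    unfolding is_polar_def by blast
  then obtain i j where S: "S \<subseteq> A \<union> B" "is_multipartite S E" "i + j \<le> k"
    "is_cluster i (A - S) E" "is_cluster j (B - S) E"
    unfolding is_cluster_union_diff[OF AB] by blast
  consider "S \<inter> A = {}" | "S \<inter> B = {}" | a b where "a \<in> S \<inter> A" "b \<in> S \<inter> B" by blast
  then have "is_polar i A E \<and> is_cluster j B E \<or> is_cluster i A E \<and> is_polar j B E \<or>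
     is_unipolar i A E \<and> is_unipolar j B E"
  proof cases
    case 1
    then have "A - S = A" "S \<subseteq> B" using S by auto
    then show ?thesis using S unfolding is_polar_def by auto
  next
    case 2
    then have "B - S = B" "S \<subseteq> A" using S by auto
    then show ?thesis using S unfolding is_polar_def by auto
  next
    case 3
    text \<open>A complete multipartite graph that meets both sides has a nonedge between any vertex
      and the other side, hence no edge at all.\<close>
    have "\<not> E u v" if "u \<in> S \<inter> A" "v \<in> S \<inter> A" for u v
      using S(2) AB(4) 3(2) that unfolding is_multipartite_def by blast
    then have "is_independent (A \<inter> S) E" unfolding is_independent_def by blast
    moreover have "\<not> E u v" if "u \<in> S \<inter> B" "v \<in> S \<inter> B" for u v
      using S(2) AB(4) 3(1) that unfolding is_multipartite_def by blast
    then have "is_independent (B \<inter> S) E" unfolding is_independent_def by blast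
    moreover have "A - A \<inter> S = A - S" "B - B \<inter> S = B - S" by auto
    ultimately have "is_unipolar i A E" "is_unipolar j B E"
      unfolding is_unipolar_def using S(4,5) by (metis Int_lower1)+
    then show ?thesis by blast
  qed
  then show "\<exists>i j. i + j \<le> k \<and>
    (is_polar i A E \<and> is_cluster j B E \<or> is_cluster i A E \<and> is_polar j B E \<or>
     is_unipolar i A E \<and> is_unipolar j B E)" using S(3) by blast
next
  assume "\<exists>i j. i + j \<le> k \<and>
    (is_polar i A E \<and> is_cluster j B E \<or> is_cluster i A E \<and> is_polar j B E \<or>
     is_unipolar i A E \<and> is_unipolar j B E)"
  then obtain i j where k: "i + j \<le> k" and "is_polar i A E \<and> is_cluster j B E \<or>
    is_cluster i A E \<and> is_polar j B E \<or> is_unipolar i A E \<and> is_unipolar j B E" by blast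
  then consider "is_polar i A E" "is_cluster j B E" | "is_cluster i A E" "is_polar j B E"
    | "is_unipolar i A E" "is_unipolar j B E" by blast
  then show "is_polar k (A \<union> B) E"
  proof cases
    case 1
    then obtain S where S: "S \<subseteq> A" "is_multipartite S E" "is_cluster i (A - S) E"
      unfolding is_polar_def by blast
    then have "B - S = B" using AB by auto
    then have "is_cluster k (A \<union> B - S) E" using is_cluster_union_diff[OF AB] 1 S k by auto
    then show ?thesis unfolding is_polar_def using S by blast
  next
    case 2
    then obtain S where S: "S \<subseteq> B" "is_multipartite S E" "is_cluster j (B - S) E"
      unfolding is_polar_def by blast
    then have "A - S = A" using AB by auto
    then have "is_cluster k (A \<union> B - S) E" using is_cluster_union_diff[OF AB] 2 S k by auto
    then show ?thesis unfolding is_polar_def using S by blast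
  next
    case 3
    then have "is_unipolar k (A \<union> B) E" using is_unipolar_union[OF AB] k by blast
    then show ?thesis
      unfolding is_polar_def is_unipolar_def using is_multipartite_if_independent by blast
  qed
qed

section \<open>Joins\<close>

lemma is_cluster_join:
  assumes AB: "finite A" "finite B" "A \<inter> B = {}" "\<forall>a\<in>A. \<forall>b\<in>B. E a b \<and> E b a"
    and ne: "A \<noteq> {}" "B \<noteq> {}"
  shows "is_cluster k (A \<union> B) E \<longleftrightarrow> 1 \<le> k \<and> is_cluster 1 A E \<and> is_cluster 1 B E"
proof
  assume "is_cluster k (A \<union> B) E"
  then obtain c :: "'a \<Rightarrow> nat" where c: "card (c ` (A \<union> B)) \<le> k"
    "\<forall>u\<in>A \<union> B. \<forall>v\<in>A \<union> B. u \<noteq> v \<longrightarrow> (E u v \<longleftrightarrow> c u = c v)"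
    unfolding is_cluster_def by blast
  obtain a b where ab: "a \<in> A" "b \<in> B" using ne by blast
  \<comment> \<open>The edges across the join leave room for a single colour: all of
    \<open>A\<close> shares the colour of \<open>b\<close>, and all of \<open>B\<close> that of
    \<open>a\<close>.\<close>
  have c_eq: "c u = c v" if "u \<in> A" "v \<in> B" for u v
  proof -
    have "u \<noteq> v" "E u v" using that AB by auto
    then show ?thesis using that c(2) by auto
  qed
  have "c ` A = {c b}" "c ` B = {c a}" using c_eq ab by (auto, metis image_eqI)
  then have "is_cluster 1 A E" "is_cluster 1 B E"
    using c(2) unfolding is_cluster_def by (auto intro!: exI[of _ c])
  moreover have "c ` (A \<union> B) \<noteq> {}" "finite (c ` (A \<union> B))" using ab AB by auto
  then have "1 \<le> k" using c(1) by (metis card_0_eq le_trans less_one not_le)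
  ultimately show "1 \<le> k \<and> is_cluster 1 A E \<and> is_cluster 1 B E" by blast
next
  assume *: "1 \<le> k \<and> is_cluster 1 A E \<and> is_cluster 1 B E"
  \<comment> \<open>A cluster with at most one colour is complete.\<close>
  have clique: "E u v" if X: "is_cluster 1 X E" "finite X" "u \<in> X" "v \<in> X" "u \<noteq> v" for u v X
  proof -
    obtain c :: "'a \<Rightarrow> nat" where c: "card (c ` X) \<le> 1"
      "\<forall>u\<in>X. \<forall>v\<in>X. u \<noteq> v \<longrightarrow> (E u v \<longleftrightarrow> c u = c v)"
      using X(1) unfolding is_cluster_def by blast
    then have "c u = c v" using X by (metis One_nat_def card_le_Suc0_iff_eq finite_imageI imageI)
    then show ?thesis using c(2) X by blast
  qed
  have "E u v" if "u \<in> A \<union> B" "v \<in> A \<union> B" "u \<noteq> v" for u v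
    using that AB clique[of A u v] clique[of B u v] * by blast
  moreover have "card ((\<lambda>_. 0 :: nat) ` (A \<union> B)) \<le> k" using * ne by (simp add: image_constant_conv)
  ultimately show "is_cluster k (A \<union> B) E" unfolding is_cluster_def by blast
qed

text \<open>An independent set of a join lies in one side. If it is that whole side, the other side
  may be any cluster; otherwise the remainder meets both sides and has to be a single
  clique.\<close>

lemma is_unipolar_join:
  assumes AB: "finite A" "finite B" "A \<inter> B = {}" "\<forall>a\<in>A. \<forall>b\<in>B. E a b \<and> E b a"
    and ne: "A \<noteq> {}" "B \<noteq> {}"
  shows "is_unipolar k (A \<union> B) E \<longleftrightarrow>
    is_unipolar 0 A E \<and> is_cluster k B E \<or> is_cluster k A E \<and> is_unipolar 0 B E \<or>
    1 \<le> k \<and> (is_unipolar 1 A E \<and> is_cluster 1 B E \<or> is_cluster 1 A E \<and> is_unipolar 1 B E)"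
proof -
  \<comment> \<open>The case of an independent set inside the first operand; it is applied a second
    time with the operands exchanged.\<close>
  have half: "(\<exists>S\<subseteq>A. is_independent S E \<and> is_cluster k (A \<union> B - S) E) \<longleftrightarrow>
      is_unipolar 0 A E \<and> is_cluster k B E \<or> 1 \<le> k \<and> is_unipolar 1 A E \<and> is_cluster 1 B E"
    if AB: "finite A" "finite B" "A \<inter> B = {}" "\<forall>a\<in>A. \<forall>b\<in>B. E a b \<and> E b a" and ne: "B \<noteq> {}" for A B
  proof
    assume "\<exists>S\<subseteq>A. is_independent S E \<and> is_cluster k (A \<union> B - S) E"
    then obtain S where S': "S \<subseteq> A" "is_independent S E" "is_cluster k (A \<union> B - S) E" by blast
    then have "A \<union> B - S = (A - S) \<union> B" using AB by auto
    then have S: "S \<subseteq> A" "is_independent S E" "is_cluster k ((A - S) \<union> B) E" using S' by auto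
    show "is_unipolar 0 A E \<and> is_cluster k B E \<or> 1 \<le> k \<and> is_unipolar 1 A E \<and> is_cluster 1 B E"
    proof (cases "A - S = {}")
      case True
      then show ?thesis using S AB by (auto simp: is_unipolar_0 intro: is_independent_subset)
    next
      case False
      then have "1 \<le> k \<and> is_cluster 1 (A - S) E \<and> is_cluster 1 B E"
        using is_cluster_join[of "A - S" B E k] S(3) AB ne by auto
      then show ?thesis using S unfolding is_unipolar_def by blast
    qed
  next
    assume "is_unipolar 0 A E \<and> is_cluster k B E \<or> 1 \<le> k \<and> is_unipolar 1 A E \<and> is_cluster 1 B E"
    then show "\<exists>S\<subseteq>A. is_independent S E \<and> is_cluster k (A \<union> B - S) E"
    proof
      assume "is_unipolar 0 A E \<and> is_cluster k B E"
      moreover have "A \<union> B - A = B" using AB by auto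
      ultimately show ?thesis using AB by (auto simp: is_unipolar_0)
    next
      assume *: "1 \<le> k \<and> is_unipolar 1 A E \<and> is_cluster 1 B E"
      then obtain S where S: "S \<subseteq> A" "is_independent S E" "is_cluster 1 (A - S) E"
        unfolding is_unipolar_def by blast
      have eq: "A \<union> B - S = (A - S) \<union> B" using S AB by auto
      have "is_cluster k ((A - S) \<union> B) E"
      \<comment> \<open>\<open>is_cluster_join\<close> needs two nonempty sides; with an empty
        remainder the cluster is \<open>B\<close> alone.\<close>
      proof (cases "A - S = {}")
        case True
        then show ?thesis using * by (metis Un_empty_left is_cluster_mono)
      next
        case False
        then show ?thesis using is_cluster_join[of "A - S" B E k] S * AB ne by auto
      qed
      then show ?thesis using S eq by auto
    qed
  qed
  have "S \<subseteq> A \<union> B \<and> is_independent S E \<longleftrightarrow> (S \<subseteq> A \<or> S \<subseteq> B) \<and> is_independent S E" for S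
    using AB(4) unfolding is_independent_def by blast
  then have "is_unipolar k (A \<union> B) E \<longleftrightarrow>
      (\<exists>S. ((S \<subseteq> A \<or> S \<subseteq> B) \<and> is_independent S E) \<and> is_cluster k (A \<union> B - S) E)"
    unfolding is_unipolar_def conj_assoc[symmetric] by simp
  then have "is_unipolar k (A \<union> B) E \<longleftrightarrow> (\<exists>S\<subseteq>A. is_independent S E \<and> is_cluster k (A \<union> B - S) E) \<or>
      (\<exists>S\<subseteq>B. is_independent S E \<and> is_cluster k (B \<union> A - S) E)"
    unfolding Un_commute[of B A] by blast
  moreover have "B \<inter> A = {}" "\<forall>b\<in>B. \<forall>a\<in>A. E b a \<and> E a b" using AB by auto
  ultimately show ?thesis
    unfolding half[OF AB ne(2)] using half[OF AB(2,1) _ _ ne(1)] by auto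
qed

text \<open>Complete multipartite graphs are closed under joins, so the multipartite parts of the
  two sides can be chosen independently. Only the leftovers interact: either one of them is empty,
  or together they form one clique.\<close>

lemma is_polar_join:
  assumes AB: "finite A" "finite B" "A \<inter> B = {}" "\<forall>a\<in>A. \<forall>b\<in>B. E a b \<and> E b a"
  shows "is_polar k (A \<union> B) E \<longleftrightarrow>
    is_polar 0 A E \<and> is_polar k B E \<or> is_polar k A E \<and> is_polar 0 B E \<or>
    1 \<le> k \<and> is_polar 1 A E \<and> is_polar 1 B E"
proof
  assume "is_polar k (A \<union> B) E"
  then obtain S where S: "S \<subseteq> A \<union> B" "is_multipartite S E" "is_cluster k (A \<union> B - S) E"
    unfolding is_polar_def by blast
  have "is_multipartite (A \<inter> S) E" "is_multipartite (B \<inter> S) E"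
    using S(2) by (auto intro: is_multipartite_subset)
  moreover have AS: "A - A \<inter> S = A - S" "B - B \<inter> S = B - S" by auto
  ultimately have *: "is_cluster i (A - S) E \<Longrightarrow> is_polar i A E"
    "is_cluster i (B - S) E \<Longrightarrow> is_polar i B E" for i
    unfolding is_polar_def by (metis Int_lower1)+
  consider "A - S = {}" | "B - S = {}" | "A - S \<noteq> {}" "B - S \<noteq> {}" by blast
  then show "is_polar 0 A E \<and> is_polar k B E \<or> is_polar k A E \<and> is_polar 0 B E \<or>
    1 \<le> k \<and> is_polar 1 A E \<and> is_polar 1 B E"
  proof cases
    case 1
    then have "is_polar 0 A E" "is_polar k B E" using * S(3) unfolding Un_Diff 1 by simp_all
    then show ?thesis by blast
  next
    case 2
    then have "is_polar k A E" "is_polar 0 B E" using * S(3) unfolding Un_Diff 2 by simp_all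
    then show ?thesis by blast
  next
    case 3
    have "1 \<le> k \<and> is_cluster 1 (A - S) E \<and> is_cluster 1 (B - S) E"
      using is_cluster_join[of "A - S" "B - S" E k] S(3) AB 3 by (auto simp: Un_Diff)
    then show ?thesis using * by blast
  qed
next
  have multi: "is_multipartite (S \<union> T) E"
    if "S \<subseteq> A" "T \<subseteq> B" "is_multipartite S E" "is_multipartite T E" for S T
    using that AB(4) unfolding is_multipartite_def by blast
  have comb: "is_polar k (A \<union> B) E" if "S \<subseteq> A" "T \<subseteq> B" "is_multipartite S E" "is_multipartite T E"
    "is_cluster k ((A - S) \<union> (B - T)) E" for S T
  proof -
    have "A \<union> B - (S \<union> T) = (A - S) \<union> (B - T)" using that AB by auto
    then show ?thesis unfolding is_polar_def using multi[OF that(1-4)] that by (intro exI[of _ "S \<union> T"]) auto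
  qed
  assume "is_polar 0 A E \<and> is_polar k B E \<or> is_polar k A E \<and> is_polar 0 B E \<or>
    1 \<le> k \<and> is_polar 1 A E \<and> is_polar 1 B E"
  then consider "is_polar 0 A E" "is_polar k B E" | "is_polar k A E" "is_polar 0 B E"
    | "1 \<le> k" "is_polar 1 A E" "is_polar 1 B E" by blast
  then show "is_polar k (A \<union> B) E"
  proof cases
    case 1
    then obtain T where "T \<subseteq> B" "is_multipartite T E" "is_cluster k (B - T) E"
      unfolding is_polar_def by blast
    then show ?thesis using comb[of A T] 1 AB by (simp add: is_polar_0)
  next
    case 2
    then obtain T where "T \<subseteq> A" "is_multipartite T E" "is_cluster k (A - T) E"
      unfolding is_polar_def by blast
    then show ?thesis using comb[of T B] 2 AB by (simp add: is_polar_0)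
  next
    case 3
    then obtain S T where S: "S \<subseteq> A" "is_multipartite S E" "is_cluster 1 (A - S) E"
      and T: "T \<subseteq> B" "is_multipartite T E" "is_cluster 1 (B - T) E"
      unfolding is_polar_def by blast
    have "is_cluster k ((A - S) \<union> (B - T)) E"
    proof (cases "A - S = {} \<or> B - T = {}")
      case True
      then show ?thesis using S T 3(1) by (auto simp del: Diff_eq_empty_iff intro: is_cluster_mono)
    next
      case False
      have "finite (A - S)" "finite (B - T)" "(A - S) \<inter> (B - T) = {}"
        "\<forall>a\<in>A - S. \<forall>b\<in>B - T. E a b \<and> E b a" using AB by auto
      then show ?thesis using is_cluster_join[of "A - S" "B - T" E k] False S T 3(1) by blast
    qed
    then show ?thesis using comb S T by blast
  qed
qed

section \<open>Profiles\<close>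

text \<open>
  A profile records the least numbers of cliques, capped at \<open>4\<close>, for which a graph is a cluster,
  an independent set plus a cluster, and a complete multipartite graph plus a cluster.
\<close>

type_synonym profile = "nat \<times> nat \<times> nat"

text \<open>The value \<open>4\<close> says that no bound up to \<open>3\<close> works, which
  includes graphs that are no clusters at all: a join is a cluster only as a single clique, whence
  the values \<open>1\<close> and \<open>4\<close>. The terms under each minimum are the
  alternatives of the corresponding lemma on unions or joins.\<close>

definition profile_op :: "bool \<Rightarrow> profile \<Rightarrow> profile \<Rightarrow> profile" where
  "profile_op j p q = (case p of (a, b, c) \<Rightarrow> case q of (a', b', c') \<Rightarrow>
     if j then
       (if a \<le> 1 \<and> a' \<le> 1 then 1 else 4,
        min (if b = 0 then a' else 4) (min (if b' = 0 then a else 4)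
          (if b \<le> 1 \<and> a' \<le> 1 \<or> a \<le> 1 \<and> b' \<le> 1 then 1 else 4)),
        min (if c = 0 then c' else 4) (min (if c' = 0 then c else 4)
          (if c \<le> 1 \<and> c' \<le> 1 then 1 else 4)))
     else
       (min 4 (a + a'), min 4 (b + b'), min 4 (min (b + b') (min (c + a') (a + c')))))"

fun profile :: "cotree \<Rightarrow> profile" where
  "profile Leaf = (1, 0, 0)"
| "profile (Node j s t) = profile_op j (profile s) (profile t)"

fun profile_le :: "profile \<Rightarrow> profile \<Rightarrow> bool" where
  "profile_le (a, b, c) (a', b', c') \<longleftrightarrow> a \<le> a' \<and> b \<le> b' \<and> c \<le> c'"

lemma profile_le_trans: "profile_le p q \<Longrightarrow> profile_le q r \<Longrightarrow> profile_le p r"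
  by (cases p; cases q; cases r) auto

text \<open>The bound \<open>(4, 4, 4)\<close> is what makes the conditionals monotone: where a
  condition holds for the smaller profiles only, the larger side becomes \<open>4\<close> and has to
  dominate an entry of the smaller ones.\<close>

lemma profile_op_mono:
  assumes "profile_le p p'" "profile_le q q'" "profile_le p' (4, 4, 4)" "profile_le q' (4, 4, 4)"
  shows "profile_le (profile_op j p q) (profile_op j p' q')"
proof -
  obtain a b c where p: "p = (a, b, c)" by (cases p)
  obtain a' b' c' where p': "p' = (a', b', c')" by (cases p')
  obtain d e f where q: "q = (d, e, f)" by (cases q)
  obtain d' e' f' where q': "q' = (d', e', f')" by (cases q')
  note defs = p p' q q' profile_op_def
  have le: "a \<le> a'" "b \<le> b'" "c \<le> c'" "d \<le> d'" "e \<le> e'" "f \<le> f'"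
    "a' \<le> 4" "b' \<le> 4" "c' \<le> 4" "d' \<le> 4" "e' \<le> 4" "f' \<le> 4"
    using assms by (simp_all add: p p' q q')
  show ?thesis
  proof (cases j)
    case True
    have ifs: "(if a \<le> 1 \<and> d \<le> 1 then 1 else 4 :: nat) \<le> (if a' \<le> 1 \<and> d' \<le> 1 then 1 else 4)"
      "(if b = 0 then d else 4) \<le> (if b' = 0 then d' else 4)"
      "(if e = 0 then a else 4) \<le> (if e' = 0 then a' else 4)"
      "(if b \<le> 1 \<and> d \<le> 1 \<or> a \<le> 1 \<and> e \<le> 1 then 1 else 4 :: nat) \<le>
       (if b' \<le> 1 \<and> d' \<le> 1 \<or> a' \<le> 1 \<and> e' \<le> 1 then 1 else 4)"
      "(if c = 0 then f else 4) \<le> (if c' = 0 then f' else 4)"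
      "(if f = 0 then c else 4) \<le> (if f' = 0 then c' else 4)"
      "(if c \<le> 1 \<and> f \<le> 1 then 1 else 4 :: nat) \<le> (if c' \<le> 1 \<and> f' \<le> 1 then 1 else 4)"
      using le by auto
    have "j = True" using True by simp
    then show ?thesis
      unfolding defs prod.case by (simp only: if_True profile_le.simps) (intro conjI min.mono ifs)
  next
    case False
    then have "j = False" by simp
    then show ?thesis
      unfolding defs prod.case
      by (simp only: if_False profile_le.simps) (intro conjI min.mono add_mono order_refl le)
  qed
qed

lemma profile_le_4: "profile_le (profile t) (4, 4, 4)"
proof -
  have "profile_le (profile_op j p q) (4, 4, 4)" for j p q
    by (cases p; cases q; cases j) (simp_all add: profile_op_def min_le_iff_disj)
  then show ?thesis by (cases t) simp_all
qed

text \<open>Only bounds \<open>k \<le> 3\<close> are compared, so for these the cap at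
  \<open>4\<close> loses nothing.\<close>

definition has_profile :: "profile \<Rightarrow> 'a set \<Rightarrow> ('a \<Rightarrow> 'a \<Rightarrow> bool) \<Rightarrow> bool" where
  "has_profile p V E \<longleftrightarrow> (case p of (a, b, c) \<Rightarrow> \<forall>k\<le>3. (is_cluster k V E \<longleftrightarrow> a \<le> k) \<and>
     (is_unipolar k V E \<longleftrightarrow> b \<le> k) \<and> (is_polar k V E \<longleftrightarrow> c \<le> k))"

text \<open>The thresholds themselves are the best witnesses, and both summands stay within the
  range up to \<open>3\<close> in which the thresholds are known to be valid.\<close>

lemma ex_sum_le_iff:
  assumes "\<forall>k\<le>3. P k \<longleftrightarrow> a \<le> k" "\<forall>k\<le>3. Q k \<longleftrightarrow> b \<le> k" "k \<le> (3 :: nat)"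
  shows "(\<exists>i j. i + j \<le> k \<and> P i \<and> Q j) \<longleftrightarrow> a + b \<le> k"
proof
  assume "\<exists>i j. i + j \<le> k \<and> P i \<and> Q j"
  then obtain i j where "i + j \<le> k" "P i" "Q j" by blast
  then show "a + b \<le> k" using assms(1)[rule_format, of i] assms(2)[rule_format, of j] assms(3) by simp
next
  assume "a + b \<le> k"
  then show "\<exists>i j. i + j \<le> k \<and> P i \<and> Q j"
    using assms(1)[rule_format, of a] assms(2)[rule_format, of b] assms(3)
    by (intro exI[of _ a] exI[of _ b]) simp
qed

lemma has_profile_union:
  assumes AB: "finite A" "finite B" "A \<inter> B = {}" "\<forall>a\<in>A. \<forall>b\<in>B. \<not> E a b \<and> \<not> E b a"
    and p: "has_profile p A E" and q: "has_profile q B E"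
  shows "has_profile (profile_op False p q) (A \<union> B) E"
proof -
  obtain a b c a' b' c' where pq: "p = (a, b, c)" "q = (a', b', c')" by (cases p; cases q)
  have 1: "\<forall>k\<le>3. is_cluster k A E \<longleftrightarrow> a \<le> k" "\<forall>k\<le>3. is_unipolar k A E \<longleftrightarrow> b \<le> k"
    "\<forall>k\<le>3. is_polar k A E \<longleftrightarrow> c \<le> k"
    and 2: "\<forall>k\<le>3. is_cluster k B E \<longleftrightarrow> a' \<le> k" "\<forall>k\<le>3. is_unipolar k B E \<longleftrightarrow> b' \<le> k"
    "\<forall>k\<le>3. is_polar k B E \<longleftrightarrow> c' \<le> k"
    using p q by (auto simp: has_profile_def pq)
  have "is_cluster k (A \<union> B) E \<longleftrightarrow> a + a' \<le> k" if "k \<le> 3" for k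
    unfolding is_cluster_union[OF AB] by (rule ex_sum_le_iff[OF 1(1) 2(1) that])
  moreover have u: "(\<exists>i j. i + j \<le> k \<and> is_unipolar i A E \<and> is_unipolar j B E) \<longleftrightarrow> b + b' \<le> k"
    if "k \<le> 3" for k by (rule ex_sum_le_iff[OF 1(2) 2(2) that])
  moreover have "is_polar k (A \<union> B) E \<longleftrightarrow> b + b' \<le> k \<or> c + a' \<le> k \<or> a + c' \<le> k" if "k \<le> 3" for k
    unfolding is_polar_union[OF AB]
    using u[OF that] ex_sum_le_iff[OF 1(3) 2(1) that] ex_sum_le_iff[OF 1(1) 2(3) that] by blast
  ultimately show ?thesis
    by (auto simp: has_profile_def pq profile_op_def is_unipolar_union[OF AB] min_le_iff_disj)
qed

lemma has_profile_join:
  assumes AB: "finite A" "finite B" "A \<inter> B = {}" "\<forall>a\<in>A. \<forall>b\<in>B. E a b \<and> E b a"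
    and ne: "A \<noteq> {}" "B \<noteq> {}"
    and p: "has_profile p A E" and q: "has_profile q B E"
  shows "has_profile (profile_op True p q) (A \<union> B) E"
proof -
  obtain a b c a' b' c' where pq: "p = (a, b, c)" "q = (a', b', c')" by (cases p; cases q)
  have 1: "is_cluster k A E \<longleftrightarrow> a \<le> k" "is_unipolar k A E \<longleftrightarrow> b \<le> k" "is_polar k A E \<longleftrightarrow> c \<le> k"
      "is_cluster k B E \<longleftrightarrow> a' \<le> k" "is_unipolar k B E \<longleftrightarrow> b' \<le> k" "is_polar k B E \<longleftrightarrow> c' \<le> k"
    if "k \<le> 3" for k
    using p q that by (auto simp: has_profile_def pq)
  show ?thesis
    by (auto simp: has_profile_def pq profile_op_def is_cluster_join[OF AB ne] is_unipolar_join[OF AB ne]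
        is_polar_join[OF AB] min_le_iff_disj 1)
qed

text \<open>Polarity can thus be read off any cotree of the graph, whichever is chosen.\<close>

lemma has_profile_profile: "realizes t V E \<Longrightarrow> has_profile (profile t) V E"
proof (induction t arbitrary: V)
  case Leaf
  then obtain v where V: "V = {v}" "\<not> E v v" by auto
  have "is_cluster k {v} E \<longleftrightarrow> 1 \<le> k" for k
    using is_cluster_0[of "{v}" E] is_cluster_mono[of 1 "{v}" E k]
    by (cases k) (auto simp: is_cluster_def)
  moreover have "is_unipolar 0 {v} E" using V by (simp add: is_unipolar_0 is_independent_def)
  moreover have "is_polar 0 {v} E" using V by (simp add: is_polar_0 is_multipartite_def)
  ultimately show ?case
    unfolding V by (auto simp: has_profile_def intro: is_unipolar_mono is_polar_mono)
next
  case (Node j s t)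
  from Node.prems(1) obtain A B where *: "V = A \<union> B" "A \<inter> B = {}"
    "realizes s A E" "realizes t B E" "\<forall>a\<in>A. \<forall>b\<in>B. E a b = j \<and> E b a = j" by auto
  have fin: "finite A" "finite B" and ne: "A \<noteq> {}" "B \<noteq> {}"
    using *(3,4) realizes_finite realizes_nonempty by blast+
  note IH = Node.IH(1)[OF *(3)] Node.IH(2)[OF *(4)]
  show ?case
  proof (cases j)
    case True
    then show ?thesis using has_profile_join[OF fin *(2) _ ne IH] * by simp
  next
    case False
    then show ?thesis using has_profile_union[OF fin *(2) _ IH] * by simp
  qed
qed

section \<open>Cotrees that are minimal for their profile\<close>

text \<open>A strict lexicographic order with \<open>Leaf\<close> first and unions before joins; the
  final \<open>j\<close> decides between nodes with different labels.\<close>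

fun tree_less :: "cotree \<Rightarrow> cotree \<Rightarrow> bool" where
  "tree_less s Leaf = False"
| "tree_less Leaf (Node j s t) = True"
| "tree_less (Node i a b) (Node j c d) =
     (if i = j then (if a = c then tree_less b d else tree_less a c) else j)"

text \<open>
  In a normalized cotree, maximal stretches of equally labelled nodes are sorted right-nested combs.
\<close>

fun tree_insert :: "bool \<Rightarrow> cotree \<Rightarrow> cotree \<Rightarrow> cotree" where
  "tree_insert j s Leaf = (if tree_less Leaf s then Node j Leaf s else Node j s Leaf)"
| "tree_insert j s (Node i t u) =
     (if i = j then (if tree_less t s then Node j t (tree_insert j s u) else Node j s (Node i t u))
      else if tree_less (Node i t u) s then Node j (Node i t u) s else Node j s (Node i t u))"

fun tree_merge :: "bool \<Rightarrow> cotree \<Rightarrow> cotree \<Rightarrow> cotree" where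
  "tree_merge j Leaf u = tree_insert j Leaf u"
| "tree_merge j (Node i s t) u =
     (if i = j then tree_insert j s (tree_merge j t u) else tree_insert j (Node i s t) u)"

fun normalize :: "cotree \<Rightarrow> cotree" where
  "normalize Leaf = Leaf"
| "normalize (Node j s t) = tree_merge j (normalize s) (normalize t)"

text \<open>Associativity and commutativity of union and join allow the reordering. Soundness is all
  that is proved about normal forms; that they coincide where they should is settled by
  evaluation.\<close>

lemma realizes_tree_insert: "realizes (tree_insert j s t) V E \<longleftrightarrow> realizes (Node j s t) V E"
proof (induction t arbitrary: V)
  case Leaf
  then show ?case using realizes_commute[of j s Leaf] by (auto simp del: realizes.simps)
next
  case (Node i t u)
  show ?case
  proof (cases "i = j \<and> tree_less t s")
    case True
    have "realizes (tree_insert j s (Node i t u)) V E \<longleftrightarrow> realizes (Node j t (tree_insert j s u)) V E"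
      using True by (simp del: realizes.simps)
    also have "\<dots> \<longleftrightarrow> realizes (Node j t (Node j s u)) V E"
      by (intro realizes_Node_cong Node.IH refl)
    also have "\<dots> \<longleftrightarrow> realizes (Node j (Node j t s) u) V E" by (simp only: realizes_assoc)
    also have "\<dots> \<longleftrightarrow> realizes (Node j (Node j s t) u) V E"
      by (intro realizes_Node_cong realizes_commute refl)
    also have "\<dots> \<longleftrightarrow> realizes (Node j s (Node i t u)) V E" using True by (simp only: realizes_assoc)
    finally show ?thesis .
  next
    case False
    then show ?thesis using realizes_commute[of j s "Node i t u"] by (auto simp del: realizes.simps)
  qed
qed

lemma realizes_tree_merge: "realizes (tree_merge j s t) V E \<longleftrightarrow> realizes (Node j s t) V E"
proof (induction s arbitrary: V)
  case Leaf
  then show ?case by (simp add: realizes_tree_insert del: realizes.simps)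
next
  case (Node i s u)
  show ?case
  proof (cases "i = j")
    case True
    then have "realizes (tree_merge j (Node i s u) t) V E \<longleftrightarrow> realizes (Node j s (tree_merge j u t)) V E"
      by (simp add: realizes_tree_insert del: realizes.simps)
    also have "\<dots> \<longleftrightarrow> realizes (Node j s (Node j u t)) V E"
      by (intro realizes_Node_cong Node.IH refl)
    finally show ?thesis using True by (simp only: realizes_assoc)
  qed (simp add: realizes_tree_insert del: realizes.simps)
qed

lemma realizes_normalize: "realizes (normalize t) V E \<longleftrightarrow> realizes t V E"
proof (induction t arbitrary: V)
  case (Node j s t)
  have "realizes (normalize (Node j s t)) V E \<longleftrightarrow> realizes (Node j (normalize s) (normalize t)) V E"
    by (simp add: realizes_tree_merge del: realizes.simps)
  also have "\<dots> \<longleftrightarrow> realizes (Node j s t) V E" by (intro realizes_Node_cong Node.IH)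
  finally show ?case .
qed simp

section \<open>Tables of minimal cotrees and rules of the recursion\<close>

abbreviation (input) "L \<equiv> Leaf"
abbreviation tree_union (infixr \<open>.+\<close> 65) where "s .+ t \<equiv> Node False s t"
abbreviation tree_join (infixr \<open>.*\<close> 70) where "s .* t \<equiv> Node True s t"

definition profiles :: "profile list" where
  "profiles =
    [(1,0,0), (1,1,0), (2,0,0), (2,1,1), (2,2,1), (3,0,0), (3,1,1), (3,2,2),
     (3,3,2), (4,0,0), (4,1,0), (4,1,1), (4,2,0), (4,2,1), (4,2,2), (4,3,0),
     (4,3,1), (4,3,2), (4,3,3), (4,4,0), (4,4,1), (4,4,2), (4,4,3), (4,4,4)]"

text \<open>
  The list for profile \<open>(a, b, c)\<close> consists of the normalized cotrees that have at least this profile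
  but none of whose vertex deletions have. Profile \<open>(4,3,2)\<close> is absent because no rule below uses it.
\<close>

definition "trees_100 =
   [L]"

definition "trees_110 =
   [L .* L]"

definition "trees_200 =
   [L .+ L]"

definition "trees_211 =
   [L .+ L .* L]"

definition "trees_221 =
   [L .* L .+ L .* L, (L .+ L) .* (L .+ L .* L), L .+ (L .+ L) .* (L .+ L)]"

definition "trees_300 =
   [L .* (L .+ L), L .+ L .+ L]"

definition "trees_311 =
   [L .* (L .+ L .* L), L .+ L .+ L .* L, L .+ L .* (L .+ L)]"

definition "trees_322 =
   [L .+ L .* L .+ L .* L, L .+ L .+ (L .+ L) .* (L .+ L), L .+ (L .+ L) .* (L .+ L .* L),
    L .* (L .+ L) .+ L .* (L .+ L)]"

definition "trees_332 =
   [L .* (L .+ L .* L .+ L .* L), L .* L .+ L .* L .+ L .* L,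
    L .* (L .+ L .+ (L .+ L) .* (L .+ L)), L .* (L .+ (L .+ L) .* (L .+ L .* L)),
    L .* (L .* (L .+ L) .+ L .* (L .+ L)), L .+ L .+ L .* (L .+ L) .* (L .+ L),
    L .+ L .* L .+ (L .+ L) .* (L .+ L), L .+ L .* L .* (L .* L .+ L .* L),
    L .+ L .* (L .+ L) .* (L .+ L .* L), L .+ L .* (L .+ (L .+ L) .* (L .+ L)),
    L .+ L .* (L .* L .+ L .* (L .+ L)), L .+ (L .+ L) .* (L .+ L .+ L .* L),
    L .+ (L .+ L) .* (L .+ L .* (L .+ L)), L .+ (L .+ L .* L) .* (L .+ L .* L),
    L .* L .+ (L .+ L) .* (L .+ L .* L), L .* (L .+ L) .+ (L .+ L) .* (L .+ L),
    L .+ L .+ (L .+ L .+ L) .* (L .+ L .+ L)]"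

definition "trees_400 =
   [L .* (L .+ L), L .+ L .+ L .+ L]"

definition "trees_410 =
   [L .* (L .+ L), L .+ L .+ L .+ L .* L]"

definition "trees_411 =
   [L .* (L .+ L .* L), L .+ L .* (L .+ L), L .+ L .+ L .+ L .* L]"

definition "trees_420 =
   [(L .+ L) .* (L .+ L), L .* (L .* L .+ L .* L), L .* L .+ L .* (L .+ L),
    L .+ L .+ L .* L .+ L .* L]"

definition "trees_421 =
   [L .* (L .* L .+ L .* L), (L .+ L) .* (L .+ L .* L), L .+ (L .+ L) .* (L .+ L),
    L .* L .+ L .* (L .+ L), L .+ L .+ L .* L .+ L .* L]"

definition "trees_422 =
   [L .* (L .+ L .* L .+ L .* L), L .+ L .+ L .* L .+ L .* L, L .+ L .+ (L .+ L) .* (L .+ L),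
    L .+ L .* L .+ L .* (L .+ L), L .+ L .* (L .* L .+ L .* L), L .+ (L .+ L) .* (L .+ L .* L),
    L .* L .+ L .* (L .+ L .* L), L .* (L .+ L) .+ L .* (L .+ L)]"

definition "trees_430 =
   [L .* (L .+ L) .* (L .+ L), L .* L .* (L .* L .+ L .* L), L .* (L .+ L .* L .+ L .* L),
    L .* (L .* L .+ L .* (L .+ L)), (L .+ L) .* (L .+ L .+ L .* L),
    (L .+ L .+ L) .* (L .+ L .+ L), (L .+ L .* L) .* (L .+ L .* L),
    L .* L .+ (L .+ L) .* (L .+ L), L .+ L .* L .+ L .* L .+ L .* L,
    L .* L .+ L .* L .+ L .* (L .+ L), L .* L .+ L .* (L .* L .+ L .* L)]"

definition "trees_431 =
   [L .* L .* (L .* L .+ L .* L), L .* (L .+ L) .* (L .+ L .* L), L .* (L .+ L .* L .+ L .* L),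
    L .* (L .+ (L .+ L) .* (L .+ L)), L .* (L .* L .+ L .* (L .+ L)),
    (L .+ L) .* (L .+ L .+ L .* L), (L .+ L) .* (L .+ L .* (L .+ L)),
    (L .+ L .* L) .* (L .+ L .* L), L .+ L .* (L .+ L) .* (L .+ L),
    L .* L .+ (L .+ L) .* (L .+ L), L .+ L .* L .+ L .* L .+ L .* L,
    L .+ (L .+ L .+ L) .* (L .+ L .+ L), L .* L .+ L .* L .+ L .* (L .+ L),
    L .* L .+ L .* (L .* L .+ L .* L)]"

definition "trees_433 =
   [L .+ L .* L .+ L .* L .+ L .* L, L .+ L .* (L .+ L .* L .+ L .* L),
    L .* (L .+ L) .+ (L .+ L) .* (L .+ L), (L .+ L .* L .+ L .* L) .* (L .+ L .* L),
    L .+ L .+ L .+ L .* (L .+ L) .* (L .+ L), L .+ L .+ L .* L .+ (L .+ L) .* (L .+ L),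
    L .+ L .+ L .* L .* (L .* L .+ L .* L), L .+ L .+ L .* (L .+ L) .* (L .+ L .* L),
    L .+ L .+ L .* (L .+ (L .+ L) .* (L .+ L)), L .+ L .+ L .* (L .* L .+ L .* (L .+ L)),
    L .+ L .+ (L .+ L) .* (L .+ L .+ L .* L), L .+ L .+ (L .+ L) .* (L .+ L .* (L .+ L)),
    L .+ L .+ (L .+ L .* L) .* (L .+ L .* L), L .+ L .* L .+ (L .+ L) .* (L .+ L .* L),
    L .+ L .* (L .+ L .+ (L .+ L) .* (L .+ L)), L .+ L .* (L .+ (L .+ L) .* (L .+ L .* L)),
    L .+ L .* (L .* (L .+ L) .+ L .* (L .+ L)), L .* L .+ L .* (L .+ L) .+ L .* (L .+ L),
    L .* (L .+ L) .+ L .* (L .* L .+ L .* L), (L .+ L .+ (L .+ L) .* (L .+ L)) .* (L .+ L .* L),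
    (L .+ L .* L) .* (L .+ (L .+ L) .* (L .+ L .* L)),
    (L .+ L .* L) .* (L .* (L .+ L) .+ L .* (L .+ L)),
    L .+ L .+ L .+ (L .+ L .+ L) .* (L .+ L .+ L)]"

definition "trees_440 =
   [L .* (L .+ L) .* (L .+ L), L .* L .* (L .* L .+ L .* L), L .* (L .* L .+ L .* (L .+ L)),
    (L .+ L .* L) .* (L .+ L .* L), L .* (L .+ L .+ L .* L .+ L .* L),
    (L .+ L) .* (L .+ L .+ L .+ L .* L), (L .+ L .+ L .+ L) .* (L .+ L .+ L .+ L),
    L .* L .+ L .* L .+ L .* L .+ L .* L, L .* L .+ L .* L .+ (L .+ L) .* (L .+ L),
    L .* L .+ L .* (L .+ L .* L .+ L .* L), L .* L .+ (L .+ L) .* (L .+ L .+ L .* L),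
    L .* L .+ (L .+ L .+ L) .* (L .+ L .+ L), (L .+ L) .* (L .+ L) .+ (L .+ L) .* (L .+ L)]"

definition "trees_441 =
   [L .* L .* (L .* L .+ L .* L), L .* (L .+ L) .* (L .+ L .* L),
    L .* (L .+ (L .+ L) .* (L .+ L)), L .* (L .* L .+ L .* (L .+ L)),
    (L .+ L) .* (L .+ L .* (L .+ L)), (L .+ L .* L) .* (L .+ L .* L),
    L .+ L .* (L .+ L) .* (L .+ L), L .* (L .+ L .+ L .* L .+ L .* L),
    (L .+ L) .* (L .+ L .+ L .+ L .* L), L .* L .+ L .* L .+ L .* L .+ L .* L,
    L .* L .+ L .* L .+ (L .+ L) .* (L .+ L), L .* L .+ L .* (L .+ L .* L .+ L .* L),
    L .* L .+ (L .+ L) .* (L .+ L .+ L .* L), L .* L .+ (L .+ L .+ L) .* (L .+ L .+ L),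
    (L .+ L) .* (L .+ L) .+ (L .+ L) .* (L .+ L), L .+ (L .+ L .+ L .+ L) .* (L .+ L .+ L .+ L)]"

definition "trees_442 =
   [L .* L .* (L .+ L .* L .+ L .* L), L .* (L .+ L .+ L .* L .+ L .* L),
    L .* (L .+ L .+ (L .+ L) .* (L .+ L)), L .* (L .+ L .* L .+ L .* (L .+ L)),
    L .* (L .+ L .* (L .* L .+ L .* L)), L .* (L .+ (L .+ L) .* (L .+ L .* L)),
    L .* (L .* L .+ L .* (L .+ L .* L)), L .* (L .* (L .+ L) .+ L .* (L .+ L)),
    L .+ L .+ L .* (L .+ L) .* (L .+ L), L .+ L .* L .* (L .* L .+ L .* L),
    L .+ L .* (L .+ L) .* (L .+ L .* L), L .+ L .* (L .+ (L .+ L) .* (L .+ L)),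
    L .+ L .* (L .* L .+ L .* (L .+ L)), L .+ (L .+ L) .* (L .+ L .* (L .+ L)),
    L .+ (L .+ L .* L) .* (L .+ L .* L), L .+ (L .+ L) .* (L .+ L .+ L .+ L .* L),
    L .* L .+ L .* L .+ L .* L .+ L .* L, L .* L .+ L .* L .+ (L .+ L) .* (L .+ L),
    L .* L .+ L .* (L .+ L .* L .+ L .* L), L .* L .+ (L .+ L) .* (L .+ L .+ L .* L),
    (L .+ L) .* (L .+ L) .+ (L .+ L) .* (L .+ L), L .+ L .* L .+ (L .+ L .+ L) .* (L .+ L .+ L),
    L .* (L .+ L) .+ (L .+ L .+ L) .* (L .+ L .+ L),
    L .+ L .+ (L .+ L .+ L .+ L) .* (L .+ L .+ L .+ L)]"

definition "trees_443 =
   [L .* (L .+ L .* L .+ L .* L .+ L .* L), L .* (L .+ L .* (L .+ L .* L .+ L .* L)),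
    L .* (L .* (L .+ L) .+ (L .+ L) .* (L .+ L)), (L .+ L .* L .+ L .* L) .* (L .+ L .* L),
    L .+ L .+ L .+ L .* (L .+ L) .* (L .+ L), L .+ L .+ L .* L .* (L .* L .+ L .* L),
    L .+ L .+ L .* (L .+ L) .* (L .+ L .* L), L .+ L .+ L .* (L .+ (L .+ L) .* (L .+ L)),
    L .+ L .+ L .* (L .* L .+ L .* (L .+ L)), L .+ L .+ (L .+ L) .* (L .+ L .* (L .+ L)),
    L .+ L .+ (L .+ L .* L) .* (L .+ L .* L), L .+ L .* L .* (L .+ L .* L .+ L .* L),
    L .+ L .* (L .+ L .+ L .* L .+ L .* L), L .+ L .* (L .+ L .+ (L .+ L) .* (L .+ L)),
    L .+ L .* (L .+ L .* L .+ L .* (L .+ L)), L .+ L .* (L .+ L .* (L .* L .+ L .* L)),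
    L .+ L .* (L .+ (L .+ L) .* (L .+ L .* L)), L .+ L .* (L .* L .+ L .* (L .+ L .* L)),
    L .+ L .* (L .* (L .+ L) .+ L .* (L .+ L)), L .* L .+ L .* L .+ L .* L .+ L .* L,
    L .* L .+ L .* (L .+ L .* L .+ L .* L), L .* (L .+ L) .+ L .* (L .+ L) .* (L .+ L),
    (L .+ L) .* (L .+ L) .+ (L .+ L) .* (L .+ L),
    L .* (L .+ L .+ L .* L .+ (L .+ L) .* (L .+ L)),
    L .* (L .+ L .+ (L .+ L) .* (L .+ L .+ L .* L)),
    L .* (L .+ L .* L .+ (L .+ L) .* (L .+ L .* L)),
    L .* (L .* L .+ L .* (L .+ L) .+ L .* (L .+ L)),
    L .* (L .* (L .+ L) .+ L .* (L .* L .+ L .* L)),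
    (L .+ L .+ (L .+ L) .* (L .+ L)) .* (L .+ L .* L),
    (L .+ L .* L) .* (L .+ (L .+ L) .* (L .+ L .* L)),
    (L .+ L .* L) .* (L .* (L .+ L) .+ L .* (L .+ L)),
    L .+ L .+ (L .+ L) .* (L .+ L .+ L .+ L .* L), L .+ L .* L .+ L .* L .+ (L .+ L) .* (L .+ L),
    L .+ L .* L .+ (L .+ L) .* (L .+ L .+ L .* L), L .* L .+ L .* L .+ (L .+ L) .* (L .+ L .* L),
    L .* L .+ L .* (L .+ L) .+ (L .+ L) .* (L .+ L),
    L .* (L .+ L) .+ (L .+ L) .* (L .+ L .+ L .* L),
    L .* (L .+ L) .+ (L .+ L .+ L) .* (L .+ L .+ L),
    L .* (L .* L .+ L .* L) .+ (L .+ L) .* (L .+ L),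
    L .* (L .+ L .+ L .+ (L .+ L .+ L) .* (L .+ L .+ L)),
    L .+ L .+ L .* L .+ (L .+ L .+ L) .* (L .+ L .+ L),
    L .+ L .+ L .+ (L .+ L .+ L .+ L) .* (L .+ L .+ L .+ L)]"

definition "trees_444 =
   [(L .+ L .* L .+ L .* L) .* (L .+ L .* L), L .* (L .+ L) .+ L .* (L .+ L) .* (L .+ L),
    (L .+ L) .* (L .+ L) .+ (L .+ L) .* (L .+ L),
    (L .+ L .+ (L .+ L) .* (L .+ L)) .* (L .+ L .* L),
    (L .+ L .* L) .* (L .+ (L .+ L) .* (L .+ L .* L)),
    (L .+ L .* L) .* (L .* (L .+ L) .+ L .* (L .+ L)),
    L .+ L .+ L .+ L .+ L .* (L .+ L) .* (L .+ L), L .+ L .+ L .+ L .* L .* (L .* L .+ L .* L),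
    L .+ L .+ L .+ L .* (L .+ L) .* (L .+ L .* L),
    L .+ L .+ L .+ L .* (L .+ (L .+ L) .* (L .+ L)),
    L .+ L .+ L .+ L .* (L .* L .+ L .* (L .+ L)),
    L .+ L .+ L .+ (L .+ L) .* (L .+ L .* (L .+ L)),
    L .+ L .+ L .+ (L .+ L .* L) .* (L .+ L .* L), L .+ L .+ L .* L .* (L .+ L .* L .+ L .* L),
    L .+ L .+ L .* (L .+ L .+ L .* L .+ L .* L), L .+ L .+ L .* (L .+ L .+ (L .+ L) .* (L .+ L)),
    L .+ L .+ L .* (L .+ L .* L .+ L .* (L .+ L)), L .+ L .+ L .* (L .+ L .* (L .* L .+ L .* L)),
    L .+ L .+ L .* (L .+ (L .+ L) .* (L .+ L .* L)),
    L .+ L .+ L .* (L .* L .+ L .* (L .+ L .* L)),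
    L .+ L .+ L .* (L .* (L .+ L) .+ L .* (L .+ L)), L .+ L .* L .+ L .* L .+ L .* L .+ L .* L,
    L .+ L .* L .+ L .* (L .+ L .* L .+ L .* L), L .+ L .* (L .+ L .* L .+ L .* L .+ L .* L),
    L .+ L .* (L .+ L .* (L .+ L .* L .+ L .* L)),
    L .+ L .* (L .* (L .+ L) .+ (L .+ L) .* (L .+ L)),
    L .* L .+ L .* (L .+ L) .+ (L .+ L) .* (L .+ L),
    L .* (L .+ L) .+ L .* L .* (L .* L .+ L .* L), L .* (L .+ L) .+ L .* (L .+ L .* L .+ L .* L),
    L .* (L .+ L) .+ L .* (L .* L .+ L .* (L .+ L)),
    L .* (L .+ L) .+ (L .+ L) .* (L .+ L .+ L .* L),
    L .* (L .+ L) .+ (L .+ L .+ L) .* (L .+ L .+ L),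
    L .* (L .+ L) .+ (L .+ L .* L) .* (L .+ L .* L),
    L .* (L .* L .+ L .* L) .+ (L .+ L) .* (L .+ L),
    L .+ L .+ L .+ (L .+ L) .* (L .+ L .+ L .+ L .* L),
    L .+ L .+ L .* L .+ L .* L .+ (L .+ L) .* (L .+ L),
    L .+ L .+ L .* L .+ (L .+ L) .* (L .+ L .+ L .* L),
    L .+ L .* L .+ L .* L .+ (L .+ L) .* (L .+ L .* L),
    L .+ L .* (L .+ L .+ L .* L .+ (L .+ L) .* (L .+ L)),
    L .+ L .* (L .+ L .+ (L .+ L) .* (L .+ L .+ L .* L)),
    L .+ L .* (L .+ L .* L .+ (L .+ L) .* (L .+ L .* L)),
    L .+ L .* (L .* L .+ L .* (L .+ L) .+ L .* (L .+ L)),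
    L .+ L .* (L .* (L .+ L) .+ L .* (L .* L .+ L .* L)),
    L .* L .+ L .* L .+ L .* (L .+ L) .+ L .* (L .+ L),
    L .* L .+ L .* (L .+ L) .+ L .* (L .* L .+ L .* L),
    L .* (L .* L .+ L .* L) .+ L .* (L .* L .+ L .* L),
    L .+ L .+ L .+ L .* L .+ (L .+ L .+ L) .* (L .+ L .+ L),
    L .+ L .* (L .+ L .+ L .+ (L .+ L .+ L) .* (L .+ L .+ L)),
    L .+ L .+ L .+ L .+ (L .+ L .+ L .+ L) .* (L .+ L .+ L .+ L)]"

definition minimal_trees :: "profile \<Rightarrow> cotree list" where
  "minimal_trees s =
   (if s = (1,0,0) then trees_100
    else if s = (1,1,0) then trees_110
    else if s = (2,0,0) then trees_200
    else if s = (2,1,1) then trees_211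
    else if s = (2,2,1) then trees_221
    else if s = (3,0,0) then trees_300
    else if s = (3,1,1) then trees_311
    else if s = (3,2,2) then trees_322
    else if s = (3,3,2) then trees_332
    else if s = (4,0,0) then trees_400
    else if s = (4,1,0) then trees_410
    else if s = (4,1,1) then trees_411
    else if s = (4,2,0) then trees_420
    else if s = (4,2,1) then trees_421
    else if s = (4,2,2) then trees_422
    else if s = (4,3,0) then trees_430
    else if s = (4,3,1) then trees_431
    else if s = (4,3,3) then trees_433
    else if s = (4,4,0) then trees_440
    else if s = (4,4,1) then trees_441
    else if s = (4,4,2) then trees_442
    else if s = (4,4,3) then trees_443
    else if s = (4,4,4) then trees_444
    else [])"

text \<open>
  An entry \<open>(s, rs)\<close> lists, up to exchanging the operands, the minimal pairs of profiles
  that \<open>profile_op j\<close> lifts to a profile at least \<open>s\<close>, neither member of a pair being at least \<open>s\<close>.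
\<close>

definition rules :: "bool \<Rightarrow> (profile \<times> (profile \<times> profile) list) list" where
  "rules j = (if j then
   [((1,0,0), []),
    ((1,1,0), [((1,0,0),(1,0,0))]),
    ((2,0,0), []),
    ((2,1,1), []),
    ((2,2,1), [((2,0,0),(2,1,1))]),
    ((3,0,0), [((1,0,0),(2,0,0))]),
    ((3,1,1), [((1,0,0),(2,1,1))]),
    ((3,2,2), []),
    ((3,3,2), [((1,0,0),(3,2,2))]),
    ((4,0,0), [((1,0,0),(2,0,0))]),
    ((4,1,0), [((1,0,0),(2,0,0))]),
    ((4,1,1), [((1,0,0),(2,1,1))]),
    ((4,2,0), [((1,0,0),(2,2,1)), ((2,0,0),(2,0,0))]),
    ((4,2,1), [((1,0,0),(2,2,1)), ((2,0,0),(2,1,1))]),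
    ((4,2,2), [((1,0,0),(3,2,2))]),
    ((4,3,0), [((1,0,0),(3,2,2)), ((1,0,0),(4,2,0)), ((1,1,0),(2,2,1)), ((2,0,0),(3,1,1)),
       ((2,0,0),(4,1,0)), ((2,1,1),(2,1,1)), ((3,0,0),(3,0,0))]),
    ((4,3,1), [((1,0,0),(3,2,2)), ((1,0,0),(4,2,1)), ((1,1,0),(2,2,1)), ((2,0,0),(3,1,1)),
       ((2,1,1),(2,1,1)), ((2,1,1),(4,1,0))]),
    ((4,3,3), [((2,1,1),(3,2,2))]),
    ((4,4,0), [((1,0,0),(4,2,0)), ((1,1,0),(2,2,1)), ((2,0,0),(4,1,0)), ((2,1,1),(2,1,1)),
       ((4,0,0),(4,0,0))]),
    ((4,4,1), [((1,0,0),(4,2,1)), ((1,1,0),(2,2,1)), ((2,0,0),(4,1,1)), ((2,1,1),(2,1,1)),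
       ((2,1,1),(4,1,0))]),
    ((4,4,2), [((1,0,0),(4,2,2)), ((1,1,0),(3,2,2))]),
    ((4,4,3), [((1,0,0),(4,3,3)), ((2,1,1),(3,2,2))]),
    ((4,4,4), [((2,1,1),(3,2,2))])]
   else
   [((1,0,0), []),
    ((1,1,0), []),
    ((2,0,0), [((1,0,0),(1,0,0))]),
    ((2,1,1), [((1,0,0),(1,1,0))]),
    ((2,2,1), [((1,0,0),(4,2,0)), ((1,1,0),(1,1,0))]),
    ((3,0,0), [((1,0,0),(2,0,0))]),
    ((3,1,1), [((1,0,0),(2,1,1)), ((1,0,0),(4,1,0)), ((1,1,0),(2,0,0))]),
    ((3,2,2), [((1,0,0),(2,2,1)), ((1,1,0),(2,1,1)), ((2,0,0),(4,2,0)), ((4,1,0),(4,1,0))]),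
    ((3,3,2), [((1,0,0),(4,3,1)), ((1,1,0),(2,2,1)), ((2,0,0),(4,3,0)), ((2,1,1),(4,2,0)),
       ((4,1,0),(4,2,0))]),
    ((4,0,0), [((1,0,0),(3,0,0)), ((2,0,0),(2,0,0))]),
    ((4,1,0), [((1,0,0),(3,1,1)), ((1,1,0),(3,0,0)), ((2,0,0),(2,1,1))]),
    ((4,1,1), [((1,0,0),(3,1,1)), ((1,0,0),(4,1,0)), ((1,1,0),(3,0,0)), ((2,0,0),(2,1,1))]),
    ((4,2,0), [((1,0,0),(3,2,2)), ((1,1,0),(3,1,1)), ((1,1,0),(4,1,0)), ((2,0,0),(2,2,1)),
       ((2,1,1),(2,1,1))]),
    ((4,2,1), [((1,0,0),(3,2,2)), ((1,0,0),(4,2,0)), ((1,1,0),(3,1,1)), ((1,1,0),(4,1,0)),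
       ((2,0,0),(2,2,1)), ((2,1,1),(2,1,1))]),
    ((4,2,2), [((1,0,0),(3,2,2)), ((1,0,0),(4,2,1)), ((1,1,0),(3,1,1)), ((2,0,0),(2,2,1)),
       ((2,0,0),(4,2,0)), ((2,1,1),(2,1,1)), ((2,1,1),(4,1,0)), ((4,1,0),(4,1,0))]),
    ((4,3,0), [((1,0,0),(3,3,2)), ((1,1,0),(3,2,2)), ((1,1,0),(4,2,0)), ((2,1,1),(2,2,1)),
       ((2,2,1),(4,1,0))]),
    ((4,3,1), [((1,0,0),(3,3,2)), ((1,0,0),(4,3,0)), ((1,1,0),(3,2,2)), ((1,1,0),(4,2,0)),
       ((2,1,1),(2,2,1)), ((2,2,1),(4,1,0))]),
    ((4,3,3), [((1,0,0),(3,3,2)), ((1,1,0),(3,2,2)), ((2,0,0),(4,3,1)), ((2,1,1),(2,2,1)),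
       ((3,0,0),(4,3,0)), ((3,1,1),(4,2,0)), ((4,1,0),(4,2,0))]),
    ((4,4,0), [((1,1,0),(3,3,2)), ((1,1,0),(4,3,0)), ((2,2,1),(2,2,1)), ((2,2,1),(4,2,0)),
       ((4,2,0),(4,2,0))]),
    ((4,4,1), [((1,0,0),(4,4,0)), ((1,1,0),(3,3,2)), ((1,1,0),(4,3,0)), ((2,2,1),(2,2,1)),
       ((2,2,1),(4,2,0)), ((4,2,0),(4,2,0))]),
    ((4,4,2), [((1,0,0),(4,4,1)), ((1,1,0),(3,3,2)), ((1,1,0),(4,3,1)), ((2,0,0),(4,4,0)),
       ((2,1,1),(4,3,0)), ((2,2,1),(2,2,1)), ((2,2,1),(4,2,0)), ((4,1,0),(4,3,0)),
       ((4,2,0),(4,2,0))]),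
    ((4,4,3), [((1,0,0),(4,4,2)), ((1,1,0),(3,3,2)), ((2,0,0),(4,4,1)), ((2,1,1),(4,3,1)),
       ((2,2,1),(2,2,1)), ((3,0,0),(4,4,0)), ((3,1,1),(4,3,0)), ((3,2,2),(4,2,0)),
       ((4,1,0),(4,3,0)), ((4,2,0),(4,2,0))]),
    ((4,4,4), [((1,0,0),(4,4,3)), ((1,1,0),(4,3,3)), ((2,0,0),(4,4,2)), ((2,1,1),(3,3,2)),
       ((2,2,1),(3,2,2)), ((3,0,0),(4,4,1)), ((3,1,1),(4,3,1)), ((4,0,0),(4,4,0)),
       ((4,1,0),(4,3,0)), ((4,2,0),(4,2,0))])])"

section \<open>Certification of the tables by evaluation\<close>

fun some_ge :: "profile \<Rightarrow> cotree list \<Rightarrow> bool" where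
  "some_ge s [] = False"
| "some_ge s (t # ts) = (if profile_le s (profile t) then True else some_ge s ts)"

text \<open>A merged cotree that is missing from the table has to be non-minimal, witnessed by a
  vertex deletion that still reaches \<open>s\<close>.\<close>

definition check_pair :: "profile \<Rightarrow> cotree list \<Rightarrow> bool \<Rightarrow> cotree \<Rightarrow> cotree \<Rightarrow> bool" where
  "check_pair s ts j x y =
     (let z = tree_merge j x y in if z \<in> set ts then True else some_ge s (deletions z))"

definition check_rules :: "bool \<Rightarrow> bool" where
  "check_rules j = list_all (\<lambda>(s, rs). list_all (\<lambda>(p, q).
     list_all (\<lambda>x. list_all (check_pair s (minimal_trees s) j x) (minimal_trees q)) (minimal_trees p)) rs)
     (rules j)"

lemma check_rules: "check_rules j"
proof -
  have "check_rules False" by code_simp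
  moreover have "check_rules True" by code_simp
  ultimately show ?thesis by (cases j) simp_all
qed

fun covered :: "profile \<Rightarrow> profile \<Rightarrow> (profile \<times> profile) list \<Rightarrow> bool" where
  "covered p q [] = False"
| "covered p q ((p', q') # rs) =
     (if profile_le p' p then if profile_le q' q then True else covered p q rs
      else covered p q rs)"

text \<open>Pairs with an operand that is already at least \<open>s\<close> are exempt: there a
  vertex of the other operand can be deleted, so the whole graph is not minimal.\<close>

definition check_cover :: "bool \<Rightarrow> profile \<Rightarrow> profile \<Rightarrow> bool" where
  "check_cover j p q = (let r = profile_op j p q in
    list_all (\<lambda>(s, rs). if profile_le s r then
      if profile_le s p then True else if profile_le s q then True
      else if covered p q rs then True else covered q p rs
     else True) (rules j))"

lemma check_cover: "list_all (\<lambda>p. list_all (check_cover j p) profiles) profiles"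
proof -
  have "list_all (\<lambda>p. list_all (check_cover False p) profiles) profiles" by code_simp
  moreover have "list_all (\<lambda>p. list_all (check_cover True p) profiles) profiles" by code_simp
  ultimately show ?thesis by (cases j) simp_all
qed

text \<open>A rule bounds the profiles of the operands only from below, in one of the two orders.
  The operands are then examined for the profiles of the rule and not for their own.\<close>

lemma rulesE:
  assumes "profile_le s (profile_op j p q)" "\<not> profile_le s p" "\<not> profile_le s q"
    "(s, rs) \<in> set (rules j)" "p \<in> set profiles" "q \<in> set profiles"
  obtains p' q' where "(p', q') \<in> set rs" "profile_le p' p \<and> profile_le q' q \<or> profile_le p' q \<and> profile_le q' p"
proof -
  have cov: "\<exists>(p', q')\<in>set rs. profile_le p' p \<and> profile_le q' q" if "covered p q rs" for p q rs
    using that by (induction p q rs rule: covered.induct) (auto split: if_splits)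
  have "check_cover j p q" using check_cover[of j] assms(5,6) by (auto simp: list_all_iff)
  then have "covered p q rs \<or> covered q p rs"
    using assms(1-4) by (auto simp: check_cover_def list_all_iff Let_def split: if_splits)
  then show thesis using cov[of p q rs] cov[of q p rs] that by fast
qed

lemma check_rulesD:
  assumes "(s, rs) \<in> set (rules j)" "(p, q) \<in> set rs"
    "x \<in> set (minimal_trees p)" "y \<in> set (minimal_trees q)"
  shows "tree_merge j x y \<in> set (minimal_trees s) \<or>
    (\<exists>d\<in>set (deletions (tree_merge j x y)). profile_le s (profile d))"
proof -
  have some_ge: "\<exists>d\<in>set ts. profile_le s (profile d)" if "some_ge s ts" for ts
    using that by (induction s ts rule: some_ge.induct) (auto split: if_splits)
  have "check_pair s (minimal_trees s) j x y"
    using check_rules[of j] assms unfolding check_rules_def list_all_iff by fast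
  then show ?thesis
    using some_ge by (auto simp: check_pair_def Let_def split: if_splits)
qed

text \<open>The list contains the profile of a vertex and is closed under both operations. This
  turns evaluations over the list into facts about all cotrees.\<close>

lemma profile_in_profiles: "profile t \<in> set profiles"
proof (induction t)
  case Leaf
  then show ?case by (simp add: profiles_def)
next
  case (Node j s t)
  have "list_all (\<lambda>p. list_all (\<lambda>q. profile_op False p q \<in> set profiles) profiles) profiles"
    by code_simp
  moreover have "list_all (\<lambda>p. list_all (\<lambda>q. profile_op True p q \<in> set profiles) profiles) profiles"
    by code_simp
  ultimately show ?case
    using Node by (cases j) (auto simp: list_all_iff)
qed

text \<open>Heredity at the level of profiles. It depends on the list: joining
  \<open>(1, 4, 0)\<close> with \<open>(1, 0, 0)\<close> would lower the second entry to
  \<open>1\<close>.\<close>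

lemma profile_le_op:
  assumes "p \<in> set profiles" "q \<in> set profiles"
  shows "profile_le p (profile_op j p q)" "profile_le q (profile_op j p q)"
proof -
  have "list_all (\<lambda>p. list_all (\<lambda>q. if profile_le p (profile_op False p q)
    then profile_le q (profile_op False p q) else False) profiles) profiles"
    by code_simp
  moreover have "list_all (\<lambda>p. list_all (\<lambda>q. if profile_le p (profile_op True p q)
    then profile_le q (profile_op True p q) else False) profiles) profiles"
    by code_simp
  ultimately show "profile_le p (profile_op j p q)" "profile_le q (profile_op j p q)"
    using assms by (cases j; auto simp: list_all_iff split: if_splits)+
qed

text \<open>Every profile demanded by a rule is again a target with rules of its own, so the
  recursion never leaves the tables. The inequality carries a lower bound on the operands over to
  the whole graph.\<close>

lemma rules_closed:
  assumes "(s, rs) \<in> set (rules j)" "(p, q) \<in> set rs"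
  shows "p \<in> fst ` set (rules False)" "q \<in> fst ` set (rules False)" "profile_le s (profile_op j p q)"
proof -
  define closed where "closed j = list_all (\<lambda>(s, rs). list_all (\<lambda>(p, q).
    if p \<in> set (map fst (rules False)) then
      if q \<in> set (map fst (rules False)) then profile_le s (profile_op j p q) else False
    else False) rs) (rules j)" for j
  have "closed False" unfolding closed_def by code_simp
  moreover have "closed True" unfolding closed_def by code_simp
  ultimately have "closed j" by (cases j) simp_all
  then have "p \<in> fst ` set (rules False) \<and> q \<in> fst ` set (rules False) \<and> profile_le s (profile_op j p q)"
    using assms unfolding closed_def by (fastforce simp: list_all_iff split: if_splits)
  then show "p \<in> fst ` set (rules False)" "q \<in> fst ` set (rules False)" "profile_le s (profile_op j p q)"
    by simp_all
qed

lemma rules_Leaf: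
  assumes "(s, rs) \<in> set (rules j)" "profile_le s (1, 0, 0)"
  shows "Leaf \<in> set (minimal_trees s)"
proof -
  have "list_all (\<lambda>(s, rs). if profile_le s (1, 0, 0) then s = (1, 0, 0) else True) (rules False)"
    "list_all (\<lambda>(s, rs). if profile_le s (1, 0, 0) then s = (1, 0, 0) else True) (rules True)"
    by code_simp+
  then have "s = (1, 0, 0)" using assms by (cases j) (auto simp: list_all_iff split: if_splits)
  then show ?thesis by (simp add: minimal_trees_def trees_100_def)
qed

text \<open>Minimality descends: if an operand could lose a vertex and still reach the profile that
  the rule demands of it, monotonicity would keep the whole graph at least \<open>s\<close> after
  this deletion. The demanded profile is in general not \<open>s\<close>, hence the induction on the
  cotree with \<open>s\<close> arbitrary.\<close>

lemma minimal_realization: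
  assumes "realizes t V E" "s \<in> fst ` set (rules False)" "profile_le s (profile t)"
    and "\<And>v d. v \<in> V \<Longrightarrow> realizes d (V - {v}) E \<Longrightarrow> \<not> profile_le s (profile d)"
  shows "\<exists>u\<in>set (minimal_trees s). realizes u V E"
  using assms
proof (induction t arbitrary: V s)
  case Leaf
  then show ?case using rules_Leaf by force
next
  case (Node j a b)
  from Node.prems(1) obtain A B where *: "V = A \<union> B" "A \<inter> B = {}"
    "realizes a A E" "realizes b B E" "\<forall>a\<in>A. \<forall>b\<in>B. E a b = j \<and> E b a = j" by auto
  let ?p = "profile a" and ?q = "profile b"
  note min = Node.prems(4)
  \<comment> \<open>If one operand were already at least \<open>s\<close>, any vertex of the other
    could be deleted. Arbitrary operands are allowed so that both orders are served.\<close>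
  have del1: "\<not> profile_le s (profile a)" if
    ab: "V = A \<union> B" "A \<inter> B = {}" "realizes a A E" "realizes b B E" "\<forall>a\<in>A. \<forall>b\<in>B. E a b = j \<and> E b a = j"
    for a b A B
  proof
    assume le: "profile_le s (profile a)"
    obtain v where v: "v \<in> B" using realizes_nonempty[OF ab(4)] by blast
    show False
    proof (cases "b = Leaf")
      case True
      then have "V - {v} = A" using ab v by auto
      then show False using min[of v a] le ab v by auto
    next
      case False
      then obtain d where d: "realizes d (B - {v}) E"
        using realizes_delete_vertex[OF ab(4) _ v] by blast
      have "realizes (Node j a d) (A \<union> (B - {v})) E"
        by (intro realizes_NodeI) (use ab d in auto)
      moreover have "A \<union> (B - {v}) = V - {v}" using ab v by auto
      moreover have "profile_le s (profile (Node j a d))"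
        using profile_le_trans[OF le profile_le_op(1)] profile_in_profiles by simp
      ultimately show False using min[of v "Node j a d"] ab v by simp
    qed
  qed
  have sym: "V = B \<union> A" "B \<inter> A = {}" "\<forall>b\<in>B. \<forall>a\<in>A. E b a = j \<and> E a b = j"
    using * by auto
  have ns: "\<not> profile_le s ?p" "\<not> profile_le s ?q"
    using del1[OF *] del1[OF sym(1,2) *(4,3) sym(3)] by auto
  obtain rs where rs: "(s, rs) \<in> set (rules j)"
  proof -
    \<comment> \<open>Both rule lists have the same targets, so the premise about
      \<open>rules False\<close> provides an entry for the label \<open>j\<close>.\<close>
    have "map fst (rules False) = map fst (rules True)" by code_simp
    then have "fst ` set (rules False) = fst ` set (rules j)" by (cases j) (simp_all flip: set_map)
    then show thesis using Node.prems(2) that by auto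
  qed
  have s_le: "profile_le s (profile_op j ?p ?q)" using Node.prems(3) by simp
  obtain p q where pq: "(p, q) \<in> set rs"
    "profile_le p ?p \<and> profile_le q ?q \<or> profile_le p ?q \<and> profile_le q ?p"
    by (rule rulesE[OF s_le ns rs profile_in_profiles profile_in_profiles])
  \<comment> \<open>Generic in the operands and their induction hypotheses, because a rule pair may
    match the operands in exchanged order.\<close>
  have main: ?case if
    ab: "V = A \<union> B" "A \<inter> B = {}" "realizes a A E" "realizes b B E" "\<forall>a\<in>A. \<forall>b\<in>B. E a b = j \<and> E b a = j"
    and le: "profile_le p (profile a)" "profile_le q (profile b)"
    and IHa: "\<And>V s. realizes a V E \<Longrightarrow> s \<in> fst ` set (rules False) \<Longrightarrow> profile_le s (profile a) \<Longrightarrow>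
      (\<And>v d. v \<in> V \<Longrightarrow> realizes d (V - {v}) E \<Longrightarrow> \<not> profile_le s (profile d)) \<Longrightarrow>
      \<exists>u\<in>set (minimal_trees s). realizes u V E"
    and IHb: "\<And>V s. realizes b V E \<Longrightarrow> s \<in> fst ` set (rules False) \<Longrightarrow> profile_le s (profile b) \<Longrightarrow>
      (\<And>v d. v \<in> V \<Longrightarrow> realizes d (V - {v}) E \<Longrightarrow> \<not> profile_le s (profile d)) \<Longrightarrow>
      \<exists>u\<in>set (minimal_trees s). realizes u V E"
    for a b A B
  proof -
    note closed = rules_closed[OF rs pq(1)]
    have s_le: "profile_le s (profile (Node j d d'))" if "profile_le p (profile d)" "profile_le q (profile d')" for d d'
      using profile_le_trans[OF closed(3)
          profile_op_mono[OF that profile_le_4 profile_le_4]] by simp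
    have "\<exists>x\<in>set (minimal_trees p). realizes x A E"
    proof (rule IHa[OF ab(3) _ le(1)])
      fix v d assume v: "v \<in> A" "realizes d (A - {v}) E"
      have "realizes (Node j d b) ((A - {v}) \<union> B) E"
        by (intro realizes_NodeI) (use ab v in auto)
      moreover have "(A - {v}) \<union> B = V - {v}" using ab v by auto
      ultimately show "\<not> profile_le p (profile d)" using min[of v "Node j d b"] s_le[OF _ le(2)] ab v by auto
    qed (use closed in simp)
    moreover have "\<exists>y\<in>set (minimal_trees q). realizes y B E"
    proof (rule IHb[OF ab(4) _ le(2)])
      fix v d assume v: "v \<in> B" "realizes d (B - {v}) E"
      have "realizes (Node j a d) (A \<union> (B - {v})) E"
        by (intro realizes_NodeI) (use ab v in auto)
      moreover have "A \<union> (B - {v}) = V - {v}" using ab v by auto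
      ultimately show "\<not> profile_le q (profile d)" using min[of v "Node j a d"] s_le[OF le(1)] ab v by auto
    qed (use closed in simp)
    ultimately obtain x y where xy: "x \<in> set (minimal_trees p)" "y \<in> set (minimal_trees q)"
      "realizes x A E" "realizes y B E" by blast
    have "realizes (Node j x y) V E" unfolding ab(1) by (intro realizes_NodeI) (use ab xy in auto)
    then have z: "realizes (tree_merge j x y) V E" by (simp only: realizes_tree_merge)
    \<comment> \<open>The merged cotree is in the table or has a deletion that reaches
      \<open>s\<close>; the latter contradicts the minimality of \<open>V\<close>.\<close>
    then show ?thesis
      using check_rulesD[OF rs pq(1) xy(1,2)] realizes_deletion[OF z] min by blast
  qed
  from pq(2) show ?case
  proof
    assume "profile_le p ?p \<and> profile_le q ?q"
    then show ?thesis using main[OF * _ _ Node.IH] by blast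
  next
    assume "profile_le p ?q \<and> profile_le q ?p"
    then show ?thesis using main[OF sym(1,2) *(4,3) sym(3) _ _ Node.IH(2,1)] by blast
  qed
qed

section \<open>Cographs have cotrees\<close>

text \<open>For a symmetric irreflexive relation the listed edges and non-edges already force the
  four vertices to be distinct.\<close>

definition P4_free :: "'a set \<Rightarrow> ('a \<Rightarrow> 'a \<Rightarrow> bool) \<Rightarrow> bool" where
  "P4_free V E \<longleftrightarrow> (\<forall>a\<in>V. \<forall>b\<in>V. \<forall>c\<in>V. \<forall>d\<in>V.
     \<not> (E a b \<and> E b c \<and> E c d \<and> \<not> E a c \<and> \<not> E a d \<and> \<not> E b d))"

text \<open>The graph or its complement is disconnected; the label \<open>j\<close> covers both
  cases, so that complementation merely exchanges them.\<close>

definition splits :: "'a set \<Rightarrow> ('a \<Rightarrow> 'a \<Rightarrow> bool) \<Rightarrow> bool" where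
  "splits V E \<longleftrightarrow> (\<exists>A B j. A \<noteq> {} \<and> B \<noteq> {} \<and> V = A \<union> B \<and> A \<inter> B = {} \<and>
     (\<forall>a\<in>A. \<forall>b\<in>B. E a b = j \<and> E b a = j))"

lemma P4_free_subset: "P4_free V E \<Longrightarrow> W \<subseteq> V \<Longrightarrow> P4_free W E"
  unfolding P4_free_def by blast

lemma splitsI:
  assumes "A \<noteq> {}" "A \<subset> V" "\<And>a b. a \<in> A \<Longrightarrow> b \<in> V \<Longrightarrow> b \<notin> A \<Longrightarrow> E a b = j"
    and sym: "\<And>u v. u \<in> V \<Longrightarrow> v \<in> V \<Longrightarrow> E u v = E v u"
  shows "splits V E"
  unfolding splits_def
proof (rule exI[of _ A], rule exI[of _ "V - A"], rule exI[of _ j], intro conjI)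
  show "\<forall>a\<in>A. \<forall>b\<in>V - A. E a b = j \<and> E b a = j"
    using assms(2,3) sym by (metis DiffE psubset_imp_subset subsetD)
qed (use assms(1,2) in auto)

lemma splits_complement: "splits V (\<lambda>u v. u \<noteq> v \<and> \<not> E u v) \<Longrightarrow> splits V E"
  unfolding splits_def by (metis IntI empty_iff)

lemma P4_free_complement:
  assumes "P4_free V E" and sym: "\<And>u v. u \<in> V \<Longrightarrow> v \<in> V \<Longrightarrow> E u v = E v u"
  shows "P4_free V (\<lambda>u v. u \<noteq> v \<and> \<not> E u v)"
  unfolding P4_free_def
proof (intro ballI notI)
  fix a b c d assume V: "a \<in> V" "b \<in> V" "c \<in> V" "d \<in> V"
    and "(a \<noteq> b \<and> \<not> E a b) \<and> (b \<noteq> c \<and> \<not> E b c) \<and> (c \<noteq> d \<and> \<not> E c d) \<and> \<not> (a \<noteq> c \<and> \<not> E a c) \<and>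
      \<not> (a \<noteq> d \<and> \<not> E a d) \<and> \<not> (b \<noteq> d \<and> \<not> E b d)"
  \<comment> \<open>The complement of the path with vertices a, b, c, d in this order is the path c,
    a, d, b.\<close>
  then have "E c a \<and> E a d \<and> E d b \<and> \<not> E c d \<and> \<not> E c b \<and> \<not> E a b"
    using sym[of a c] sym[of b d] sym[of a d] sym[of b c] sym[of a b] sym[of c d] by metis
  then show False using assms(1) V unfolding P4_free_def by blast
qed

text \<open>
  If both sides of a disconnected graph \<open>A \<union> B\<close> see \<open>v\<close>, then a vertex \<open>x\<close> of \<open>A\<close> that does not
  see \<open>v\<close> lies in a component of the non-neighbours of \<open>v\<close> that has no edge to the rest: such an
  edge would extend through \<open>v\<close> to an induced path with end in \<open>B\<close>.
\<close>

lemma splits_insert_aux: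
  assumes sym: "\<And>x y. x \<in> insert v W \<Longrightarrow> y \<in> insert v W \<Longrightarrow> E x y = E y x"
    and P4: "P4_free (insert v W) E"
    and AB: "W = A \<union> B" "v \<notin> W" "\<And>a b. a \<in> A \<Longrightarrow> b \<in> B \<Longrightarrow> \<not> E a b"
    and x: "x \<in> A" "\<not> E v x" and z: "z \<in> B" "E v z"
  shows "splits (insert v W) E"
proof -
  define R where "R = {y. (\<lambda>p q. q \<in> A \<and> \<not> E v q \<and> E p q)\<^sup>*\<^sup>* x y}"
  have R: "r \<in> A \<and> \<not> E v r" if "r \<in> R" for r
  proof -
    have "(\<lambda>p q. q \<in> A \<and> \<not> E v q \<and> E p q)\<^sup>*\<^sup>* x r" using that by (simp add: R_def)
    then show ?thesis by (induction rule: rtranclp_induct) (use x in auto)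
  qed
  show ?thesis
  proof (rule splitsI[of R])
    have "x \<in> R" by (simp add: R_def)
    then show "R \<noteq> {}" by blast
    show "R \<subset> insert v W" using R AB by blast
    show "E r u = False" if "r \<in> R" "u \<in> insert v W" "u \<notin> R" for r u
    proof -
      have "\<not> E r u"
      proof
        assume ru: "E r u"
        have rA: "r \<in> A" "\<not> E v r" using R that(1) by auto
        then have "u \<noteq> v" using ru sym[of r v] AB by auto
        then have "u \<in> A" using that(2) AB(1) AB(3)[OF rA(1)] ru by auto
        moreover have "E v u"
        proof (rule ccontr)
          assume "\<not> E v u"
          then have "u \<in> R" using that(1) \<open>u \<in> A\<close> ru by (auto simp: R_def intro: rtranclp.rtrancl_into_rtrancl)
          then show False using that by simp
        qed
        moreover have "\<not> E r z" "\<not> E u z" using AB(3) rA z \<open>u \<in> A\<close> by auto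
        moreover have "E u v" "\<not> E r v" using sym[of u v] sym[of r v] \<open>E v u\<close> \<open>u \<in> A\<close> rA AB by auto
        ultimately show False
          using P4 rA z ru AB(1) unfolding P4_free_def by blast
      qed
      then show ?thesis by simp
    qed
  qed (use sym in auto)
qed

text \<open>Unless \<open>v\<close> misses a whole side or sees everything, it misses a vertex on
  one side and sees a vertex on the other, which is the situation of
  \<open>splits_insert_aux\<close>.\<close>

lemma splits_insert:
  assumes sym: "\<And>x y. x \<in> insert v W \<Longrightarrow> y \<in> insert v W \<Longrightarrow> E x y = E y x"
    and P4: "P4_free (insert v W) E"
    and AB: "W = A \<union> B" "v \<notin> W" "A \<inter> B = {}" "A \<noteq> {}" "B \<noteq> {}"
    "\<And>a b. a \<in> A \<Longrightarrow> b \<in> B \<Longrightarrow> \<not> E a b \<and> \<not> E b a"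
  shows "splits (insert v W) E"
proof -
  consider "\<forall>z\<in>A. \<not> E v z" | "\<forall>z\<in>B. \<not> E v z" | "\<forall>w\<in>W. E v w"
    | x z where "x \<in> A" "\<not> E v x" "z \<in> B" "E v z" | x z where "x \<in> B" "\<not> E v x" "z \<in> A" "E v z"
    using AB(1) by blast
  then show ?thesis
  proof cases
    case 1
    then have "\<not> E z v" if "z \<in> A" for z using sym[of z v] AB(1) that by auto
    then show ?thesis by (intro splitsI[of A _ _ False]) (use AB sym in auto)
  next
    case 2
    then have v: "\<not> E z v" if "z \<in> B" for z using sym[of z v] AB(1) that by auto
    show ?thesis
    proof (rule splitsI[of B])
      show "E a b = False" if "a \<in> B" "b \<in> insert v W" "b \<notin> B" for a b
        using that v AB(1) AB(6)[of b a] by auto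
    qed (use AB(1-5) sym in auto)
  next
    case 3
    then show ?thesis by (intro splitsI[of "{v}" _ _ True]) (use AB sym in auto)
  next
    case 4
    show ?thesis
      by (rule splits_insert_aux[where A = A and B = B and x = x and z = z]) (use assms 4 in auto)
  next
    case 5
    show ?thesis
    proof (rule splits_insert_aux[where A = B and B = A and x = x and z = z])
      show "\<not> E a b" if "a \<in> B" "b \<in> A" for a b using AB(6) that by blast
    qed (use assms(1-6) 5 in auto)
  qed
qed

text \<open>This is Seinsche's theorem. A vertex is added back to a split of the remaining graph; if
  that split is a join, passing to the complement turns it into a disjoint union, as being free of
  the path is invariant under complements.\<close>

lemma P4_free_splits:
  assumes "finite V" "card V \<ge> 2" "P4_free V E"
    and "\<And>u v. u \<in> V \<Longrightarrow> v \<in> V \<Longrightarrow> E u v = E v u"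
  shows "splits V E"
  using assms
proof (induction V rule: finite_induct)
  case empty
  then show ?case by simp
next
  case (insert v W)
  note sym = insert.prems(3)
  show ?case
  proof (cases "card W \<ge> 2")
    case True
    have "splits W E"
      by (rule insert.IH[OF True]) (use insert.prems P4_free_subset in blast)+
    then obtain A B j where AB: "A \<noteq> {}" "B \<noteq> {}" "W = A \<union> B" "A \<inter> B = {}"
      "\<forall>a\<in>A. \<forall>b\<in>B. E a b = j \<and> E b a = j"
      unfolding splits_def by blast
    show ?thesis
    proof (cases j)
      case False
      then show ?thesis by (intro splits_insert[of v W E A B]) (use insert AB in auto)
    next
      case True
      show ?thesis
      proof (rule splits_complement, rule splits_insert[of v W _ A B])
        show "P4_free (insert v W) (\<lambda>u v. u \<noteq> v \<and> \<not> E u v)"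
          by (rule P4_free_complement[OF insert.prems(2) sym])
        show "(x \<noteq> y \<and> \<not> E x y) = (y \<noteq> x \<and> \<not> E y x)" if "x \<in> insert v W" "y \<in> insert v W" for x y
          using sym[OF that] by auto
      qed (use insert AB True in auto)
    qed
  next
    case False
    then obtain w where "W = {w}" using insert by (auto simp: card_1_singleton_iff numeral_2_eq_2 not_le less_Suc_eq)
    then show ?thesis
      by (intro splitsI[of "{v}" _ _ "E v w"]) (use insert sym in auto)
  qed
qed

lemma P4_free_imp_realizes:
  assumes "finite V" "V \<noteq> {}" "P4_free V E"
    and "\<And>u v. u \<in> V \<Longrightarrow> v \<in> V \<Longrightarrow> E u v = E v u" "\<And>v. v \<in> V \<Longrightarrow> \<not> E v v"
  shows "\<exists>t. realizes t V E"
  using assms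
proof (induction "card V" arbitrary: V rule: less_induct)
  case less
  show ?case
  proof (cases "card V \<ge> 2")
    case True
    then have "splits V E" by (intro P4_free_splits) (use less.prems in auto)
    then obtain A B j where AB: "A \<noteq> {}" "B \<noteq> {}" "V = A \<union> B" "A \<inter> B = {}"
      "\<forall>a\<in>A. \<forall>b\<in>B. E a b = j \<and> E b a = j"
      unfolding splits_def by blast
    have ex: "\<exists>s. realizes s A E" if "A \<noteq> {}" "A \<subset> V" for A
    proof (rule less.hyps)
      show "card A < card V" using that less.prems by (intro psubset_card_mono)
      show "finite A" "P4_free A E"
        using that less.prems by (auto intro: finite_subset P4_free_subset)
    qed (use that less.prems in auto)
    have "\<exists>s. realizes s A E" "\<exists>t. realizes t B E"
      by (rule ex; use AB in blast)+
    then obtain s t where "realizes s A E" "realizes t B E" by blast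
    then have "realizes (Node j s t) V E" unfolding AB(3) by (intro realizes_NodeI) (use AB in auto)
    then show ?thesis by blast
  next
    case False
    then have "card V = 1" using less.prems by (metis One_nat_def Suc_1 card_gt_0_iff le_SucE not_less_eq_eq Suc_leI)
    then obtain v where "V = {v}" by (auto simp: card_1_singleton_iff)
    then have "realizes Leaf V E" using less.prems by simp
    then show ?thesis by blast
  qed
qed

section \<open>Graphs and their adjacency relations\<close>

abbreviation (input) adj :: "('a, 'b) pre_digraph \<Rightarrow> 'a \<Rightarrow> 'a \<Rightarrow> bool" where
  "adj G \<equiv> \<lambda>u v. u \<rightarrow>\<^bsub>G\<^esub> v"

lemma dominates_induce_subgraph_iff [simp]:
  "u \<rightarrow>\<^bsub>G \<restriction> S\<^esub> v \<longleftrightarrow> u \<in> S \<and> v \<in> S \<and> u \<rightarrow>\<^bsub>G\<^esub> v"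
  by (auto simp: arcs_ends_conv)

lemma (in graph) graph_induce_subgraph: "S \<subseteq> verts G \<Longrightarrow> graph (G \<restriction> S)"
  using induced_graph_imp_graph digraphI_induced digraph_axioms induced_induce sym_arcs
  by (metis digraph.graphI induced_graph_imp_symmetric)

lemma digraph_iso_imp_bij:
  assumes "G \<simeq> H"
  obtains f where "bij_betw f (verts G) (verts H)"
    "\<And>u v. u \<in> verts G \<Longrightarrow> v \<in> verts G \<Longrightarrow> adj G u v = adj H (f u) (f v)"
proof -
  obtain h where h: "pre_digraph.digraph_isomorphism G h" "H = app_iso h G"
    using assms unfolding digraph_iso_def by blast
  interpret G: wf_digraph G using h(1) by (simp add: pre_digraph.digraph_isomorphism_def)
  have inj: "inj_on (iso_verts h) (verts G)" using h(1) by (simp add: G.digraph_isomorphism_def)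
  show thesis
  proof (rule that)
    show "bij_betw (iso_verts h) (verts G) (verts H)" using inj by (simp add: h bij_betw_def)
    show "adj G u v = adj H (iso_verts h u) (iso_verts h v)" if "u \<in> verts G" "v \<in> verts G" for u v
      using that inj G.adj_in_verts
      by (auto simp: h G.arcs_ends_app_iso_eq[OF h(1)] dest: inj_onD intro: rev_image_eqI)
  qed
qed

lemma digraph_iso_if_bij:
  assumes "nomulti_digraph G" "nomulti_digraph H" and f: "bij_betw f (verts G) (verts H)"
    and adj: "\<And>u v. u \<in> verts G \<Longrightarrow> v \<in> verts G \<Longrightarrow> adj G u v = adj H (f u) (f v)"
  shows "G \<simeq> H"
proof -
  interpret G: nomulti_digraph G by fact
  interpret H: nomulti_digraph H by fact
  \<comment> \<open>Without parallel arcs an arc of \<open>H\<close> is determined by its ends, so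
    the vertex bijection leaves no choice for the arc map; \<open>inv_into\<close> picks the arc
    with the required ends.\<close>
  define g where "g e = inv_into (arcs H) (arc_to_ends H) (f (tail G e), f (head G e))" for e
  have g: "g e \<in> arcs H" "tail H (g e) = f (tail G e)" "head H (g e) = f (head G e)"
    if e: "e \<in> arcs G" for e
  proof -
    have "adj G (tail G e) (head G e)" using e by (auto simp: arcs_ends_conv)
    then have "(f (tail G e), f (head G e)) \<in> arc_to_ends H ` arcs H"
      using adj e by (simp add: arcs_ends_def)
    then show "g e \<in> arcs H" "tail H (g e) = f (tail G e)" "head H (g e) = f (head G e)"
      using inv_into_into[of _ "arc_to_ends H" "arcs H"] f_inv_into_f[of _ "arc_to_ends H" "arcs H"]
      by (auto simp: g_def arc_to_ends_def)
  qed
  have inj: "inj_on f (verts G)" using f by (simp add: bij_betw_def)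
  have inj_g: "inj_on g (arcs G)"
  proof (rule inj_onI)
    fix e e' assume e: "e \<in> arcs G" "e' \<in> arcs G" "g e = g e'"
    then have "f (tail G e) = f (tail G e')" "f (head G e) = f (head G e')"
      using g by metis+
    then show "e = e'" using inj e
      by (intro G.no_multi_arcs) (auto simp: arc_to_ends_def dest: inj_onD)
  qed
  have "g ` arcs G = arcs H"
  proof (intro equalityI subsetI)
    fix e' assume e': "e' \<in> arcs H"
    then obtain u v where uv: "u \<in> verts G" "v \<in> verts G" "f u = tail H e'" "f v = head H e'"
      using f H.wellformed[OF e'] unfolding bij_betw_def by (metis imageE)
    have "adj H (f u) (f v)" using e' uv by (auto simp: arcs_ends_conv)
    then have "adj G u v" using adj uv by simp
    then obtain e where e: "e \<in> arcs G" "tail G e = u" "head G e = v" by (auto simp: arcs_ends_conv)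
    then have "g e = e'" using g[OF e(1)] e' uv
      by (intro H.no_multi_arcs) (auto simp: arc_to_ends_def)
    then show "e' \<in> g ` arcs G" using e by blast
  qed (use g in auto)
  then have "H = app_iso \<lparr>iso_verts = f, iso_arcs = g, iso_head = head H, iso_tail = tail H\<rparr> G"
    using f by (simp add: app_iso_def bij_betw_def)
  moreover have "G.digraph_isomorphism \<lparr>iso_verts = f, iso_arcs = g, iso_head = head H, iso_tail = tail H\<rparr>"
    using inj inj_g g by (simp add: G.digraph_isomorphism_def G.wf_digraph_axioms)
  ultimately show ?thesis unfolding digraph_iso_def by blast
qed

text \<open>A realized cotree replaces isomorphism to a fixed graph, which frees the later arguments
  from the vertex and arc types of \<open>H\<close>.\<close>

lemma digraph_iso_iff_realizes:
  assumes "nomulti_digraph G" "nomulti_digraph H" "realizes t (verts H) (adj H)"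
  shows "G \<simeq> H \<longleftrightarrow> realizes t (verts G) (adj G)"
proof
  interpret G: nomulti_digraph G by fact
  assume "G \<simeq> H"
  then have HG: "H \<simeq> G" by (rule digraph_iso_swap[OF G.wf_digraph_axioms])
  obtain f where f: "bij_betw f (verts H) (verts G)"
    "\<And>u v. u \<in> verts H \<Longrightarrow> v \<in> verts H \<Longrightarrow> adj H u v = adj G (f u) (f v)"
    by (rule digraph_iso_imp_bij[OF HG]) blast
  show "realizes t (verts G) (adj G)"
    using realizes_transfer[OF assms(3), of f "adj G"] f by (simp add: bij_betw_def)
next
  assume "realizes t (verts G) (adj G)"
  then obtain f where "bij_betw f (verts G) (verts H)"
    "\<And>u v. u \<in> verts G \<Longrightarrow> v \<in> verts G \<Longrightarrow> adj G u v = adj H (f u) (f v)"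
    using realizes_iso[OF _ assms(3)] by blast
  then show "G \<simeq> H" by (rule digraph_iso_if_bij[OF assms(1,2)])
qed

section \<open>Cographs\<close>

text \<open>The path on four vertices and its complement are both connected, so its vertices cannot
  be divided between the operands of a node.\<close>

lemma realizes_P4_free: "realizes t V E \<Longrightarrow> P4_free V E"
proof (induction t arbitrary: V)
  case Leaf
  then show ?case by (auto simp: P4_free_def)
next
  case (Node j s t)
  then obtain A B where *: "V = A \<union> B" "\<forall>a\<in>A. \<forall>b\<in>B. E a b = j \<and> E b a = j"
    "P4_free A E" "P4_free B E" by auto
  show ?case
    unfolding P4_free_def *(1)
  proof (intro ballI notI)
    fix a b c d
    assume V: "a \<in> A \<union> B" "b \<in> A \<union> B" "c \<in> A \<union> B" "d \<in> A \<union> B"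
      and E: "E a b \<and> E b c \<and> E c d \<and> \<not> E a c \<and> \<not> E a d \<and> \<not> E b d"
    have same: "\<not> (x \<in> A \<and> y \<in> B) \<and> \<not> (x \<in> B \<and> y \<in> A)" if "E x y \<noteq> j" for x y
      using *(2) that by blast
    have "{a, b, c, d} \<subseteq> A \<or> {a, b, c, d} \<subseteq> B"
    proof (cases j)
      case True
      then show ?thesis using same[of a c] same[of a d] same[of b d] E V by auto
    next
      case False
      then show ?thesis using same[of a b] same[of b c] same[of c d] E V by auto
    qed
    then show False
    proof
      assume "{a, b, c, d} \<subseteq> A"
      then show False using *(3) E unfolding P4_free_def by auto
    next
      assume "{a, b, c, d} \<subseteq> B"
      then show False using *(4) E unfolding P4_free_def by auto
    qed
  qed
qed

lemma nomulti_with_proj: "pair_wf_digraph H \<Longrightarrow> nomulti_digraph (with_proj H)"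
  by (simp add: nomulti_digraph_def nomulti_digraph_axioms_def arc_to_ends_def wf_digraph_def
      pair_wf_digraph_def prod_eq_iff)

lemma nomulti_P4: "nomulti_digraph (with_proj P\<^sub>4)"
  by (rule nomulti_with_proj) (auto simp: pair_wf_digraph_def path_graph_def)

lemma cograph_imp_P4_free:
  assumes "cograph G"
  shows "P4_free (verts G) (adj G)"
  unfolding P4_free_def
proof (intro ballI notI)
  interpret graph G using assms by (simp add: cograph_def)
  fix a b c d assume V: "a \<in> verts G" "b \<in> verts G" "c \<in> verts G" "d \<in> verts G"
    and E: "adj G a b \<and> adj G b c \<and> adj G c d \<and> \<not> adj G a c \<and> \<not> adj G a d \<and> \<not> adj G b d"
  have sym: "adj G v u" if "adj G u v" for u v using sym_arcs that by (rule arcs_ends_symmetric)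
  have irrefl: "\<not> adj G u u" for u using adj_not_same by blast
  have ne: "a \<noteq> b" "a \<noteq> c" "a \<noteq> d" "b \<noteq> c" "b \<noteq> d" "c \<noteq> d" using E sym irrefl by metis+
  let ?H = "G \<restriction> {a, b, c, d}"
  define f :: "'a \<Rightarrow> nat" where "f x = (if x = a then 0 else if x = b then 1 else if x = c then 2 else 3)" for x
  have ind: "induced_subgraph ?H G" using V by (intro induced_induce) auto
  then interpret H: graph ?H using V by (intro graph_induce_subgraph) auto
  have "?H \<simeq> P\<^sub>4"
  proof (rule digraph_iso_if_bij)
    show "bij_betw f (verts ?H) (verts P\<^sub>4)"
      using ne by (auto simp: bij_betw_def inj_on_def f_def path_graph_def)
    have "\<not> adj G c a" "\<not> adj G d a" "\<not> adj G d b" "adj G b a" "adj G c b" "adj G d c"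
      using E sym by blast+
    then show "adj ?H u v = adj P\<^sub>4 (f u) (f v)" if "u \<in> verts ?H" "v \<in> verts ?H" for u v
      using that E irrefl ne by (auto simp: f_def path_graph_def)
  qed (use H.nomulti_digraph_axioms nomulti_P4 in auto)
  then show False using assms ind unfolding cograph_def by blast
qed

lemma cograph_if_realizes:
  assumes "graph G" "realizes t (verts G) (adj G)"
  shows "cograph G"
  unfolding cograph_def
proof (intro conjI notI assms(1))
  interpret graph G by fact
  assume "\<exists>H. induced_subgraph H G \<and> H \<simeq> P\<^sub>4"
  then obtain H where H: "induced_subgraph H G" "H \<simeq> P\<^sub>4" by blast
  have sub: "verts H \<subseteq> verts G" using H(1) by (auto simp: induced_subgraph_def subgraph_def)
  have HG: "G \<restriction> verts H = H" using H(1) by (rule induce_eq_iff_induced)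
  obtain f where f: "bij_betw f (verts H) (verts P\<^sub>4)"
    "\<And>u v. u \<in> verts H \<Longrightarrow> v \<in> verts H \<Longrightarrow> adj H u v = adj P\<^sub>4 (f u) (f v)"
    by (rule digraph_iso_imp_bij[OF H(2)]) blast
  have "\<exists>v\<in>verts H. f v = i" if "i < 4" for i
    using f(1) that unfolding bij_betw_def path_graph_def by (simp add: image_iff set_eq_iff) metis
  then have "\<exists>v\<in>verts H. f v = 0" "\<exists>v\<in>verts H. f v = 1" "\<exists>v\<in>verts H. f v = 2"
    "\<exists>v\<in>verts H. f v = 3" by simp_all
  then obtain a b c d where ends: "a \<in> verts H" "f a = 0" "b \<in> verts H" "f b = 1"
    "c \<in> verts H" "f c = 2" "d \<in> verts H" "f d = 3"
    by blast
  have "adj G u v = adj P\<^sub>4 (f u) (f v)" if "u \<in> verts H" "v \<in> verts H" for u v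
    using f(2)[OF that] that dominates_induce_subgraph_iff[of u v G "verts H"] by (simp add: HG)
  then have "adj G a b \<and> adj G b c \<and> adj G c d \<and> \<not> adj G a c \<and> \<not> adj G a d \<and> \<not> adj G b d"
    using ends by (simp add: path_graph_def)
  then show False using realizes_P4_free[OF assms(2)] ends sub unfolding P4_free_def by blast
qed

section \<open>Components and polarity\<close>

lemma is_multipartite_cong:
  "(\<And>u v. u \<in> V \<Longrightarrow> v \<in> V \<Longrightarrow> E u v = E' u v) \<Longrightarrow> is_multipartite V E = is_multipartite V E'"
  unfolding is_multipartite_def by simp

lemma is_cluster_cong:
  "(\<And>u v. u \<in> V \<Longrightarrow> v \<in> V \<Longrightarrow> E u v = E' u v) \<Longrightarrow> is_cluster k V E = is_cluster k V E'"
  unfolding is_cluster_def by simp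

lemma is_polar_cong:
  assumes "\<And>u v. u \<in> V \<Longrightarrow> v \<in> V \<Longrightarrow> E u v = E' u v"
  shows "is_polar k V E = is_polar k V E'"
proof -
  have "is_multipartite A E = is_multipartite A E' \<and> is_cluster k (V - A) E = is_cluster k (V - A) E'"
    if "A \<subseteq> V" for A
    using that assms is_multipartite_cong[of A E E'] is_cluster_cong[of "V - A" E E' k] by blast
  then show ?thesis unfolding is_polar_def by blast
qed

section \<open>Strong components, complete multipartite graphs and clusters\<close>

context graph
begin

lemma adj_sym: "adj G u v = adj G v u"
  using arcs_ends_symmetric[OF sym_arcs] by blast

lemma adj_irrefl: "\<not> adj G v v"
  using adj_not_same by blast

text \<open>Closure under arcs keeps the component of a vertex inside its class, and mutual
  reachability makes it the whole class.\<close>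

lemma sccs_verts_eqI:
  assumes "\<Union>\<P> = verts G" "{} \<notin> \<P>"
    and reach: "\<And>S u v. S \<in> \<P> \<Longrightarrow> u \<in> S \<Longrightarrow> v \<in> S \<Longrightarrow> u \<rightarrow>\<^sup>* v"
    and closed: "\<And>S u v. S \<in> \<P> \<Longrightarrow> u \<in> S \<Longrightarrow> u \<rightarrow> v \<Longrightarrow> v \<in> S"
  shows "sccs_verts = \<P>"
proof -
  have scc: "scc_of u = S" if "S \<in> \<P>" "u \<in> S" for S u
  proof -
    have "v \<in> S" if "u \<rightarrow>\<^sup>* v" for v
      using that by (induction rule: reachable_induct) (use \<open>S \<in> \<P>\<close> \<open>u \<in> S\<close> closed in auto)
    moreover have "u \<rightarrow>\<^sup>* v \<and> v \<rightarrow>\<^sup>* u" if "v \<in> S" for v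
      using reach[OF \<open>S \<in> \<P>\<close>] that \<open>u \<in> S\<close> by blast
    ultimately show ?thesis unfolding scc_of_def by blast
  qed
  have "scc_of ` verts G = \<P>"
  proof (intro equalityI subsetI)
    fix S assume "S \<in> \<P>"
    then obtain u where "u \<in> S" using assms(2) by (metis ex_in_conv)
    then show "S \<in> scc_of ` verts G" using scc \<open>S \<in> \<P>\<close> assms(1) by (auto intro!: image_eqI[of _ _ u])
  next
    fix S assume "S \<in> scc_of ` verts G"
    then show "S \<in> \<P>" using scc assms(1) by (metis UnionE imageE)
  qed
  then show ?thesis by (simp add: sccs_verts_conv_scc_of)
qed

text \<open>The parts are the equivalence classes of non-adjacency: reflexive and symmetric since
  the graph is simple, transitive by \<open>is_multipartite\<close>.\<close>

lemma complete_multipartite_iff: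
  "complete_multipartite_le \<infinity> G \<longleftrightarrow> is_multipartite (verts G) (adj G)"
proof
  assume "complete_multipartite_le \<infinity> G"
  then obtain \<P> where P: "partition_on (verts G) \<P>"
    "\<forall>u\<in>verts G. \<forall>v\<in>verts G. adj G u v \<longleftrightarrow> \<not> (\<exists>P\<in>\<P>. u \<in> P \<and> v \<in> P)"
    unfolding complete_multipartite_le_def by blast
  have "P = Q" if "P \<in> \<P>" "Q \<in> \<P>" "v \<in> P" "v \<in> Q" for P Q v
    using partition_onD2[OF P(1)] that by (metis IntI disjointD empty_iff)
  then show "is_multipartite (verts G) (adj G)"
    unfolding is_multipartite_def using P(2) by metis
next
  assume multi: "is_multipartite (verts G) (adj G)"
  let ?r = "{(u, v). u \<in> verts G \<and> v \<in> verts G \<and> \<not> adj G u v}"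
  have equiv: "equiv (verts G) ?r"
  proof (rule equivI)
    show "trans ?r" using multi unfolding is_multipartite_def trans_def by blast
    show "sym ?r" using adj_sym by (auto simp: sym_def)
  qed (use adj_irrefl in \<open>auto simp: refl_on_def\<close>)
  have "adj G u v \<longleftrightarrow> \<not> (\<exists>P\<in>verts G // ?r. u \<in> P \<and> v \<in> P)" if "u \<in> verts G" "v \<in> verts G" for u v
  proof -
    have "(\<exists>P\<in>verts G // ?r. u \<in> P \<and> v \<in> P) \<longleftrightarrow> (u, v) \<in> ?r"
      using that quotientI[of u "verts G" ?r] equiv_class_self[OF equiv, of u]
        quotient_eq_iff[OF equiv] in_quotient_imp_in_rel[OF equiv]
      by (metis (lifting) Image_singleton_iff empty_subsetI insert_subset)
    then show ?thesis using that by simp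
  qed
  moreover have "finite (verts G // ?r)" by (rule finite_quotient) auto
  ultimately show "complete_multipartite_le \<infinity> G"
    unfolding complete_multipartite_le_def using partition_on_quotient[OF equiv]
    by (intro exI[of _ "verts G // ?r"]) simp
qed

text \<open>Colours and components determine one another: an injective numbering of the components
  is a colouring, and conversely the colour classes are the components.\<close>

lemma cluster_le_iff: "cluster_le (enat k) G \<longleftrightarrow> is_cluster k (verts G) (adj G)"
proof
  assume "cluster_le (enat k) G"
  then have complete: "\<And>C. C \<in> sccs \<Longrightarrow> complete_digraph (card (verts C)) C" and "card sccs \<le> k"
    unfolding cluster_le_def by auto
  then have k: "card sccs_verts \<le> k" by (simp add: card_sccs_verts)
  obtain f :: "'a set \<Rightarrow> nat" where f: "inj_on f sccs_verts"
    using finite_imp_inj_to_nat_seg[OF finite_sccs_verts] by blast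
  define c where "c v = f (scc_of v)" for v
  have "card (c ` verts G) \<le> k"
    using k card_image_le[OF finite_sccs_verts, of f]
    by (simp add: c_def sccs_verts_conv_scc_of image_image)
  moreover have "adj G u v \<longleftrightarrow> c u = c v" if uv: "u \<in> verts G" "v \<in> verts G" "u \<noteq> v" for u v
  proof
    assume "adj G u v"
    then have "scc_of u = scc_of v" by (intro scc_of_eq scc_ofI_reachable) simp
    then show "c u = c v" by (simp add: c_def)
  next
    assume "c u = c v"
    then have eq: "scc_of u = scc_of v"
      using f uv scc_of_in_sccs_verts unfolding c_def inj_on_def by blast
    let ?S = "scc_of u"
    have "G \<restriction> ?S \<in> sccs" using in_sccs_verts_conv scc_of_in_sccs_verts uv by blast
    then have "arcs_ends (G \<restriction> ?S) = {(u, v). (u, v) \<in> ?S \<times> ?S \<and> u \<noteq> v}"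
      using complete by (simp add: complete_digraph_def)
    then have "adj (G \<restriction> ?S) u v" using uv in_scc_of_self[of u] in_scc_of_self[of v] eq by auto
    then show "adj G u v" by simp
  qed
  ultimately show "is_cluster k (verts G) (adj G)" unfolding is_cluster_def by blast
next
  assume "is_cluster k (verts G) (adj G)"
  then obtain c :: "'a \<Rightarrow> nat" where c: "card (c ` verts G) \<le> k"
    "\<forall>u\<in>verts G. \<forall>v\<in>verts G. u \<noteq> v \<longrightarrow> (adj G u v \<longleftrightarrow> c u = c v)"
    unfolding is_cluster_def by blast
  \<comment> \<open>Only colours that occur are used, so no class is empty.\<close>
  let ?P = "(\<lambda>i. {v \<in> verts G. c v = i}) ` c ` verts G"
  have P: "sccs_verts = ?P"
  proof (rule sccs_verts_eqI)
    show "u \<rightarrow>\<^sup>* v" if "S \<in> ?P" "u \<in> S" "v \<in> S" for S u v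
    proof (cases "u = v")
      case False
      then have "adj G u v" using that c(2) by auto
      then show ?thesis by simp
    qed (use that in auto)
    show "v \<in> S" if "S \<in> ?P" "u \<in> S" "u \<rightarrow> v" for S u v
    proof -
      have "u \<noteq> v" using that(3) adj_irrefl by blast
      then have "c u = c v" using that(3) c(2) adj_in_verts[OF that(3)] by blast
      then show ?thesis using that adj_in_verts[OF that(3)] by auto
    qed
  qed auto
  have "complete_digraph (card (verts C)) C" if C: "C \<in> sccs" for C
  proof -
    obtain S where S: "S \<in> sccs_verts" "C = G \<restriction> S" 
      using C unfolding sccs_conv_sccs_verts by blast
    then have "S \<subseteq> verts G" by (simp add: sccs_verts_subsets)
    moreover have adj: "adj G u v \<longleftrightarrow> u \<noteq> v" if "u \<in> S" "v \<in> S" for u v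
    proof -
      obtain i where "S = {v \<in> verts G. c v = i}" using S(1) unfolding P by auto
      then show ?thesis using that c(2) adj_irrefl[of u] by (cases "u = v") auto
    qed
    have "arcs_ends (G \<restriction> S) = {(u, v). (u, v) \<in> S \<times> S \<and> u \<noteq> v}"
    proof (intro set_eqI)
      fix x show "x \<in> arcs_ends (G \<restriction> S) \<longleftrightarrow> x \<in> {(u, v). (u, v) \<in> S \<times> S \<and> u \<noteq> v}"
        using adj by (cases x) auto
    qed
    with calculation show ?thesis
      using graph_induce_subgraph[of S] by (simp add: S(2) complete_digraph_def)
  qed
  moreover have "card sccs_verts \<le> k"
    unfolding P using c(1) card_image_le[of "c ` verts G" "\<lambda>i. {v \<in> verts G. c v = i}"] by simp
  moreover have "finite sccs" using finite_sccs_verts by (simp add: sccs_conv_sccs_verts)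
  ultimately show "cluster_le (enat k) G"
    unfolding cluster_le_def by (simp add: card_sccs_verts)
qed

end

lemma polar_iff_is_polar:
  assumes "graph G"
  shows "polar \<infinity> (enat k) G \<longleftrightarrow> is_polar k (verts G) (adj G)"
proof -
  interpret graph G by fact
  have "complete_multipartite_le \<infinity> (G \<restriction> A) \<longleftrightarrow> is_multipartite A (adj G)"
    "cluster_le (enat k) (G \<restriction> A) \<longleftrightarrow> is_cluster k A (adj G)" if "A \<subseteq> verts G" for A
  proof -
    interpret A: graph "G \<restriction> A" using that by (rule graph_induce_subgraph)
    show "complete_multipartite_le \<infinity> (G \<restriction> A) \<longleftrightarrow> is_multipartite A (adj G)"
      using A.complete_multipartite_iff is_multipartite_cong[of A "adj (G \<restriction> A)" "adj G"] by simp
    show "cluster_le (enat k) (G \<restriction> A) \<longleftrightarrow> is_cluster k A (adj G)"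
      using A.cluster_le_iff is_cluster_cong[of A "adj (G \<restriction> A)" "adj G"] by simp
  qed
  moreover have "A \<union> B = verts G \<and> A \<inter> B = {} \<longleftrightarrow> A \<subseteq> verts G \<and> B = verts G - A" for A B by blast
  ultimately show ?thesis
    unfolding polar_def polar_partition_def is_polar_def by (metis (no_types, lifting) Diff_subset)
qed

section \<open>Components of a cotree\<close>

text \<open>A join of nonempty graphs is connected, so cutting at the union nodes that lie above all
  joins yields exactly the components.\<close>

fun union_parts :: "cotree \<Rightarrow> cotree list" where
  "union_parts Leaf = [Leaf]"
| "union_parts (Node j s t) = (if j then [Node j s t] else union_parts s @ union_parts t)"

text \<open>Lists are needed for the count: isomorphic components can share a cotree, while
  \<open>distinct Vs\<close> keeps their vertex sets apart.\<close>

lemma realizes_union_parts: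
  "realizes t V E \<Longrightarrow> \<exists>Vs. list_all2 (\<lambda>c U. realizes c U E) (union_parts t) Vs \<and> \<Union> (set Vs) = V \<and>
     distinct Vs \<and> (\<forall>U\<in>set Vs. \<forall>u\<in>U. \<forall>v\<in>V. E u v \<longrightarrow> v \<in> U)"
proof (induction t arbitrary: V)
  case Leaf
  then show ?case by (intro exI[of _ "[V]"]) auto
next
  case (Node j s t)
  show ?case
  proof (cases j)
    case True
    then show ?thesis using Node.prems by (intro exI[of _ "[V]"]) (simp del: realizes.simps)
  next
    case False
    obtain A B where *: "V = A \<union> B" "A \<inter> B = {}"
      "realizes s A E" "realizes t B E" "\<forall>a\<in>A. \<forall>b\<in>B. \<not> E a b \<and> \<not> E b a"
      using Node.prems False by auto
    obtain Us where Us: "list_all2 (\<lambda>c U. realizes c U E) (union_parts s) Us" "\<Union> (set Us) = A"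
      "distinct Us" "\<forall>U\<in>set Us. \<forall>u\<in>U. \<forall>v\<in>A. E u v \<longrightarrow> v \<in> U"
      using Node.IH(1)[OF *(3)] by blast
    obtain Ws where Ws: "list_all2 (\<lambda>c U. realizes c U E) (union_parts t) Ws" "\<Union> (set Ws) = B"
      "distinct Ws" "\<forall>U\<in>set Ws. \<forall>u\<in>U. \<forall>v\<in>B. E u v \<longrightarrow> v \<in> U"
      using Node.IH(2)[OF *(4)] by blast
    \<comment> \<open>Disjointness of \<open>A\<close> and \<open>B\<close> separates the members of
      the two lists only because these are nonempty.\<close>
    have "U \<noteq> {}" if "U \<in> set Us" for U
      using list_all2_conv_all_nth[THEN iffD1, OF Us(1)] that
      by (metis in_set_conv_nth realizes_nonempty)
    then have "set Us \<inter> set Ws = {}" using *(2) Us(2) Ws(2) by blast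
    moreover have "v \<in> U" if U: "U \<in> set (Us @ Ws)" "u \<in> U" "v \<in> V" "E u v" for U u v
    proof -
      consider "U \<in> set Us" "u \<in> A" | "U \<in> set Ws" "u \<in> B" using U Us(2) Ws(2) by auto
      then show ?thesis
      proof cases
        case 1
        then have "v \<in> A" using U(3,4) *(1,5) by blast
        then show ?thesis using 1 Us(4) U by blast
      next
        case 2
        then have "v \<in> B" using U(3,4) *(1,5) by blast
        then show ?thesis using 2 Ws(4) U by blast
      qed
    qed
    ultimately show ?thesis
      using False Us(1-3) Ws(1-3) *(1) by (intro exI[of _ "Us @ Ws"]) (auto simp: list_all2_appendI)
  qed
qed

text \<open>Two vertices on the same side of a join have every vertex of the other side as a common
  neighbour.\<close>

lemma union_parts_connected:
  assumes "c \<in> set (union_parts t)" "realizes c U E" "u \<in> U" "v \<in> U"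
  shows "u = v \<or> E u v \<or> (\<exists>w\<in>U. E u w \<and> E w v)"
proof -
  have "c = Leaf \<or> (\<exists>a b. c = Node True a b)"
    using assms(1) by (induction t) (auto split: if_splits)
  then show ?thesis
  proof
    assume "\<exists>a b. c = Node True a b"
    then obtain A B a b where "U = A \<union> B" "realizes a A E" "realizes b B E"
      "\<forall>a\<in>A. \<forall>b\<in>B. E a b \<and> E b a" using assms(2) by auto
    moreover from this have "A \<noteq> {}" "B \<noteq> {}" using realizes_nonempty by blast+
    ultimately show ?thesis using assms(3,4) by blast
  qed (use assms in auto)
qed

lemma count_image_mset_set:
  "finite V \<Longrightarrow> count (image_mset f (mset_set V)) y = card {v \<in> V. f v = y}"
  by (simp add: count_image_mset' eq_commute)

context graph
begin

lemma sccs_verts_union_parts: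
  assumes "realizes t (verts G) (adj G)"
  shows "\<exists>Vs. list_all2 (\<lambda>c U. realizes c U (adj G)) (union_parts t) Vs \<and> distinct Vs \<and> sccs_verts = set Vs"
proof -
  obtain Vs where Vs: "list_all2 (\<lambda>c U. realizes c U (adj G)) (union_parts t) Vs" "\<Union> (set Vs) = verts G"
    "distinct Vs" "\<forall>U\<in>set Vs. \<forall>u\<in>U. \<forall>v\<in>verts G. adj G u v \<longrightarrow> v \<in> U"
    using realizes_union_parts[OF assms] by blast
  have part: "\<exists>c\<in>set (union_parts t). realizes c U (adj G)" if "U \<in> set Vs" for U
    using list_all2_conv_all_nth[THEN iffD1, OF Vs(1)] that by (metis in_set_conv_nth)
  have "sccs_verts = set Vs"
  proof (rule sccs_verts_eqI[OF Vs(2)])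
    show "{} \<notin> set Vs" using part realizes_nonempty by blast
    show "u \<rightarrow>\<^sup>* v" if U: "U \<in> set Vs" "u \<in> U" "v \<in> U" for U u v
    proof -
      obtain c where "c \<in> set (union_parts t)" "realizes c U (adj G)" using part U by blast
      from union_parts_connected[OF this U(2,3)] show ?thesis
        using U Vs(2) by (auto intro: reachable_adj_trans)
    qed
    show "v \<in> U" if "U \<in> set Vs" "u \<in> U" "u \<rightarrow> v" for U u v
      using Vs(4) that adj_in_verts by blast
  qed
  then show ?thesis using Vs by blast
qed

lemma card_sccs_union_parts:
  assumes "realizes t (verts G) (adj G)"
  shows "card sccs = length (union_parts t)"
proof -
  obtain Vs where "list_all2 (\<lambda>c U. realizes c U (adj G)) (union_parts t) Vs" "distinct Vs" "sccs_verts = set Vs"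
    using sccs_verts_union_parts[OF assms] by blast
  then show ?thesis using card_sccs_verts distinct_card list_all2_lengthD by metis
qed

lemma connected_iff_card_sccs: "connected G \<longleftrightarrow> card sccs = 1"
proof
  assume "connected G"
  then have "strongly_connected G" using sym_arcs by (rule symmetric_connected_imp_strongly_connected[rotated])
  then show "card sccs = 1" by (simp add: strongly_connected_eq_iff)
next
  assume "card sccs = 1"
  then have "card sccs_verts = 1" by (simp add: card_sccs_verts)
  then obtain S where S: "sccs_verts = {S}" by (auto simp: card_1_singleton_iff)
  have "u \<rightarrow>\<^sup>* v" if "u \<in> verts G" "v \<in> verts G" for u v
  proof -
    have "v \<in> scc_of u"
      using scc_of_in_sccs_verts[OF that(1)] scc_of_in_sccs_verts[OF that(2)] in_scc_of_self[OF that(2)]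
      unfolding S by simp
    then show ?thesis by (simp add: scc_of_def)
  qed
  moreover have "verts G \<noteq> {}" using S by (auto simp: sccs_verts_conv_scc_of)
  ultimately show "connected G" by (intro connectedI reachable_mk_symmetricI)
qed

text \<open>Components are recognised by two computable criteria: equal degree sequences are
  necessary, equal normal forms are sufficient (\<open>ex_component_isoI\<close>). For the listed
  graphs and the path on three vertices both coincide, see
  \<open>listed_union_parts_P3\<close>.\<close>

lemma ex_component_iso_imp:
  assumes "realizes t (verts G) (adj G)" "nomulti_digraph H" "realizes s (verts H) (adj H)"
    "\<exists>C\<in>sccs. C \<simeq> H"
  shows "\<exists>c\<in>set (union_parts t). sort (degrees c) = sort (degrees s)"
proof -
  obtain Vs where Vs: "list_all2 (\<lambda>c U. realizes c U (adj G)) (union_parts t) Vs" "sccs_verts = set Vs"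
    using sccs_verts_union_parts[OF assms(1)] by blast
  obtain U where U: "U \<in> set Vs" "G \<restriction> U \<simeq> H"
    using assms(4) unfolding sccs_conv_sccs_verts Vs by blast
  obtain c where c: "c \<in> set (union_parts t)" "realizes c U (adj G)"
    using list_all2_conv_all_nth[THEN iffD1, OF Vs(1)] U(1) by (metis in_set_conv_nth)
  interpret U: graph "G \<restriction> U"
    using U Vs(2) sccs_verts_subsets by (intro graph_induce_subgraph) blast
  have "realizes s U (adj (G \<restriction> U))"
    using U(2) digraph_iso_iff_realizes[OF U.nomulti_digraph_axioms assms(2,3)] by simp
  then have "realizes s U (adj G)" by (rule realizes_cong[rotated]) simp
  then show ?thesis using c realizes_sort_degrees by blast
qed

lemma ex_component_isoI:
  assumes "realizes t (verts G) (adj G)" "nomulti_digraph H" "realizes s (verts H) (adj H)"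
    "c \<in> set (union_parts t)" "normalize c = normalize s"
  shows "\<exists>C\<in>sccs. C \<simeq> H"
proof -
  obtain Vs where Vs: "list_all2 (\<lambda>c U. realizes c U (adj G)) (union_parts t) Vs" "sccs_verts = set Vs"
    using sccs_verts_union_parts[OF assms(1)] by blast
  obtain U where U: "U \<in> set Vs" "realizes c U (adj G)"
    using list_all2_conv_all_nth[THEN iffD1, OF Vs(1)] assms(4) by (metis in_set_conv_nth)
  interpret U: graph "G \<restriction> U"
    using U Vs(2) sccs_verts_subsets by (intro graph_induce_subgraph) blast
  have "realizes s U (adj G)" using U(2) assms(5) realizes_normalize by metis
  then have "realizes s U (adj (G \<restriction> U))" by (rule realizes_cong[rotated]) simp
  then have "G \<restriction> U \<simeq> H"
    using digraph_iso_iff_realizes[OF U.nomulti_digraph_axioms assms(2,3)] by simp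
  then show ?thesis using U(1) unfolding sccs_conv_sccs_verts Vs by blast
qed

lemma card_isolated_vertices:
  assumes "realizes t (verts G) (adj G)"
  shows "card (isolated_vertices G) = count_list (degrees t) 0"
proof -
  have "isolated_vertices G = {v \<in> verts G. card {u \<in> verts G. adj G v u} = 0}"
    unfolding isolated_vertices_def using adj_in_verts(2) by (auto simp: card_eq_0_iff)
  also have "card \<dots> = count (image_mset (\<lambda>v. card {u \<in> verts G. adj G v u}) (mset_set (verts G))) 0"
    by (rule count_image_mset_set[symmetric]) simp
  also have "\<dots> = count_list (degrees t) 0"
    by (simp add: mset_degrees[OF assms, symmetric] count_mset)
  finally show ?thesis .
qed

end

section \<open>Cotrees of the listed graphs\<close>

definition represents :: "cotree \<Rightarrow> nat pair_pre_digraph \<Rightarrow> bool" where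
  "represents t H \<longleftrightarrow> pair_wf_digraph H \<and> realizes t (pverts H) (\<lambda>u v. (u, v) \<in> parcs H)"

lemma represents_realizes: "represents t H \<Longrightarrow> realizes t (verts H) (adj H)"
  by (simp add: represents_def)

lemma represents_nomulti: "represents t H \<Longrightarrow> nomulti_digraph H"
  by (simp add: represents_def nomulti_with_proj)

lemma represents_iso_iff:
  "represents t H \<Longrightarrow> nomulti_digraph G \<Longrightarrow> G \<simeq> H \<longleftrightarrow> realizes t (verts G) (adj G)"
  by (intro digraph_iso_iff_realizes represents_nomulti represents_realizes)

lemma ex_iso_iff:
  assumes "list_all2 represents ts Hs" "nomulti_digraph G"
  shows "(\<exists>H\<in>set Hs. G \<simeq> H) \<longleftrightarrow> (\<exists>t\<in>set ts. realizes t (verts G) (adj G))"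
  using assms(1) by (induction rule: list_all2_induct) (auto simp: represents_iso_iff[OF _ assms(2)])

text \<open>No cotree describes zero copies; \<open>tree_copies 0 t\<close> is the dummy value
  \<open>t\<close>, and \<open>represents_copies\<close> assumes a positive number.\<close>

fun tree_copies :: "nat \<Rightarrow> cotree \<Rightarrow> cotree" where
  "tree_copies (Suc (Suc n)) t = Node False t (tree_copies (Suc n) t)"
| "tree_copies _ t = t"

lemma realizes_edgeless:
  "finite V \<Longrightarrow> V \<noteq> {} \<Longrightarrow> \<forall>u\<in>V. \<forall>v\<in>V. \<not> E u v \<Longrightarrow> realizes (tree_copies (card V) Leaf) V E"
proof (induction V rule: finite_ne_induct)
  case (insert v V)
  then obtain n where n: "card V = Suc n" by (metis card_eq_0_iff not0_implies_Suc)
  have "realizes (Node False Leaf (tree_copies (card V) Leaf)) ({v} \<union> V) E"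
    by (intro realizes_NodeI) (use insert in auto)
  then show ?case using insert n by simp
qed simp

section \<open>Cotrees of the basic graphs and of the graph operations\<close>

lemma represents_K1: "represents Leaf K\<^sub>1"
  by (auto simp: represents_def complete_graph_def pair_wf_digraph_def)

lemma represents_K2: "represents (Node True Leaf Leaf) K\<^sub>2"
proof -
  have "realizes (Node True Leaf Leaf) ({0} \<union> {1}) (\<lambda>u v. (u, v) \<in> parcs K\<^sub>2)"
    by (intro realizes_NodeI) (auto simp: complete_graph_def)
  moreover have "pverts K\<^sub>2 = {0} \<union> {1}" by (auto simp: complete_graph_def)
  moreover have "pair_wf_digraph K\<^sub>2" by (auto simp: complete_graph_def pair_wf_digraph_def)
  ultimately show ?thesis unfolding represents_def by (simp only:)
qed

lemma represents_P3: "represents (Node True Leaf (Node False Leaf Leaf)) P\<^sub>3"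
proof -
  have "realizes (Node True Leaf (Node False Leaf Leaf)) ({1} \<union> ({0} \<union> {2})) (\<lambda>u v. (u, v) \<in> parcs P\<^sub>3)"
    by (intro realizes_NodeI) (auto simp: path_graph_def)
  moreover have "pverts P\<^sub>3 = {1} \<union> ({0} \<union> {2})" by (auto simp: path_graph_def)
  moreover have "pair_wf_digraph P\<^sub>3" by (auto simp: path_graph_def pair_wf_digraph_def)
  ultimately show ?thesis unfolding represents_def by (simp only:)
qed

lemma represents_C4: "represents (Node True (Node False Leaf Leaf) (Node False Leaf Leaf)) C\<^sub>4"
proof -
  have "realizes (Node True (Node False Leaf Leaf) (Node False Leaf Leaf))
      (({0} \<union> {2}) \<union> ({1} \<union> {3})) (\<lambda>u v. (u, v) \<in> parcs C\<^sub>4)"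
    by (intro realizes_NodeI) (auto simp: cycle_graph_def)
  moreover have "pverts C\<^sub>4 = ({0} \<union> {2}) \<union> ({1} \<union> {3})" by (auto simp: cycle_graph_def)
  moreover have "pair_wf_digraph C\<^sub>4" by (auto simp: cycle_graph_def pair_wf_digraph_def)
  ultimately show ?thesis unfolding represents_def by (simp only:)
qed

lemma represents_complete_bipartite:
  assumes "0 < p" "0 < q"
  shows "represents (Node True (tree_copies p Leaf) (tree_copies q Leaf)) (complete_bipartite_graph p q)"
proof -
  let ?E = "\<lambda>u v. (u, v) \<in> parcs (complete_bipartite_graph p q)"
  have "realizes (tree_copies (card {..<p}) Leaf) {..<p} ?E"
    by (rule realizes_edgeless) (use assms in \<open>auto simp: complete_bipartite_graph_def\<close>)
  moreover have "realizes (tree_copies (card {p..<p + q}) Leaf) {p..<p + q} ?E"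
    by (rule realizes_edgeless) (use assms in \<open>auto simp: complete_bipartite_graph_def\<close>)
  ultimately have "realizes (Node True (tree_copies p Leaf) (tree_copies q Leaf)) ({..<p} \<union> {p..<p + q}) ?E"
    by (intro realizes_NodeI) (auto simp: complete_bipartite_graph_def)
  moreover have "pverts (complete_bipartite_graph p q) = {..<p} \<union> {p..<p + q}"
    by (auto simp: complete_bipartite_graph_def)
  moreover have "pair_wf_digraph (complete_bipartite_graph p q)"
    by (auto simp: complete_bipartite_graph_def pair_wf_digraph_def)
  ultimately show ?thesis unfolding represents_def by (simp only:)
qed

text \<open>Union and join share the embedding into even and odd numbers and differ only in the
  edges across, hence one lemma for both values of \<open>j\<close>.\<close>

lemma represents_sum:
  assumes s: "represents s G" and t: "represents t H"
    and V: "pverts X = pverts (G \<uplus> H)"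
    and E: "parcs X = parcs (G \<uplus> H) \<union>
      (if j then \<Union>u\<in>pverts G. \<Union>v\<in>pverts H. {(2 * u, 2 * v + 1), (2 * v + 1, 2 * u)} else {})"
  shows "represents (Node j s t) X"
proof -
  interpret G: pair_wf_digraph G using s by (simp add: represents_def)
  interpret H: pair_wf_digraph H using t by (simp add: represents_def)
  let ?E = "\<lambda>u v. (u, v) \<in> parcs X"
  have odd: "Suc (2 * x) \<noteq> 2 * y" "2 * y \<noteq> Suc (2 * x)" for x y :: nat by presburger+
  have image: "(x, y) \<in> (\<lambda>(u, v). (f u, f v)) ` R \<longleftrightarrow> (\<exists>u v. (u, v) \<in> R \<and> x = f u \<and> y = f v)"
    for x y and f :: "nat \<Rightarrow> nat" and R by auto
  have E_iff: "(2 * u, 2 * v) \<in> parcs X \<longleftrightarrow> (u, v) \<in> parcs G"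
    "(2 * u + 1, 2 * v + 1) \<in> parcs X \<longleftrightarrow> (u, v) \<in> parcs H"
    "(2 * u, 2 * v + 1) \<in> parcs X \<longleftrightarrow> j \<and> u \<in> pverts G \<and> v \<in> pverts H"
    "(2 * v + 1, 2 * u) \<in> parcs X \<longleftrightarrow> j \<and> u \<in> pverts G \<and> v \<in> pverts H" for u v
    unfolding E by (auto simp: disjoint_union_def odd image split: if_splits)
  have "realizes s ((\<lambda>u. 2 * u) ` pverts G) ?E"
    by (rule realizes_transfer[of s "pverts G" "\<lambda>u v. (u, v) \<in> parcs G"])
      (use s in \<open>auto simp: represents_def E_iff inj_on_def\<close>)
  moreover have "realizes t ((\<lambda>u. 2 * u + 1) ` pverts H) ?E"
    by (rule realizes_transfer[of t "pverts H" "\<lambda>u v. (u, v) \<in> parcs H"])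
      (use t E_iff(2) in \<open>auto simp: represents_def inj_on_def\<close>)
  ultimately have "realizes (Node j s t) ((\<lambda>u. 2 * u) ` pverts G \<union> (\<lambda>u. 2 * u + 1) ` pverts H) ?E"
    by (rule realizes_NodeI) (use E_iff(3,4) odd in auto)
  moreover have "pair_wf_digraph X"
    unfolding pair_wf_digraph_def V E
    by (auto simp: disjoint_union_def split: if_splits dest: G.wellformed' H.wellformed')
  ultimately show ?thesis unfolding represents_def V by (simp add: disjoint_union_def del: realizes.simps)
qed

lemma represents_disjoint_union:
  "represents s G \<Longrightarrow> represents t H \<Longrightarrow> represents (Node False s t) (G \<uplus> H)"
  by (rule represents_sum) auto

lemma represents_join:
  "represents s G \<Longrightarrow> represents t H \<Longrightarrow> represents (Node True s t) (G \<oplus> H)"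
  by (rule represents_sum) (auto simp: join_def)

lemma represents_union_empty:
  assumes "represents t G"
  shows "represents t (G \<uplus> empty_graph)"
proof -
  interpret G: pair_wf_digraph G using assms by (simp add: represents_def)
  have "realizes t ((\<lambda>u. 2 * u) ` pverts G) (\<lambda>u v. (u, v) \<in> parcs (G \<uplus> empty_graph))"
    by (rule realizes_transfer[of t "pverts G" "\<lambda>u v. (u, v) \<in> parcs G"])
      (use assms in \<open>auto simp: represents_def disjoint_union_def empty_graph_def inj_on_def\<close>)
  then show ?thesis
    by (auto simp: represents_def disjoint_union_def empty_graph_def pair_wf_digraph_def
        dest: G.wellformed')
qed

lemma represents_copies: "represents t G \<Longrightarrow> 0 < n \<Longrightarrow> represents (tree_copies n t) (n \<cdot> G)"
proof (induction n)
  case (Suc n)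
  \<comment> \<open>A single copy is \<open>G\<close> followed by an empty summand, which
    \<open>represents_union_empty\<close> absorbs.\<close>
  then show ?case
    by (cases n) (auto intro: represents_union_empty represents_disjoint_union)
qed simp

lemma adj_complement: "adj (complement G) u v \<longleftrightarrow> u \<in> verts G \<and> v \<in> verts G \<and> u \<noteq> v \<and> \<not> adj G u v"
  by (simp add: complement_def)

lemma realizes_complement:
  assumes "realizes t (verts G) (adj G)"
  shows "realizes (co_tree t) (verts (complement G)) (adj (complement G))"
proof -
  have "realizes (co_tree t) (verts G) (\<lambda>u v. u \<noteq> v \<and> \<not> adj G u v)"
    using assms by (rule realizes_co_tree)
  then have "realizes (co_tree t) (verts G) (adj (complement G))"
    by (rule realizes_cong[rotated]) (simp only: adj_complement simp_thms)
  then show ?thesis by (simp add: complement_def)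
qed

lemma pair_wf_complement: "pair_wf_digraph (complement G)"
  by (auto simp: pair_wf_digraph_def complement_def)

lemma realizes_complement_iff:
  assumes "graph G"
  shows "realizes t (verts (complement G)) (adj (complement G)) \<longleftrightarrow> realizes (co_tree t) (verts G) (adj G)"
proof
  interpret graph G by fact
  assume "realizes t (verts (complement G)) (adj (complement G))"
  then have "realizes (co_tree t) (verts (complement (complement G))) (adj (complement (complement G)))"
    by (rule realizes_complement)
  then have "realizes (co_tree t) (verts G) (adj (complement (complement G)))"
    by (simp add: complement_def)
  \<comment> \<open>The double complement has pairs of vertices as arcs, but its adjacency is that
    of \<open>G\<close>, since neither graph has loops.\<close>
  then show "realizes (co_tree t) (verts G) (adj G)"
    by (rule realizes_cong[rotated]) (use adj_irrefl in \<open>auto simp: complement_def\<close>)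
next
  assume "realizes (co_tree t) (verts G) (adj G)"
  then show "realizes t (verts (complement G)) (adj (complement G))"
    using realizes_complement[of "co_tree t" G] by simp
qed

lemma represents_complement: "represents t H \<Longrightarrow> represents (co_tree t) (complement H)"
  using realizes_complement[of t "with_proj H"] pair_wf_complement by (simp add: represents_def)

section \<open>Cotrees for the seven classes\<close>

abbreviation (input) "K2_tree \<equiv> L .* L"
abbreviation (input) "P3_tree \<equiv> L .* (L .+ L)"
abbreviation (input) "C4_tree \<equiv> (L .+ L) .* (L .+ L)"

text \<open>The first class is described through the complement; the outer \<open>co_tree\<close>
  leads back to the graph itself.\<close>

definition co_connected_trees :: "cotree list" where
  "co_connected_trees = map (\<lambda>t. co_tree (P3_tree .+ t))
    [L .* C4_tree, co_tree (tree_copies 2 P3_tree), K2_tree .* tree_copies 2 K2_tree,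
     L .* (K2_tree .+ P3_tree)]"

definition no_isolated_no_P3_trees :: "cotree list" where
  "no_isolated_no_P3_trees =
    [tree_copies 2 C4_tree, tree_copies 2 (L .* tree_copies 2 K2_tree),
     C4_tree .+ L .* tree_copies 2 K2_tree]"

definition P3_trees :: "cotree list" where
  "P3_trees = map (\<lambda>t. P3_tree .+ t)
    [P3_tree .+ tree_copies 2 K2_tree, K2_tree .+ L .* tree_copies 2 K2_tree, K2_tree .+ C4_tree,
     tree_copies 3 L .* tree_copies 3 L, tree_copies 2 L .* (K2_tree .+ tree_copies 2 L),
     L .* (L .+ tree_copies 2 K2_tree), L .* C4_tree, co_tree (tree_copies 2 P3_tree),
     K2_tree .* tree_copies 2 K2_tree, L .* (K2_tree .+ P3_tree)]"

text \<open>The family member for \<open>p = 4\<close> is separate because it contains zero copies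
  of \<open>K\<^sub>2\<close>, for which \<open>tree_copies\<close> has no meaningful value. The
  next two classes treat the last members of their families likewise.\<close>

definition five_components_trees :: "cotree list" where
  "five_components_trees = (tree_copies 4 L .+ L .* C4_tree) #
    map (\<lambda>p. (tree_copies p L .+ tree_copies (4 - p) K2_tree) .+ tree_copies p L .* tree_copies p L)
      [1, 2, 3] @
    [tree_copies 4 L .+ tree_copies 4 L .* tree_copies 4 L]"

definition four_components_trees :: "cotree list" where
  "four_components_trees = map (\<lambda>t. tree_copies 3 L .+ t)
    [co_tree (tree_copies 2 P3_tree), L .* (P3_tree .+ K2_tree), K2_tree .* tree_copies 2 K2_tree,
     L .* (C4_tree .+ L), L .* co_tree (P3_tree .+ K2_tree), co_tree K2_tree .* (P3_tree .+ L)] @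
    map (\<lambda>p. (tree_copies p L .+ tree_copies (3 - p) K2_tree) .+
      tree_copies 2 L .* (K2_tree .+ tree_copies p L)) [1, 2] @
    [tree_copies 3 L .+ tree_copies 2 L .* (K2_tree .+ tree_copies 3 L)]"

definition three_components_trees :: "cotree list" where
  "three_components_trees = map (\<lambda>t. tree_copies 2 L .+ t)
    [L .* (C4_tree .+ tree_copies 2 L), L .* tree_copies 2 P3_tree,
     L .* (L .+ co_tree (P3_tree .+ K2_tree)), L .* (K2_tree .+ co_tree (P3_tree .+ L)),
     K2_tree .* (L .+ tree_copies 2 K2_tree), L .* ((L .+ K2_tree) .+ P3_tree),
     L .* (L .+ L .* tree_copies 2 K2_tree)] @
    [(tree_copies 1 L .+ tree_copies (2 - 1) K2_tree) .+ L .* (tree_copies 2 K2_tree .+ tree_copies 1 L),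
     tree_copies 2 L .+ L .* (tree_copies 2 K2_tree .+ tree_copies 2 L)]"

definition two_components_trees :: "cotree list" where
  "two_components_trees = map (\<lambda>t. L .+ L .* t)
    [P3_tree .+ C4_tree, P3_tree .+ L .* tree_copies 2 K2_tree, tree_copies 2 P3_tree .+ K2_tree,
     L .+ tree_copies 3 K2_tree, (tree_copies 2 L .+ K2_tree) .+ C4_tree,
     tree_copies 3 L .+ tree_copies 3 L .* tree_copies 3 L,
     (L .+ K2_tree) .+ tree_copies 2 L .* (K2_tree .+ L),
     tree_copies 2 L .+ tree_copies 2 L .* (K2_tree .+ tree_copies 2 L),
     L .+ L .* (L .+ tree_copies 2 K2_tree)]"

definition listed_trees :: "cotree list" where
  "listed_trees = co_connected_trees @ no_isolated_no_P3_trees @ P3_trees @ five_components_trees @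
     four_components_trees @ three_components_trees @ two_components_trees"

section \<open>The cotrees represent the listed graphs\<close>

lemmas represents_intros =
  represents_K1 represents_K2 represents_P3 represents_C4 represents_complete_bipartite
  represents_disjoint_union represents_join represents_copies represents_complement
  represents_union_empty

lemma represents_co_connected:
  "list_all2 represents (map co_tree co_connected_trees) (map (\<lambda>H. P\<^sub>3 \<uplus> H) co_connected_summands)"
  unfolding co_connected_trees_def co_connected_summands_def list.map co_tree_co_tree
  by (intro list.rel_intros represents_intros) simp_all

lemma represents_no_isolated_no_P3:
  "list_all2 represents no_isolated_no_P3_trees no_isolated_no_P3_obstructions"
  unfolding no_isolated_no_P3_trees_def no_isolated_no_P3_obstructions_def
  by (intro list.rel_intros represents_intros) simp_all

lemma represents_P3_summands:
  "list_all2 represents P3_trees (map (\<lambda>H. P\<^sub>3 \<uplus> H) P3_summands)"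
  unfolding P3_trees_def P3_summands_def list.map
  by (intro list.rel_intros represents_intros) simp_all

lemma represents_five_components:
  "list_all2 represents five_components_trees
    (five_components_obstruction # map five_components_family [1, 2, 3, 4])"
proof -
  \<comment> \<open>For the largest \<open>p\<close> the middle summand is the empty graph; it is
    exposed so that \<open>represents_union_empty\<close> applies.\<close>
  have eq: "five_components_family 4 = 4 \<cdot> K\<^sub>1 \<uplus> empty_graph \<uplus> complete_bipartite_graph 4 4"
    by (simp add: five_components_family_def)
  show ?thesis
    unfolding five_components_trees_def five_components_obstruction_def list.map append.simps eq
    unfolding five_components_family_def
    by (intro list.rel_intros represents_intros) simp_all
qed

lemma represents_four_components:
  "list_all2 represents four_components_trees
    (map (\<lambda>H. 3 \<cdot> K\<^sub>1 \<uplus> H) four_components_summands @ map four_components_family [1, 2, 3])"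
proof -
  have eq: "four_components_family 3 = 3 \<cdot> K\<^sub>1 \<uplus> empty_graph \<uplus> (2 \<cdot> K\<^sub>1 \<oplus> (K\<^sub>2 \<uplus> 3 \<cdot> K\<^sub>1))"
    by (simp add: four_components_family_def)
  show ?thesis
    unfolding four_components_trees_def four_components_summands_def list.map append.simps eq
    unfolding four_components_family_def
    by (intro list.rel_intros represents_intros) simp_all
qed

lemma represents_three_components:
  "list_all2 represents three_components_trees
    (map (\<lambda>H. 2 \<cdot> K\<^sub>1 \<uplus> H) three_components_summands @ map three_components_family [1, 2])"
proof -
  have eq: "three_components_family 2 = 2 \<cdot> K\<^sub>1 \<uplus> empty_graph \<uplus> (K\<^sub>1 \<oplus> (2 \<cdot> K\<^sub>2 \<uplus> 2 \<cdot> K\<^sub>1))"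
    by (simp add: three_components_family_def)
  show ?thesis
    unfolding three_components_trees_def three_components_summands_def list.map append.simps eq
    unfolding three_components_family_def
    by (intro list.rel_intros represents_intros) simp_all
qed

lemma represents_two_components:
  "list_all2 represents two_components_trees (map (\<lambda>H. K\<^sub>1 \<uplus> (K\<^sub>1 \<oplus> H)) two_components_summands)"
  unfolding two_components_trees_def two_components_summands_def list.map
  by (intro list.rel_intros represents_intros) simp_all

lemma represents_listed: "list_all2 represents listed_trees listed_cographs"
proof -
  have "list_all2 represents co_connected_trees (map (\<lambda>H. complement (P\<^sub>3 \<uplus> H)) co_connected_summands)"
    using represents_co_connected unfolding list.rel_map
    by (rule list_all2_mono) (metis co_tree_co_tree represents_complement)
  then show ?thesis
    unfolding listed_trees_def listed_cographs_def
    using represents_no_isolated_no_P3 represents_P3_summands represents_five_components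
      represents_four_components represents_three_components represents_two_components
    by (metis append.assoc append_Cons list_all2_appendI)
qed

text \<open>Table entries are normal forms, whereas \<open>listed_trees\<close> mirrors the shape of
  the graph terms; normalizing the latter makes the two lists comparable.\<close>

lemma trees_444_listed: "u \<in> set trees_444 \<Longrightarrow> \<exists>t\<in>set listed_trees. normalize t = u"
proof -
  have "let ns = map normalize listed_trees in list_all (\<lambda>u. u \<in> set ns) trees_444"
    by code_simp
  then show "u \<in> set trees_444 \<Longrightarrow> \<exists>t\<in>set listed_trees. normalize t = u"
    by (auto simp: Let_def list_all_iff)
qed

text \<open>The computation behind the converse direction: a third entry \<open>4\<close> excludes
  polarity, and a third entry of at most \<open>3\<close> after each deletion restores it.\<close>

lemma profile_listed:
  assumes "t \<in> set listed_trees"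
  shows "profile t = (4, 4, 4)" "d \<in> set (deletions t) \<Longrightarrow> snd (snd (profile d)) \<le> 3"
proof -
  have "list_all (\<lambda>t. if profile t = (4, 4, 4) then list_all (\<lambda>d. snd (snd (profile d)) \<le> 3) (deletions t)
    else False) listed_trees"
    by code_simp
  then show "profile t = (4, 4, 4)" "d \<in> set (deletions t) \<Longrightarrow> snd (snd (profile d)) \<le> 3"
    using assms by (auto simp: list_all_iff split: if_splits)
qed

text \<open>This serves two purposes: the listed graphs are pairwise non-isomorphic, and an
  obstruction has only one listed cotree.\<close>

lemma distinct_degrees_listed: "distinct (map (\<lambda>t. sort (degrees t)) listed_trees)"
  by code_simp

lemma listed_union_parts_P3:
  assumes "t \<in> set listed_trees" "c \<in> set (union_parts t)"
  shows "normalize c = P3_tree \<longleftrightarrow> sort (degrees c) = sort (degrees P3_tree)"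
proof -
  have "list_all (\<lambda>t. list_all (\<lambda>c. (normalize c = P3_tree) = (sort (degrees c) = sort (degrees P3_tree)))
    (union_parts t)) listed_trees"
    by code_simp
  then show ?thesis using assms by (auto simp: list_all_iff)
qed

definition has_P3_part :: "cotree \<Rightarrow> bool" where
  "has_P3_part t = list_ex (\<lambda>c. normalize c = P3_tree) (union_parts t)"

text \<open>Number of components, isolated vertices and path components are all visible on the
  cotree, so the seven characterisations become comparisons within one finite list.\<close>

lemma listed_classification:
  assumes "t \<in> set listed_trees"
  shows "length (union_parts t) = 1 \<longleftrightarrow> t \<in> set co_connected_trees"
    "length (union_parts t) \<noteq> 1 \<and> count_list (degrees t) 0 = 0 \<and> \<not> has_P3_part t \<longleftrightarrow>
      t \<in> set no_isolated_no_P3_trees"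
    "length (union_parts t) \<noteq> 1 \<and> has_P3_part t \<longleftrightarrow> t \<in> set P3_trees"
    "length (union_parts t) = 5 \<longleftrightarrow> t \<in> set five_components_trees"
    "length (union_parts t) = 4 \<and> count_list (degrees t) 0 \<noteq> 0 \<longleftrightarrow> t \<in> set four_components_trees"
    "length (union_parts t) = 3 \<and> count_list (degrees t) 0 \<noteq> 0 \<longleftrightarrow> t \<in> set three_components_trees"
    "length (union_parts t) = 2 \<and> count_list (degrees t) 0 = 1 \<longleftrightarrow> t \<in> set two_components_trees"
proof -
  have "list_all (\<lambda>t.
    (length (union_parts t) = 1 \<longleftrightarrow> t \<in> set co_connected_trees) \<and>
    (length (union_parts t) \<noteq> 1 \<and> count_list (degrees t) 0 = 0 \<and> \<not> has_P3_part t \<longleftrightarrow>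
      t \<in> set no_isolated_no_P3_trees) \<and>
    (length (union_parts t) \<noteq> 1 \<and> has_P3_part t \<longleftrightarrow> t \<in> set P3_trees) \<and>
    (length (union_parts t) = 5 \<longleftrightarrow> t \<in> set five_components_trees) \<and>
    (length (union_parts t) = 4 \<and> count_list (degrees t) 0 \<noteq> 0 \<longleftrightarrow> t \<in> set four_components_trees) \<and>
    (length (union_parts t) = 3 \<and> count_list (degrees t) 0 \<noteq> 0 \<longleftrightarrow> t \<in> set three_components_trees) \<and>
    (length (union_parts t) = 2 \<and> count_list (degrees t) 0 = 1 \<longleftrightarrow> t \<in> set two_components_trees))
    listed_trees"
    by code_simp
  note this[unfolded list_all_iff, rule_format, OF assms]
  then show "length (union_parts t) = 1 \<longleftrightarrow> t \<in> set co_connected_trees"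
    "length (union_parts t) \<noteq> 1 \<and> count_list (degrees t) 0 = 0 \<and> \<not> has_P3_part t \<longleftrightarrow>
      t \<in> set no_isolated_no_P3_trees"
    "length (union_parts t) \<noteq> 1 \<and> has_P3_part t \<longleftrightarrow> t \<in> set P3_trees"
    "length (union_parts t) = 5 \<longleftrightarrow> t \<in> set five_components_trees"
    "length (union_parts t) = 4 \<and> count_list (degrees t) 0 \<noteq> 0 \<longleftrightarrow> t \<in> set four_components_trees"
    "length (union_parts t) = 3 \<and> count_list (degrees t) 0 \<noteq> 0 \<longleftrightarrow> t \<in> set three_components_trees"
    "length (union_parts t) = 2 \<and> count_list (degrees t) 0 = 1 \<longleftrightarrow> t \<in> set two_components_trees"
    by blast+
qed

section \<open>The obstructions\<close>

text \<open>A proper induced subgraph misses some vertex, and polarity is hereditary; so only the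
  deletions of single vertices have to be inspected.\<close>

lemma realizes_listed_imp_obstruction:
  assumes "graph G" "t \<in> set listed_trees" and t: "realizes t (verts G) (adj G)"
  shows "cograph_minimal_polar_obstruction \<infinity> 3 G"
proof -
  interpret graph G by fact
  note polar_iff = polar_iff_is_polar[of _ 3, unfolded enat_numeral]
  have "\<not> is_polar 3 (verts G) (adj G)"
    using has_profile_profile[OF t] profile_listed(1)[OF assms(2)] by (simp add: has_profile_def)
  moreover have "polar \<infinity> 3 H" if H: "induced_subgraph H G" "H \<noteq> G" for H
  proof -
    have HG: "G \<restriction> verts H = H" using H(1) by (rule induce_eq_iff_induced)
    have sub: "verts H \<subseteq> verts G" using H(1) by (auto simp: induced_subgraph_def subgraph_def)
    then interpret H: graph H using graph_induce_subgraph HG by metis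
    have "verts H \<noteq> verts G"
      using H induced_subgraph_refl induced_eq_verts_imp_eq by blast
    then obtain v where v: "v \<in> verts G" "verts H \<subseteq> verts G - {v}" using sub by blast
    have "t \<noteq> Leaf" using profile_listed(1)[OF assms(2)] by auto
    then obtain d where d: "d \<in> set (deletions t)" "realizes d (verts G - {v}) (adj G)"
      using realizes_delete_vertex[OF t _ v(1)] by blast
    have "is_polar 3 (verts G - {v}) (adj G)"
      using has_profile_profile[OF d(2)] profile_listed(2)[OF assms(2) d(1)]
      by (auto simp: has_profile_def split: prod.splits)
    then have "is_polar 3 (verts H) (adj G)" using v(2) by (rule is_polar_subset) simp
    moreover have "adj G u v = adj H u v" if "u \<in> verts H" "v \<in> verts H" for u v
      using dominates_induce_subgraph_iff[of u v G "verts H", unfolded HG] that by simp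
    ultimately have "is_polar 3 (verts H) (adj H)" by (simp only: is_polar_cong[of "verts H" "adj G" "adj H"])
    then show ?thesis by (simp add: polar_iff[OF H.graph_axioms])
  qed
  ultimately show ?thesis
    unfolding cograph_minimal_polar_obstruction_def
    using cograph_if_realizes[OF assms(1) t] polar_iff[OF assms(1)] by blast
qed

lemma obstruction_imp_realizes_listed:
  assumes "cograph_minimal_polar_obstruction \<infinity> 3 G"
  shows "\<exists>t\<in>set listed_trees. realizes t (verts G) (adj G)"
proof -
  have cograph: "cograph G" and not_polar: "\<not> polar \<infinity> 3 G"
    and polar_sub: "\<And>H. induced_subgraph H G \<Longrightarrow> H \<noteq> G \<Longrightarrow> polar \<infinity> 3 H"
    using assms by (auto simp: cograph_minimal_polar_obstruction_def)
  interpret graph G using cograph by (simp add: cograph_def)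
  note polar_iff = polar_iff_is_polar[of _ 3, unfolded enat_numeral]
  have not_is_polar: "\<not> is_polar 3 (verts G) (adj G)" using not_polar polar_iff[OF graph_axioms] by simp
  \<comment> \<open>Cotrees exist only for nonempty graphs; the empty graph is polar.\<close>
  have "verts G \<noteq> {}" using not_is_polar by (auto simp: is_polar_def is_multipartite_def)
  then obtain t where t: "realizes t (verts G) (adj G)"
    using P4_free_imp_realizes[OF _ _ cograph_imp_P4_free[OF cograph]] adj_sym adj_irrefl by auto
  \<comment> \<open>Failure of polarity pins down the whole profile, since no other occurring
    profile has a third entry above \<open>3\<close>.\<close>
  have top: "p = (4, 4, 4)" if "p \<in> set profiles" "\<not> snd (snd p) \<le> 3" for p
    using that by (auto simp: profiles_def)
  have "\<not> snd (snd (profile t)) \<le> 3"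
    using has_profile_profile[OF t] not_is_polar by (auto simp: has_profile_def split: prod.splits)
  then have profile_t: "profile t = (4, 4, 4)" using top profile_in_profiles by blast
  have "\<exists>u\<in>set (minimal_trees (4, 4, 4)). realizes u (verts G) (adj G)"
  proof (rule minimal_realization[OF t])
    show "(4, 4, 4) \<in> fst ` set (rules False)" by (simp add: rules_def)
    show "profile_le (4, 4, 4) (profile t)" by (simp add: profile_t)
    fix v d assume v: "v \<in> verts G" and d: "realizes d (verts G - {v}) (adj G)"
    let ?H = "G \<restriction> (verts G - {v})"
    interpret H: graph ?H by (rule graph_induce_subgraph) blast
    have "verts ?H \<noteq> verts G" using v by auto
    then have "polar \<infinity> 3 ?H" using polar_sub[of ?H] by fastforce
    then have "is_polar 3 (verts G - {v}) (adj ?H)" using polar_iff[OF H.graph_axioms] by simp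
    then have "is_polar 3 (verts G - {v}) (adj G)" by (rule is_polar_cong[THEN iffD1, rotated]) simp
    then show "\<not> profile_le (4, 4, 4) (profile d)"
      using has_profile_profile[OF d] by (auto simp: has_profile_def split: prod.splits)
  qed
  then obtain u where "u \<in> set trees_444" "realizes u (verts G) (adj G)"
    by (auto simp: minimal_trees_def)
  then show ?thesis using trees_444_listed realizes_normalize by metis
qed

lemma realizes_listed_unique:
  assumes "s \<in> set listed_trees" "t \<in> set listed_trees" "realizes s V E" "realizes t V E"
  shows "s = t"
  using realizes_sort_degrees[OF assms(3,4)] distinct_degrees_listed assms(1,2)
  by (auto simp: distinct_map dest: inj_onD)

theorem theorem11:
  fixes G :: "('a, 'b) pre_digraph"
  assumes "graph G"
  shows "(cograph_minimal_polar_obstruction \<infinity> 3 G \<longrightarrow>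
      (connected G \<longleftrightarrow> (\<exists>H\<in>set co_connected_summands. complement G \<simeq> P\<^sub>3 \<uplus> H)) \<and>
      (\<not> connected G \<and> isolated_vertices G = {} \<and> \<not> (\<exists>C\<in>components G. C \<simeq> P\<^sub>3) \<longleftrightarrow>
        (\<exists>H\<in>set no_isolated_no_P3_obstructions. G \<simeq> H)) \<and>
      (\<not> connected G \<and> (\<exists>C\<in>components G. C \<simeq> P\<^sub>3) \<longleftrightarrow>
        (\<exists>H\<in>set P3_summands. G \<simeq> P\<^sub>3 \<uplus> H)) \<and>
      (card (components G) = 5 \<longleftrightarrow>
        G \<simeq> five_components_obstruction \<or> (\<exists>p\<in>{1, 2, 3, 4}. G \<simeq> five_components_family p)) \<and>
      (card (components G) = 4 \<and> isolated_vertices G \<noteq> {} \<longleftrightarrow>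
        (\<exists>H\<in>set four_components_summands. G \<simeq> 3 \<cdot> K\<^sub>1 \<uplus> H) \<or>
        (\<exists>p\<in>{1, 2, 3}. G \<simeq> four_components_family p)) \<and>
      (card (components G) = 3 \<and> isolated_vertices G \<noteq> {} \<longleftrightarrow>
        (\<exists>H\<in>set three_components_summands. G \<simeq> 2 \<cdot> K\<^sub>1 \<uplus> H) \<or>
        (\<exists>p\<in>{1, 2}. G \<simeq> three_components_family p)) \<and>
      (card (components G) = 2 \<and> card (isolated_vertices G) = 1 \<longleftrightarrow>
        (\<exists>H\<in>set two_components_summands. G \<simeq> K\<^sub>1 \<uplus> (K\<^sub>1 \<oplus> H)))) \<and>
    (cograph_minimal_polar_obstruction \<infinity> 3 G \<longleftrightarrow>
      (\<exists>H\<in>set listed_cographs. G \<simeq> H)) \<and>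
    length listed_cographs = 49 \<and>
    (\<forall>i<49. \<forall>j<49. i \<noteq> j \<longrightarrow> \<not> listed_cographs ! i \<simeq> listed_cographs ! j)"
proof (intro conjI impI)
  interpret graph G by fact
  have ex_listed: "(\<exists>H\<in>set listed_cographs. G \<simeq> H) \<longleftrightarrow> (\<exists>t\<in>set listed_trees. realizes t (verts G) (adj G))"
    by (rule ex_iso_iff[OF represents_listed nomulti_digraph_axioms])
  show "cograph_minimal_polar_obstruction \<infinity> 3 G \<longleftrightarrow> (\<exists>H\<in>set listed_cographs. G \<simeq> H)"
    unfolding ex_listed
    using realizes_listed_imp_obstruction[OF assms] obstruction_imp_realizes_listed by blast
  show length: "length listed_cographs = 49"
    by (simp add: listed_cographs_def co_connected_summands_def no_isolated_no_P3_obstructions_def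
        P3_summands_def four_components_summands_def three_components_summands_def
        two_components_summands_def)
  show "\<forall>i<49. \<forall>j<49. i \<noteq> j \<longrightarrow> \<not> listed_cographs ! i \<simeq> listed_cographs ! j"
  proof (intro allI impI notI)
    fix i j :: nat assume ij: "i < 49" "j < 49" "i \<noteq> j" "listed_cographs ! i \<simeq> listed_cographs ! j"
    have len: "length listed_trees = 49" using list_all2_lengthD[OF represents_listed] length by simp
    have i: "represents (listed_trees ! i) (listed_cographs ! i)"
      and j: "represents (listed_trees ! j) (listed_cographs ! j)"
      using list_all2_nthD[OF represents_listed] ij len by auto
    \<comment> \<open>An isomorphism would let one graph realize both cotrees, and then they
      coincide.\<close>
    have "listed_trees ! i = listed_trees ! j"
      using represents_iso_iff[OF j represents_nomulti[OF i]] represents_realizes[OF i] ij len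
      by (intro realizes_listed_unique) auto
    moreover have "distinct listed_trees" using distinct_degrees_listed by (simp add: distinct_map)
    ultimately show False using ij len by (simp add: nth_eq_iff_index_eq)
  qed
  assume "cograph_minimal_polar_obstruction \<infinity> 3 G"
  then obtain t where t: "t \<in> set listed_trees" "realizes t (verts G) (adj G)"
    using obstruction_imp_realizes_listed by blast
  \<comment> \<open>As \<open>t\<close> is the only listed cotree of \<open>G\<close>, isomorphism
    to a member of a class is the same as membership of \<open>t\<close> among the cotrees of that
    class.\<close>
  have ex_iff: "(\<exists>H\<in>set Hs. G \<simeq> H) \<longleftrightarrow> t \<in> set ts"
    if "list_all2 represents ts Hs" "set ts \<subseteq> set listed_trees" for ts Hs
    unfolding ex_iso_iff[OF that(1) nomulti_digraph_axioms]
    using that(2) t realizes_listed_unique by blast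
  have sub: "set co_connected_trees \<subseteq> set listed_trees" "set no_isolated_no_P3_trees \<subseteq> set listed_trees"
    "set P3_trees \<subseteq> set listed_trees" "set five_components_trees \<subseteq> set listed_trees"
    "set four_components_trees \<subseteq> set listed_trees" "set three_components_trees \<subseteq> set listed_trees"
    "set two_components_trees \<subseteq> set listed_trees"
    by (auto simp: listed_trees_def)
  have connected: "connected G \<longleftrightarrow> length (union_parts t) = 1"
    by (simp add: connected_iff_card_sccs card_sccs_union_parts[OF t(2)])
  have isolated: "card (isolated_vertices G) = count_list (degrees t) 0"
    by (rule card_isolated_vertices[OF t(2)])
  have "finite (isolated_vertices G)" by (simp add: isolated_vertices_def)
  then have no_isolated: "isolated_vertices G = {} \<longleftrightarrow> count_list (degrees t) 0 = 0"
    using isolated by (metis card_0_eq)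
  have P3: "(\<exists>C\<in>components G. C \<simeq> P\<^sub>3) \<longleftrightarrow> has_P3_part t"
  proof
    assume "\<exists>C\<in>components G. C \<simeq> P\<^sub>3"
    then obtain c where "c \<in> set (union_parts t)" "sort (degrees c) = sort (degrees P3_tree)"
      using ex_component_iso_imp[OF t(2) represents_nomulti represents_realizes] represents_P3 by blast
    then show "has_P3_part t"
      using listed_union_parts_P3[OF t(1)] by (auto simp: has_P3_part_def list_ex_iff)
  next
    assume "has_P3_part t"
    then obtain c where "c \<in> set (union_parts t)" "normalize c = P3_tree"
      by (auto simp: has_P3_part_def list_ex_iff)
    moreover have "normalize P3_tree = P3_tree" by code_simp
    ultimately show "\<exists>C\<in>components G. C \<simeq> P\<^sub>3"
      using ex_component_isoI[OF t(2) represents_nomulti[OF represents_P3] represents_realizes[OF represents_P3]]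
      by simp
  qed
  note classification = listed_classification[OF t(1)]
  show "connected G \<longleftrightarrow> (\<exists>H\<in>set co_connected_summands. complement G \<simeq> P\<^sub>3 \<uplus> H)"
  proof -
    \<comment> \<open>Only this class speaks about the complement of \<open>G\<close>; its cotrees
      are complemented to obtain cotrees of \<open>G\<close>.\<close>
    have "(\<exists>H\<in>set co_connected_summands. complement G \<simeq> P\<^sub>3 \<uplus> H) \<longleftrightarrow>
        (\<exists>H\<in>set (map (\<lambda>H. P\<^sub>3 \<uplus> H) co_connected_summands). complement G \<simeq> H)" by simp
    also have "\<dots> \<longleftrightarrow> (\<exists>s\<in>set (map co_tree co_connected_trees).
        realizes s (verts (complement G)) (adj (complement G)))"
      by (rule ex_iso_iff[OF represents_co_connected nomulti_with_proj[OF pair_wf_complement]])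
    also have "\<dots> \<longleftrightarrow> (\<exists>s\<in>set co_connected_trees. realizes s (verts G) (adj G))"
      by (simp only: realizes_complement_iff[OF assms] set_map bex_simps co_tree_co_tree)
    also have "\<dots> \<longleftrightarrow> t \<in> set co_connected_trees"
      using sub(1) t realizes_listed_unique by blast
    finally show ?thesis using classification(1) connected by simp
  qed
  show "\<not> connected G \<and> isolated_vertices G = {} \<and> \<not> (\<exists>C\<in>components G. C \<simeq> P\<^sub>3) \<longleftrightarrow>
      (\<exists>H\<in>set no_isolated_no_P3_obstructions. G \<simeq> H)"
    unfolding ex_iff[OF represents_no_isolated_no_P3 sub(2)] connected no_isolated P3 by (rule classification(2))
  show "\<not> connected G \<and> (\<exists>C\<in>components G. C \<simeq> P\<^sub>3) \<longleftrightarrow> (\<exists>H\<in>set P3_summands. G \<simeq> P\<^sub>3 \<uplus> H)"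
    using ex_iff[OF represents_P3_summands sub(3)] classification(3) unfolding connected P3 by simp
  show "card (components G) = 5 \<longleftrightarrow>
      G \<simeq> five_components_obstruction \<or> (\<exists>p\<in>{1, 2, 3, 4}. G \<simeq> five_components_family p)"
    using ex_iff[OF represents_five_components sub(4)] classification(4)
    unfolding card_sccs_union_parts[OF t(2)] by simp
  show "card (components G) = 4 \<and> isolated_vertices G \<noteq> {} \<longleftrightarrow>
      (\<exists>H\<in>set four_components_summands. G \<simeq> 3 \<cdot> K\<^sub>1 \<uplus> H) \<or>
      (\<exists>p\<in>{1, 2, 3}. G \<simeq> four_components_family p)"
    using ex_iff[OF represents_four_components sub(5)] classification(5)
    unfolding card_sccs_union_parts[OF t(2)] no_isolated by (simp add: bex_Un) blast
  show "card (components G) = 3 \<and> isolated_vertices G \<noteq> {} \<longleftrightarrow>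
      (\<exists>H\<in>set three_components_summands. G \<simeq> 2 \<cdot> K\<^sub>1 \<uplus> H) \<or>
      (\<exists>p\<in>{1, 2}. G \<simeq> three_components_family p)"
    using ex_iff[OF represents_three_components sub(6)] classification(6)
    unfolding card_sccs_union_parts[OF t(2)] no_isolated by (simp add: bex_Un) blast
  show "card (components G) = 2 \<and> card (isolated_vertices G) = 1 \<longleftrightarrow>
      (\<exists>H\<in>set two_components_summands. G \<simeq> K\<^sub>1 \<uplus> (K\<^sub>1 \<oplus> H))"
    using ex_iff[OF represents_two_components sub(7)] classification(7)
    unfolding card_sccs_union_parts[OF t(2)] isolated by simp
qed

end
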